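(* Let $\mu\in\mathbb{R}$ and $\mathfrak{P}_U=\frac{\sigma}{4\pi}$. For any Borel set $A\subseteq\mathbb{S}^2$, any $t>0$ and any Borel probability measure $\mathfrak{P}$ on $\mathbb{S}^2$, $$\lim_{s\to+\infty}\mathbb{P}_{\mathfrak{P}}(W^\mu_\Phi(s)\in A)=\frac{\sigma(A)}{4\pi}=\mathbb{P}_{\mathfrak{P}_U}(W^\mu_\Phi(t)\in A).$$
   Context: $\mathbb{S}^2\subset\mathbb{R}^3$ is the unit sphere with the round metric $g$ and surface measure $\sigma$ (so $\sigma(\mathbb{S}^2)=4\pi$). $\Delta_g$ is the Laplace–Beltrami operator, $X_\mu$ is the smooth vector field equal to $\mu\,\partial/\partial\varphi$ in spherical coordinates $(\sin\theta\cos\varphi,\sin\theta\sin\varphi,\cos\theta)$ (zero at the poles), and $\mathcal{G}_\mu=\Delta_g+X_\mu$. $\Phi(\lambda)=\int_0^{+\infty}(1-e^{-\lambda t})\nu_\Phi(dt)$, $\lambda\ge0$, where $\nu_\Phi$ is a measure on $(0,+\infty)$ with $\int_0^{+\infty}(1\wedge t)\nu_\Phi(dt)<\infty$ and $\nu_\Phi(0,+\infty)=+\infty$. $S_\Phi$ is a subordinator (increasing Lévy process with $S_\Phi(0)=0$) with $\mathbb{E}[e^{-\lambda S_\Phi(t)}]=e^{-t\Phi(\lambda)}$, and $L_\Phi(t)=\inf\{s>0:S_\Phi(s)>t\}$. $W^\mu$ is the diffusion (Feller) process on $\mathbb{S}^2$ generated by $\mathcal{G}_\mu$, $S_\Phi$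 is independent of $W^\mu$, and $W^\mu_\Phi(t):=W^\mu(L_\Phi(t))$. For a Borel probability measure $\mathfrak{P}$, $\mathbb{P}_{\mathfrak{P}}$ is the probability under which the initial position $W^\mu(0)=W^\mu_\Phi(0)$ has law $\mathfrak{P}$. *)

theory Defs
  imports "HOL-Probability.Probability"
begin

section \<open>The unit sphere\<close>

abbreviation S2 :: "(real^3) set"
  where "S2 \<equiv> sphere 0 1"

abbreviation S2_borel :: "(real^3) measure"
  where "S2_borel \<equiv> restrict_space borel S2"

definition sph :: "real \<times> real \<Rightarrow> real^3"
  where "sph = (\<lambda>(\<theta>, \<phi>). vector [sin \<theta> * cos \<phi>, sin \<theta> * sin \<phi>, cos \<theta>])"

text \<open>
  The metric is \<open>d\<theta>\<^sup>2 + sin\<^sup>2 \<theta> d\<phi>\<^sup>2\<close> in spherical coordinates, so its volume element is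
  \<open>sin \<theta> d\<theta> d\<phi>\<close>; the coordinates miss (or hit several times) only a null set.
\<close>

definition sphere_measure :: "(real^3) measure"
  where "sphere_measure =
    distr (density (restrict_space lborel ({0..pi} \<times> {0..2 * pi})) (\<lambda>(\<theta>, \<phi>). ennreal (sin \<theta>)))
      S2_borel sph"

definition uniform_S2 :: "(real^3) measure"
  where "uniform_S2 = scale_measure (ennreal (1 / (4 * pi))) sphere_measure"


section \<open>Differential calculus on the sphere\<close>

primrec Ck_on :: "nat \<Rightarrow> ('a::euclidean_space \<Rightarrow> real) \<Rightarrow> 'a set \<Rightarrow> bool" where
  "Ck_on 0 f U \<longleftrightarrow> continuous_on U f"
| "Ck_on (Suc k) f U \<longleftrightarrow>
    (\<forall>x\<in>U. f differentiable (at x)) \<and> (\<forall>v. Ck_on k (\<lambda>x. frechet_derivative f (at x) v) U)"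

text \<open>
  Functions and vector fields on the sphere are represented by functions on the ambient space whose
  values off the sphere are irrelevant. Composing with the smooth retraction \<open>y \<mapsto> y / |y|\<close> of
  the punctured space onto the sphere makes the ambient notions of smoothness and derivative
  available without dependence on those values.
\<close>

definition radial_ext :: "(real^3 \<Rightarrow> 'b) \<Rightarrow> real^3 \<Rightarrow> 'b"
  where "radial_ext f = (\<lambda>y. f (y /\<^sub>R norm y))"

definition smooth_on_S2 :: "(real^3 \<Rightarrow> real) \<Rightarrow> bool"
  where "smooth_on_S2 f \<longleftrightarrow> (\<forall>k. Ck_on k (radial_ext f) (- {0}))"

text \<open>The differential at \<open>x\<close>, to be applied to tangent vectors \<open>v\<close>, i.e. \<open>x \<bullet> v = 0\<close>.\<close>

definition sphere_diff :: "(real^3 \<Rightarrow> 'b::real_normed_vector) \<Rightarrow> real^3 \<Rightarrow> real^3 \<Rightarrow> 'b"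
  where "sphere_diff f x = frechet_derivative (radial_ext f) (at x)"

definition tangent_proj :: "real^3 \<Rightarrow> real^3 \<Rightarrow> real^3"
  where "tangent_proj x v = v - (x \<bullet> v) *\<^sub>R x"

definition sphere_grad :: "(real^3 \<Rightarrow> real) \<Rightarrow> real^3 \<Rightarrow> real^3"
  where "sphere_grad f x =
    (THE w. x \<bullet> w = 0 \<and> (\<forall>v. x \<bullet> v = 0 \<longrightarrow> sphere_diff f x v = w \<bullet> v))"

text \<open>
  The Levi-Civita connection of the induced metric is the tangential part of the ambient
  derivative. The divergence is the trace of \<open>v \<mapsto> \<nabla>\<^sub>v X\<close> on the tangent space; precomposing with
  the projection extends this map by \<open>0\<close> to the normal line, which does not change the trace.
\<close>

definition sphere_cov :: "(real^3 \<Rightarrow> real^3) \<Rightarrow> real^3 \<Rightarrow> real^3 \<Rightarrow> real^3"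
  where "sphere_cov X x v = tangent_proj x (sphere_diff X x v)"

definition sphere_div :: "(real^3 \<Rightarrow> real^3) \<Rightarrow> real^3 \<Rightarrow> real"
  where "sphere_div X x = (\<Sum>b\<in>Basis. sphere_cov X x (tangent_proj x b) \<bullet> b)"

definition laplace_beltrami :: "(real^3 \<Rightarrow> real) \<Rightarrow> real^3 \<Rightarrow> real"
  where "laplace_beltrami f = sphere_div (sphere_grad f)"

definition drift_field :: "real \<Rightarrow> real^3 \<Rightarrow> real^3"
  where "drift_field \<mu> x = \<mu> *\<^sub>R vector [- (x $ 2), x $ 1, 0]"

definition gen_op :: "real \<Rightarrow> (real^3 \<Rightarrow> real) \<Rightarrow> real^3 \<Rightarrow> real"
  where "gen_op \<mu> f x = laplace_beltrami f x + sphere_diff f x (drift_field \<mu> x)"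


section \<open>Feller processes on the sphere\<close>

definition feller_transition :: "(real \<Rightarrow> real^3 \<Rightarrow> (real^3) measure) \<Rightarrow> bool"
  where "feller_transition K \<longleftrightarrow>
    (\<forall>t\<ge>0. K t \<in> S2_borel \<rightarrow>\<^sub>M prob_algebra S2_borel) \<and>
    (\<forall>x\<in>S2. K 0 x = return S2_borel x) \<and>
    (\<forall>s\<ge>0. \<forall>t\<ge>0. \<forall>x\<in>S2. K (s + t) x = K s x \<bind> K t) \<and>
    (\<forall>f::real^3 \<Rightarrow> real. continuous_on S2 f \<longrightarrow>
      (\<forall>t\<ge>0. continuous_on S2 (\<lambda>x. \<integral>y. f y \<partial>K t x)) \<and>
      uniform_limit S2 (\<lambda>t x. \<integral>y. f y \<partial>K t x) f (at_right 0))"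

definition in_generator ::
  "(real \<Rightarrow> real^3 \<Rightarrow> (real^3) measure) \<Rightarrow> (real^3 \<Rightarrow> real) \<Rightarrow> (real^3 \<Rightarrow> real) \<Rightarrow> bool"
  where "in_generator K f g \<longleftrightarrow> continuous_on S2 f \<and> continuous_on S2 g \<and>
    uniform_limit S2 (\<lambda>t x. ((\<integral>y. f y \<partial>K t x) - f x) / t) g (at_right 0)"

text \<open>
  \<open>K\<close> is generated by the differential operator \<open>gen_op \<mu>\<close>: its generator on the continuous
  functions (with the uniform norm) is the closure of \<open>gen_op \<mu>\<close> defined on the smooth functions.
\<close>

definition generated_by :: "(real \<Rightarrow> real^3 \<Rightarrow> (real^3) measure) \<Rightarrow> real \<Rightarrow> bool"
  where "generated_by K \<mu> \<longleftrightarrow> (\<forall>f g. in_generator K f g \<longleftrightarrow>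
    continuous_on S2 f \<and> continuous_on S2 g \<and>
    (\<exists>u::nat \<Rightarrow> real^3 \<Rightarrow> real. (\<forall>n. smooth_on_S2 (u n)) \<and>
      uniform_limit S2 u f sequentially \<and>
      uniform_limit S2 (\<lambda>n. gen_op \<mu> (u n)) g sequentially))"

definition process_sigma ::
  "'w measure \<Rightarrow> 'e measure \<Rightarrow> (real \<Rightarrow> 'w \<Rightarrow> 'e) \<Rightarrow> real set \<Rightarrow> 'w measure"
  where "process_sigma M E X T =
    sigma (space M) (\<Union>t\<in>T. {X t -` B \<inter> space M | B. B \<in> sets E})"

text \<open>
  A diffusion: Markov process (for its natural filtration) with continuous paths, transition
  function \<open>K\<close> and initial law \<open>I\<close>.
\<close>

definition diffusion_process ::
  "'w measure \<Rightarrow> (real \<Rightarrow> real^3 \<Rightarrow> (real^3) measure) \<Rightarrow> (real^3) measure \<Rightarrow>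
    (real \<Rightarrow> 'w \<Rightarrow> real^3) \<Rightarrow> bool"
  where "diffusion_process M K I W \<longleftrightarrow>
    (\<forall>t\<ge>0. W t \<in> M \<rightarrow>\<^sub>M S2_borel) \<and>
    (\<forall>\<omega>\<in>space M. continuous_on {0..} (\<lambda>t. W t \<omega>)) \<and>
    distr M S2_borel (W 0) = I \<and>
    (\<forall>s\<ge>0. \<forall>t\<ge>0. \<forall>B\<in>sets S2_borel. AE \<omega> in M.
      real_cond_exp M (process_sigma M S2_borel W {0..s}) (\<lambda>\<omega>'. indicator B (W (s + t) \<omega>')) \<omega>
        = measure (K t (W s \<omega>)) B)"


section \<open>Subordinators and their inverses\<close>

definition levy_measure_inf :: "real measure \<Rightarrow> bool"
  where "levy_measure_inf \<nu> \<longleftrightarrow>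
    sets \<nu> = sets (restrict_space borel {0<..}) \<and>
    (\<integral>\<^sup>+t. ennreal (min 1 t) \<partial>\<nu>) < \<infinity> \<and>
    emeasure \<nu> {0<..} = \<infinity>"

definition laplace_exponent :: "real measure \<Rightarrow> real \<Rightarrow> real"
  where "laplace_exponent \<nu> z = (\<integral>t. 1 - exp (- z * t) \<partial>\<nu>)"

definition levy_process :: "'w measure \<Rightarrow> (real \<Rightarrow> 'w \<Rightarrow> real) \<Rightarrow> bool"
  where "levy_process M S \<longleftrightarrow>
    (\<forall>t\<ge>0. S t \<in> borel_measurable M) \<and>
    (\<forall>\<omega>\<in>space M. S 0 \<omega> = 0) \<and>
    (\<forall>\<omega>\<in>space M. \<forall>t\<ge>0. continuous (at_right t) (\<lambda>r. S r \<omega>)) \<and>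
    (\<forall>\<omega>\<in>space M. \<forall>t>0. \<exists>l. ((\<lambda>r. S r \<omega>) \<longlongrightarrow> l) (at_left t)) \<and>
    (\<forall>s\<ge>0. \<forall>t\<ge>s. distr M borel (\<lambda>\<omega>. S t \<omega> - S s \<omega>) = distr M borel (S (t - s))) \<and>
    (\<forall>(n::nat) (\<tau>::nat \<Rightarrow> real). 0 \<le> \<tau> 0 \<longrightarrow> mono \<tau> \<longrightarrow>
      prob_space.indep_vars M (\<lambda>_. borel) (\<lambda>i \<omega>. S (\<tau> (Suc i)) \<omega> - S (\<tau> i) \<omega>) {..<n})"

definition subordinator :: "'w measure \<Rightarrow> real measure \<Rightarrow> (real \<Rightarrow> 'w \<Rightarrow> real) \<Rightarrow> bool"
  where "subordinator M \<nu> S \<longleftrightarrow>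
    levy_process M S \<and>
    (\<forall>\<omega>\<in>space M. mono_on {0..} (\<lambda>t. S t \<omega>)) \<and>
    (\<forall>t\<ge>0. \<forall>z\<ge>0. prob_space.expectation M (\<lambda>\<omega>. exp (- z * S t \<omega>))
      = exp (- t * laplace_exponent \<nu> z))"

text \<open>
  The infimum is over a nonempty set almost surely. The value \<open>0\<close> on the exceptional event replaces
  the unspecified real number \<open>Inf {}\<close>, which could be negative.
\<close>

definition inverse_process :: "(real \<Rightarrow> 'w \<Rightarrow> real) \<Rightarrow> real \<Rightarrow> 'w \<Rightarrow> real"
  where "inverse_process S t \<omega> =
    (if \<exists>s>0. S s \<omega> > t then Inf {s. s > 0 \<and> S s \<omega> > t} else 0)"

definition time_changed ::
  "(real \<Rightarrow> 'w \<Rightarrow> real^3) \<Rightarrow> (real \<Rightarrow> 'w \<Rightarrow> real) \<Rightarrow> real \<Rightarrow> 'w \<Rightarrow> real^3"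
  where "time_changed W S t \<omega> = W (inverse_process S t \<omega>) \<omega>"

definition indep_processes ::
  "'w measure \<Rightarrow> (real \<Rightarrow> 'w \<Rightarrow> real^3) \<Rightarrow> (real \<Rightarrow> 'w \<Rightarrow> real) \<Rightarrow> bool"
  where "indep_processes M W S \<longleftrightarrow>
    prob_space.indep_set M (sets (process_sigma M S2_borel W {0..})) (sets (process_sigma M borel S {0..}))"


section \<open>Consistency checks\<close>

lemma sph_components:
  "sph (\<theta>, \<phi>) $ 1 = sin \<theta> * cos \<phi>" "sph (\<theta>, \<phi>) $ 2 = sin \<theta> * sin \<phi>" "sph (\<theta>, \<phi>) $ 3 = cos \<theta>"
  by (simp_all add: sph_def vector_3)

lemma sph_expand:
  "sph = (\<lambda>(\<theta>, \<phi>). (sin \<theta> * cos \<phi>) *\<^sub>R axis 1 1 + (sin \<theta> * sin \<phi>) *\<^sub>R axis 2 1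
    + cos \<theta> *\<^sub>R axis 3 1)"
  by (auto simp: fun_eq_iff vec_eq_iff forall_3 sph_components axis_def)

lemma sph_in_S2: "sph p \<in> S2"
proof -
  obtain \<theta> \<phi> where p: "p = (\<theta>, \<phi>)" by fastforce
  have "(sin \<theta> * cos \<phi>)\<^sup>2 + (sin \<theta> * sin \<phi>)\<^sup>2 + (cos \<theta>)\<^sup>2
      = (sin \<theta>)\<^sup>2 * ((cos \<phi>)\<^sup>2 + (sin \<phi>)\<^sup>2) + (cos \<theta>)\<^sup>2"
    by (simp only: power_mult_distrib distrib_left)
  then have "(sin \<theta> * cos \<phi>)\<^sup>2 + (sin \<theta> * sin \<phi>)\<^sup>2 + (cos \<theta>)\<^sup>2 = 1"
    by simp
  then show ?thesis
    by (simp add: p norm_vec_def L2_set_def sum_3 sph_components)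
qed

text \<open>The drift is \<open>\<mu> \<partial>/\<partial>\<phi>\<close>, in Cartesian components.\<close>

lemma drift_field_sph:
  "((\<lambda>\<phi>. \<mu> *\<^sub>R sph (\<theta>, \<phi>)) has_vector_derivative drift_field \<mu> (sph (\<theta>, \<phi>))) (at \<phi>)"
proof -
  have "((\<lambda>\<phi>. sph (\<theta>, \<phi>)) has_vector_derivative
      (sin \<theta> * (- sin \<phi>)) *\<^sub>R axis 1 1 + (sin \<theta> * cos \<phi>) *\<^sub>R axis 2 1) (at \<phi>)"
    unfolding sph_expand prod.case has_vector_derivative_def
    by (auto intro!: derivative_eq_intros simp: fun_eq_iff algebra_simps)
  then have "((\<lambda>\<phi>. \<mu> *\<^sub>R sph (\<theta>, \<phi>)) has_vector_derivative
      \<mu> *\<^sub>R ((sin \<theta> * (- sin \<phi>)) *\<^sub>R axis 1 1 + (sin \<theta> * cos \<phi>) *\<^sub>R axis 2 1)) (at \<phi>)"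
    by (intro bounded_linear.has_vector_derivative[OF bounded_linear_scaleR_right])
  also have "\<mu> *\<^sub>R ((sin \<theta> * (- sin \<phi>)) *\<^sub>R axis 1 1 + (sin \<theta> * cos \<phi>) *\<^sub>R axis 2 1)
      = drift_field \<mu> (sph (\<theta>, \<phi>))"
    unfolding vec_eq_iff forall_3 by (simp add: drift_field_def sph_components axis_def)
  finally show ?thesis .
qed

lemma measurable_sph: "sph \<in> borel \<rightarrow>\<^sub>M S2_borel"
proof (rule measurable_restrict_space2)
  show "sph \<in> space borel \<rightarrow> S2" using sph_in_S2 by blast
  have "continuous_on UNIV sph"
    unfolding sph_expand case_prod_beta by (intro continuous_intros)
  then show "sph \<in> borel_measurable borel" by (rule borel_measurable_continuous_onI)
qed

lemma emeasure_sphere_measure: "emeasure sphere_measure S2 = ennreal (4 * pi)"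
proof -
  let ?B = "{0..pi} \<times> {0..2 * pi} :: (real \<times> real) set"
  have sin0: "x \<in> {0..pi} \<Longrightarrow> 0 \<le> sin x" for x :: real by (auto intro: sin_ge_zero)
  have B: "?B \<in> sets borel" by (auto simp: borel_prod[symmetric])
  have [measurable]: "(\<lambda>(\<theta>, \<phi>). ennreal (sin \<theta>)) \<in> borel_measurable (borel :: (real \<times> real) measure)"
    by (auto simp: borel_prod[symmetric])
  let ?D = "density (restrict_space lborel ?B) (\<lambda>(\<theta>, \<phi>). ennreal (sin \<theta>))"
  have "sph \<in> ?D \<rightarrow>\<^sub>M S2_borel"
    using measurable_restrict_space1[OF measurable_sph] by (simp cong: measurable_cong_sets sets_restrict_space_cong)
  moreover have "sph -` S2 \<inter> space ?D = ?B"
    using sph_in_S2 by (auto simp: space_restrict_space)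
  ultimately have "emeasure sphere_measure S2 = emeasure ?D ?B"
    unfolding sphere_measure_def by (subst emeasure_distr) (auto simp: sets_restrict_space intro: image_eqI[of _ _ UNIV])
  also have "\<dots> = (\<integral>\<^sup>+p\<in>?B. ennreal (sin (fst p)) \<partial>lborel)"
    using B by (subst emeasure_density)
      (auto simp: sets_restrict_space_iff nn_integral_restrict_space case_prod_beta
        intro!: measurable_restrict_space1 nn_integral_cong split: split_indicator)
  also have "\<dots> = (\<integral>\<^sup>+\<theta>. \<integral>\<^sup>+\<phi>. ennreal (sin \<theta>) * indicator ?B (\<theta>, \<phi>) \<partial>lborel \<partial>lborel)"
    unfolding lborel_prod[symmetric]
    by (subst lborel.nn_integral_fst[symmetric]) auto
  also have "\<dots> = (\<integral>\<^sup>+\<theta>. ennreal (2 * pi) * (ennreal (sin \<theta>) * indicator {0..pi} \<theta>) \<partial>lborel)"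
    by (intro nn_integral_cong) (auto simp: indicator_times nn_integral_cmult mult_ac)
  also have "\<dots> = ennreal (2 * pi) * ennreal ((- cos pi) - (- cos 0))"
    by (subst nn_integral_cmult, simp, subst nn_integral_FTC_Icc[where F = "\<lambda>x. - cos x"])
      (auto intro!: derivative_eq_intros sin_ge_zero)
  also have "\<dots> = ennreal (4 * pi)"
    by (subst ennreal_mult[symmetric]) auto
  finally show ?thesis .
qed

end

theory Submission
  imports Defs
begin

text \<open>
  Write \<open>L\<^sub>1, L\<^sub>2, L\<^sub>3\<close> for the derivatives along the three infinitesimal rotations
  \<open>x \<mapsto> e\<^sub>i \<times> x\<close>. On the sphere \<open>\<Delta> = L\<^sub>1\<^sup>2 + L\<^sub>2\<^sup>2 + L\<^sub>3\<^sup>2\<close> and the drift is \<open>\<mu> L\<^sub>3\<close>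
  (\<open>gen_op_polyf\<close>), so the generator \<open>G\<close> acts on polynomials on \<open>\<real>\<^sup>3\<close> without raising the degree.
  Hence each polynomial \<open>f\<close> lies in a finite dimensional \<open>G\<close>-stable space, the equation
  \<open>u' = G u\<close>, \<open>u\<^sub>0 = f\<close> is a linear ordinary differential equation there (\<open>rot_gen_flow\<close>), and
  its solution is the action of the transition function on \<open>f\<close> (\<open>T_eq_flow\<close>).

  Everything then rests on the Bakry-Emery argument. Put \<open>\<Gamma>(f) = \<Sum>\<^sub>i (L\<^sub>i f)\<^sup>2\<close>. The commutation
  relations of the rotations give \<open>G \<Gamma>(f) - 2 \<Sum>\<^sub>i L\<^sub>i f \<cdot> L\<^sub>i G f = 2 \<Sum>\<^sub>i\<^sub>j (L\<^sub>j L\<^sub>i f)\<^sup>2 \<ge> 0\<close>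
  (\<open>bochner_identity\<close>): the drift contributes nothing because it is itself a rotation.
  Therefore \<open>2 \<tau> \<Gamma>(u\<^sub>\<tau>) + u\<^sub>\<tau>\<^sup>2\<close> is a subsolution of the heat equation of \<open>G\<close>, and comparison with
  its initial value \<open>f\<^sup>2\<close> gives \<open>2 t \<Gamma>(u\<^sub>t) \<le> 1\<close> if \<open>\<bar>f\<bar> \<le> 1\<close> (\<open>gradient_bound\<close>). So the
  oscillation of \<open>u\<^sub>t\<close> over the sphere is \<open>O(t\<^bsup>-1/2\<^esup>)\<close> with a constant that depends on nothing
  but the bound of \<open>f\<close>. Each \<open>L\<^sub>i\<close> integrates to \<open>0\<close> over the sphere (\<open>integral_rot_zero\<close>), so
  the mean of \<open>u\<^sub>t\<close> is constant in \<open>t\<close>.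

  Since the estimate is uniform in \<open>f\<close>, the Stone-Weierstrass theorem and inner regularity turn it
  into a bound on the total variation distance between the transition probabilities and the
  uniform law (\<open>K_close_to_uniform\<close>). This is what makes the limit hold for every Borel set \<open>A\<close>
  and not only for those with a null boundary. The same device shows that the uniform law is
  invariant (\<open>uniform_invariant\<close>).

  Finally, the inverse subordinator at time \<open>s\<close> is independent of the diffusion, so that
  the law of the time-changed process is the average of the laws of the diffusion over this random
  time (\<open>time_changed_prob\<close>). It tends to infinity almost surely as \<open>s\<close> grows
  (\<open>subordinator_unbounded\<close>, \<open>inverse_process_at_top\<close>), and dominated convergence gives the limit;
  the invariant law is unchanged by averaging over a random time.
\<close>

section \<open>Rotation fields acting on polynomials\<close>

text \<open>
  The vector fields \<open>x \<mapsto> e\<^sub>i \<times> x\<close> live on all of \<open>\<real>\<^sup>3\<close> and are tangent to every sphere around the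
  origin, so identities between them can be proved for polynomials on \<open>\<real>\<^sup>3\<close> with no restriction
  to the sphere.
\<close>

definition rot :: "3 \<Rightarrow> (real^3 \<Rightarrow> real) \<Rightarrow> real^3 \<Rightarrow> real"
  where "rot i f x = frechet_derivative f (at x) (cross3 (axis i 1) x)"

definition rot_gen :: "real \<Rightarrow> (real^3 \<Rightarrow> real) \<Rightarrow> real^3 \<Rightarrow> real"
  where "rot_gen \<mu> f x = (\<Sum>i\<in>UNIV. rot i (rot i f) x) + \<mu> * rot 3 f x"

abbreviation polyf :: "(real^3 \<Rightarrow> real) \<Rightarrow> bool"
  where "polyf \<equiv> real_polynomial_function"

lemma polyf_has_derivative:
  "polyf f \<Longrightarrow> (f has_derivative frechet_derivative f (at x)) (at x)"
  using differentiable_at_real_polynomial_function frechet_derivative_works by blast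

lemma polyf_continuous_on: "polyf f \<Longrightarrow> continuous_on A f"
  by (meson continuous_real_polymonial_function continuous_at_imp_continuous_on)

lemma polyf_nth: "polyf (\<lambda>x. x $ i)"
  by (intro real_polynomial_function.intros(1) bounded_linear_vec_nth)

lemma rot_eqI:
  assumes "(f has_derivative f') (at x)"
  shows "rot i f x = f' (cross3 (axis i 1) x)"
  using frechet_derivative_at[OF assms] by (simp add: rot_def)

lemma rot_linear: "bounded_linear f \<Longrightarrow> rot i f = (\<lambda>x. f (cross3 (axis i 1) x))"
  by (intro ext rot_eqI bounded_linear_imp_has_derivative)

lemma rot_const: "rot i (\<lambda>x. c) = (\<lambda>x. 0)"
  by (rule ext, subst rot_eqI[where f' = "\<lambda>_. 0"]) (auto intro: derivative_intros)

lemma rot_add: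
  assumes "polyf f" "polyf g"
  shows "rot i (\<lambda>x. f x + g x) = (\<lambda>x. rot i f x + rot i g x)"
  unfolding rot_def[of i f] rot_def[of i g]
  by (intro ext rot_eqI has_derivative_add polyf_has_derivative assms)

lemma rot_diff:
  assumes "polyf f" "polyf g"
  shows "rot i (\<lambda>x. f x - g x) = (\<lambda>x. rot i f x - rot i g x)"
  unfolding rot_def[of i f] rot_def[of i g]
  by (intro ext rot_eqI has_derivative_diff polyf_has_derivative assms)

lemma rot_mult:
  assumes "polyf f" "polyf g"
  shows "rot i (\<lambda>x. f x * g x) = (\<lambda>x. f x * rot i g x + rot i f x * g x)"
  unfolding rot_def[of i f] rot_def[of i g]
  by (intro ext rot_eqI has_derivative_mult polyf_has_derivative assms)

lemma rot_cmult: "polyf f \<Longrightarrow> rot i (\<lambda>x. c * f x) = (\<lambda>x. c * rot i f x)"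
  by (simp add: rot_mult rot_const real_polynomial_function.intros(2))

lemma bounded_linear_cross_right: "bounded_linear (cross3 v)"
  using bilinear_cross by (simp add: bilinear_def linear_linear)

lemma polyf_rot: "polyf f \<Longrightarrow> polyf (rot i f)"
proof (induction f rule: real_polynomial_function.induct)
  case (linear f)
  then show ?case
    unfolding rot_linear[OF linear]
    by (intro real_polynomial_function.intros(1) bounded_linear_compose[OF linear] bounded_linear_cross_right)
qed (auto simp: rot_const rot_add rot_mult)

lemmas polyf_intros = real_polynomial_function.intros(2-4)
  real_polynomial_function_diff real_polynomial_function_power
  real_polynomial_function_sum polyf_rot polyf_nth

lemma rot_sum:
  assumes "finite J" "\<And>j. j \<in> J \<Longrightarrow> polyf (f j)"
  shows "rot i (\<lambda>x. \<Sum>j\<in>J. f j x) = (\<lambda>x. \<Sum>j\<in>J. rot i (f j) x)"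
  using assms
proof (induction J rule: finite_induct)
  case (insert j J)
  then have "rot i (\<lambda>x. f j x + (\<Sum>j\<in>J. f j x)) = (\<lambda>x. rot i (f j) x + rot i (\<lambda>x. \<Sum>j\<in>J. f j x) x)"
    by (intro rot_add polyf_intros) auto
  with insert show ?case by simp
qed (simp add: rot_const)

text \<open>
  The commutator of two derivations is a derivation, so the relations propagate from linear
  functions to all polynomials. For a linear function they are the Jacobi identity of the cross
  product.
\<close>

lemma rot_commutator:
  assumes "polyf f"
  shows "rot 2 (rot 1 f) x = rot 1 (rot 2 f) x + rot 3 f x"
    and "rot 3 (rot 2 f) x = rot 2 (rot 3 f) x + rot 1 f x"
    and "rot 1 (rot 3 f) x = rot 3 (rot 1 f) x + rot 2 f x"
proof -
  have "\<forall>x. rot 2 (rot 1 f) x = rot 1 (rot 2 f) x + rot 3 f x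
      \<and> rot 3 (rot 2 f) x = rot 2 (rot 3 f) x + rot 1 f x
      \<and> rot 1 (rot 3 f) x = rot 3 (rot 1 f) x + rot 2 f x"
    using assms
  proof (induction f rule: real_polynomial_function.induct)
    case (linear f)
    have bl: "bounded_linear (\<lambda>x. f (cross3 (axis i 1) x))" for i
      by (intro bounded_linear_compose[OF linear] bounded_linear_cross_right)
    have f: "f (x + y) = f x + f y" "f (x - y) = f x - f y" for x y
      using linear by (auto simp: bounded_linear.linear linear_add linear_diff)
    show ?case
      unfolding rot_linear[OF linear] rot_linear[OF bl] f[symmetric]
      by (auto intro!: arg_cong[where f = f] simp: vec_eq_iff forall_3 cross3_def axis_def)
  next
    case (add f g)
    then show ?case by (simp add: rot_add polyf_rot)
  next
    case (mult f g)
    then show ?case by (simp add: rot_add rot_mult polyf_intros algebra_simps)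
  qed (simp add: rot_const)
  then show "rot 2 (rot 1 f) x = rot 1 (rot 2 f) x + rot 3 f x"
    and "rot 3 (rot 2 f) x = rot 2 (rot 3 f) x + rot 1 f x"
    and "rot 1 (rot 3 f) x = rot 3 (rot 1 f) x + rot 2 f x" by blast+
qed

lemma polyf_rot_gen: "polyf f \<Longrightarrow> polyf (rot_gen \<mu> f)"
  unfolding rot_gen_def[abs_def] by (intro polyf_intros) auto

lemma rot_gen_const: "rot_gen \<mu> (\<lambda>x. c) = (\<lambda>x. 0)"
  by (simp add: rot_gen_def[abs_def] rot_const)

lemma rot_gen_add:
  "polyf f \<Longrightarrow> polyf g \<Longrightarrow> rot_gen \<mu> (\<lambda>x. f x + g x) = (\<lambda>x. rot_gen \<mu> f x + rot_gen \<mu> g x)"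
  by (simp add: rot_gen_def[abs_def] rot_add polyf_rot sum.distrib algebra_simps)

lemma rot_gen_cmult:
  "polyf f \<Longrightarrow> rot_gen \<mu> (\<lambda>x. c * f x) = (\<lambda>x. c * rot_gen \<mu> f x)"
  by (simp add: rot_gen_def[abs_def] rot_cmult polyf_rot sum_distrib_left algebra_simps)

lemma rot_gen_mult:
  assumes "polyf f" "polyf g"
  shows "rot_gen \<mu> (\<lambda>x. f x * g x) = (\<lambda>x. f x * rot_gen \<mu> g x + rot_gen \<mu> f x * g x
    + 2 * (\<Sum>i\<in>UNIV. rot i f x * rot i g x))"
  using assms
  by (simp add: rot_gen_def[abs_def] rot_add rot_mult polyf_rot polyf_intros sum.distrib sum_3 algebra_simps)

text \<open>
  For a unit vector \<open>x\<close> the vectors \<open>e\<^sub>i \<times> x\<close> form a Parseval frame of the tangent plane, so on the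
  sphere this is the squared length of the gradient.
\<close>

definition sq_gradient :: "(real^3 \<Rightarrow> real) \<Rightarrow> real^3 \<Rightarrow> real"
  where "sq_gradient f x = (\<Sum>i\<in>UNIV. rot i f x * rot i f x)"

text \<open>
  As \<open>rot_gen \<mu>\<close> is of second order, the left-hand side is the sum of the right-hand side and of
  \<open>2 \<Sum>\<^sub>i L\<^sub>i f \<cdot> [G, L\<^sub>i] f\<close>. The latter vanishes: \<open>\<Sum>\<^sub>i L\<^sub>i\<^sup>2\<close> is the Casimir operator of the rotations and commutes
  with each \<open>L\<^sub>i\<close>, while bracketing with \<open>L\<^sub>3\<close> rotates \<open>(L\<^sub>1 f, L\<^sub>2 f)\<close> by a right angle, which leaves
  the inner product of that vector with its rotation.
\<close>

lemma bochner_identity: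
  assumes "polyf f"
  shows "rot_gen \<mu> (sq_gradient f) x - 2 * (\<Sum>i\<in>UNIV. rot i f x * rot i (rot_gen \<mu> f) x)
    = 2 * (\<Sum>i\<in>UNIV. \<Sum>j\<in>UNIV. (rot j (rot i f) x)\<^sup>2)"
proof -
  note p = assms polyf_rot polyf_intros
  have c: "rot 2 (rot 1 g) = (\<lambda>x. rot 1 (rot 2 g) x + rot 3 g x)"
     "rot 3 (rot 2 g) = (\<lambda>x. rot 2 (rot 3 g) x + rot 1 g x)"
     "rot 3 (rot 1 g) = (\<lambda>x. rot 1 (rot 3 g) x - rot 2 g x)" if "polyf g" for g
    using rot_commutator[OF that] by (auto simp: fun_eq_iff)
  have *: "rot_gen \<mu> (sq_gradient f) x = 2 * (\<Sum>i\<in>UNIV. rot i f x * rot_gen \<mu> (rot i f) x)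
    + 2 * (\<Sum>i\<in>UNIV. \<Sum>j\<in>UNIV. (rot j (rot i f) x)\<^sup>2)"
    by (simp add: sq_gradient_def[abs_def] sum_3 rot_gen_mult rot_gen_add p power2_eq_square algebra_simps)
  have "(\<Sum>i\<in>UNIV. rot i f x * rot_gen \<mu> (rot i f) x) = (\<Sum>i\<in>UNIV. rot i f x * rot i (rot_gen \<mu> f) x)"
    by (simp add: rot_gen_def[abs_def] sum_3 rot_add rot_diff rot_cmult c p, simp add: algebra_simps)
  with * show ?thesis by simp
qed

section \<open>The generator on polynomials\<close>

definition pd :: "3 \<Rightarrow> (real^3 \<Rightarrow> real) \<Rightarrow> real^3 \<Rightarrow> real"
  where "pd i f x = frechet_derivative f (at x) (axis i 1)"

lemma pd_eqI:
  assumes "(f has_derivative f') (at x)"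
  shows "pd i f x = f' (axis i 1)"
  using frechet_derivative_at[OF assms] by (simp add: pd_def)

lemma pd_add: "polyf f \<Longrightarrow> polyf g \<Longrightarrow> pd i (\<lambda>x. f x + g x) = (\<lambda>x. pd i f x + pd i g x)"
  unfolding pd_def[of i f] pd_def[of i g] by (intro ext pd_eqI has_derivative_add polyf_has_derivative)

lemma pd_diff: "polyf f \<Longrightarrow> polyf g \<Longrightarrow> pd i (\<lambda>x. f x - g x) = (\<lambda>x. pd i f x - pd i g x)"
  unfolding pd_def[of i f] pd_def[of i g] by (intro ext pd_eqI has_derivative_diff polyf_has_derivative)

lemma pd_mult:
  "polyf f \<Longrightarrow> polyf g \<Longrightarrow> pd i (\<lambda>x. f x * g x) = (\<lambda>x. f x * pd i g x + pd i f x * g x)"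
  unfolding pd_def[of i f] pd_def[of i g] by (intro ext pd_eqI has_derivative_mult polyf_has_derivative)

lemma pd_linear: "bounded_linear f \<Longrightarrow> pd i f = (\<lambda>x. f (axis i 1))"
  by (intro ext pd_eqI bounded_linear_imp_has_derivative)

lemma pd_nth: "pd i (\<lambda>x. x $ k) = (\<lambda>x. if k = i then 1 else 0)"
  by (subst pd_linear) (auto simp: bounded_linear_vec_nth axis_def)

lemma pd_const: "pd i (\<lambda>x. c) = (\<lambda>x. 0)"
  by (rule ext, subst pd_eqI[where f' = "\<lambda>_. 0"]) (auto intro: derivative_intros)

lemma polyf_pd: "polyf f \<Longrightarrow> polyf (pd i f)"
  by (induction f rule: real_polynomial_function.induct) (auto simp: pd_linear pd_const pd_add pd_mult)

lemma frechet_derivative_eq_pd: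
  assumes "polyf f"
  shows "frechet_derivative f (at x) v = (\<Sum>i\<in>UNIV. v $ i * pd i f x)"
proof -
  have lin: "linear (frechet_derivative f (at x))"
    using polyf_has_derivative[OF assms] has_derivative_linear by blast
  have "frechet_derivative f (at x) v = frechet_derivative f (at x) (\<Sum>i\<in>UNIV. v $ i *\<^sub>R axis i 1)"
    using basis_expansion[of v] by (simp add: scalar_mult_eq_scaleR)
  also have "\<dots> = (\<Sum>i\<in>UNIV. v $ i * pd i f x)"
    by (simp add: linear_sum[OF lin] linear_cmul[OF lin] pd_def)
  finally show ?thesis .
qed

lemma rot_eq_pd:
  assumes "polyf f"
  shows "rot 1 f = (\<lambda>x. x $ 2 * pd 3 f x - x $ 3 * pd 2 f x)"
    and "rot 2 f = (\<lambda>x. x $ 3 * pd 1 f x - x $ 1 * pd 3 f x)"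
    and "rot 3 f = (\<lambda>x. x $ 1 * pd 2 f x - x $ 2 * pd 1 f x)"
  by (auto simp: fun_eq_iff rot_def frechet_derivative_eq_pd[OF assms] sum_3 cross3_def axis_def)

lemma sum_rot_rot:
  assumes f: "polyf f" and x: "norm x = 1"
  shows "(\<Sum>i\<in>UNIV. rot i (rot i f) x) = (\<Sum>i\<in>UNIV. pd i (pd i f) x)
    - (\<Sum>i\<in>UNIV. \<Sum>j\<in>UNIV. x $ i * x $ j * pd i (pd j f) x) - 2 * (\<Sum>i\<in>UNIV. x $ i * pd i f x)"
proof -
  have x1: "(x $ 1)\<^sup>2 + (x $ 2)\<^sup>2 + (x $ 3)\<^sup>2 = 1"
    using x by (simp add: norm_vec_def L2_set_def sum_3)
  have "(\<Sum>i\<in>UNIV. rot i (rot i f) x) = ((x $ 1)\<^sup>2 + (x $ 2)\<^sup>2 + (x $ 3)\<^sup>2) * (\<Sum>i\<in>UNIV. pd i (pd i f) x)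
    - (\<Sum>i\<in>UNIV. \<Sum>j\<in>UNIV. x $ i * x $ j * pd i (pd j f) x) - 2 * (\<Sum>i\<in>UNIV. x $ i * pd i f x)"
    by (simp add: rot_eq_pd f polyf_pd polyf_intros pd_diff pd_mult pd_nth sum_3 power2_eq_square,
        simp add: algebra_simps)
  then show ?thesis by (simp add: x1)
qed

lemma has_derivative_normalize:
  fixes x :: "'a::real_inner"
  assumes "norm x = 1"
  shows "((\<lambda>y. y /\<^sub>R norm y) has_derivative (\<lambda>h. h - (x \<bullet> h) *\<^sub>R x)) (at x)"
proof -
  have "x \<noteq> 0" using assms by auto
  then show ?thesis
    by (auto intro!: derivative_eq_intros has_derivative_norm simp: assms sgn_div_norm inner_commute)
qed

text \<open>
  The derivative of \<open>y \<mapsto> y / |y|\<close> at a unit vector is the projection to the tangent plane.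
\<close>

lemma sphere_diff_eqI:
  assumes "(f has_derivative f') (at x)" "norm x = 1"
  shows "sphere_diff f x v = f' (tangent_proj x v)"
proof -
  have "(f has_derivative f') (at (x /\<^sub>R norm x))" using assms by simp
  from has_derivative_compose[OF has_derivative_normalize[OF assms(2)] this]
  have "(radial_ext f has_derivative (\<lambda>v. f' (tangent_proj x v))) (at x)"
    by (simp add: radial_ext_def tangent_proj_def)
  from frechet_derivative_at[OF this, symmetric] show ?thesis by (simp add: sphere_diff_def)
qed

lemma inner_tangent_proj: "norm x = 1 \<Longrightarrow> x \<bullet> tangent_proj x v = 0"
  by (simp add: tangent_proj_def inner_diff_right dot_square_norm)

lemma tangent_proj_id: "x \<bullet> v = 0 \<Longrightarrow> tangent_proj x v = v"
  by (simp add: tangent_proj_def)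

lemma sphere_grad_eq:
  assumes "polyf f" "norm x = 1"
  shows "sphere_grad f x = tangent_proj x (\<chi> i. pd i f x)"
proof -
  let ?g = "\<chi> i. pd i f x"
  have d: "sphere_diff f x v = ?g \<bullet> v" if "x \<bullet> v = 0" for v
    using sphere_diff_eqI[OF polyf_has_derivative[OF assms(1)] assms(2)] that
    by (simp add: tangent_proj_id frechet_derivative_eq_pd[OF assms(1)] inner_vec_def mult.commute)
  show ?thesis
    unfolding sphere_grad_def
  proof (rule the_equality, safe)
    show "x \<bullet> tangent_proj x ?g = 0" using assms by (simp add: inner_tangent_proj)
    show "sphere_diff f x v = tangent_proj x ?g \<bullet> v" if "x \<bullet> v = 0" for v
      using that d by (simp add: tangent_proj_def inner_diff_left)
  next
    fix w assume w: "x \<bullet> w = 0" "\<forall>v. x \<bullet> v = 0 \<longrightarrow> sphere_diff f x v = w \<bullet> v"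
    let ?u = "w - tangent_proj x ?g"
    have "x \<bullet> ?u = 0" using w assms by (simp add: inner_diff_right inner_tangent_proj)
    then have "w \<bullet> ?u = ?g \<bullet> ?u" "x \<bullet> ?u = 0" using w d by auto
    then have "?u \<bullet> ?u = 0"
      by (simp add: tangent_proj_def inner_diff_left)
    then show "w = tangent_proj x ?g" by simp
  qed
qed

lemma sum_Basis_vec3: "(\<Sum>b\<in>Basis. F b) = (\<Sum>i\<in>UNIV. F (axis i 1 :: real^3))"
proof (rule sum.reindex_bij_witness[where i = "\<lambda>i. axis i 1" and j = "\<lambda>b. THE i. b = axis i 1"])
  fix b :: "real^3" assume "b \<in> Basis"
  then obtain i where "b = axis i 1" by (auto simp: Basis_vec_def)
  then show "axis (THE i. b = axis i 1) 1 = b" "F (axis (THE i. b = axis i 1) 1) = F b"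
    by (simp_all add: axis_eq_axis)
qed (auto simp: Basis_vec_def axis_eq_axis)

lemma trace_tangent_proj:
  assumes "linear B" "norm x = 1"
  shows "(\<Sum>b\<in>Basis. tangent_proj x (B (tangent_proj x b)) \<bullet> b) = (\<Sum>b\<in>Basis. B b \<bullet> b) - B x \<bullet> x"
proof -
  have *: "tangent_proj x (B (tangent_proj x b)) \<bullet> b =
     B b \<bullet> b - (x \<bullet> b) * (B x \<bullet> b) - (B b \<bullet> x) * (x \<bullet> b) + (B x \<bullet> x) * ((x \<bullet> b) * (x \<bullet> b))" for b
    by (simp add: tangent_proj_def linear_diff[OF assms(1)] linear_cmul[OF assms(1)] inner_diff_left
        inner_diff_right inner_commute algebra_simps)
  have "(\<Sum>b\<in>Basis. (B b \<bullet> x) * (x \<bullet> b)) = (\<Sum>b\<in>Basis. (x \<bullet> b) *\<^sub>R B b) \<bullet> x"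
    by (simp add: inner_sum_left mult.commute)
  also have "(\<Sum>b\<in>Basis. (x \<bullet> b) *\<^sub>R B b) = B (\<Sum>b\<in>Basis. (x \<bullet> b) *\<^sub>R b)"
    by (simp add: linear_sum[OF assms(1)] linear_cmul[OF assms(1)])
  finally have 1: "(\<Sum>b\<in>Basis. (B b \<bullet> x) * (x \<bullet> b)) = B x \<bullet> x"
    by (simp add: euclidean_representation)
  have 2: "(\<Sum>b\<in>Basis. (x \<bullet> b) * (B x \<bullet> b)) = B x \<bullet> x"
    by (simp add: euclidean_inner[of "B x" x] mult.commute)
  have 3: "(\<Sum>b\<in>Basis. (x \<bullet> b) * (x \<bullet> b)) = 1"
    using assms(2) by (simp add: euclidean_inner[of x x, symmetric] dot_square_norm)
  show ?thesis
    unfolding * by (simp add: sum.distrib sum_subtractf sum_distrib_left[symmetric] 1 2 3)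
qed

text \<open>
  On the sphere the gradient of \<open>f\<close> is the restriction of the polynomial field
  \<open>X y = \<nabla>f y - (y \<bullet> \<nabla>f y) y\<close>, hence both have the same radial extension and the divergence can
  be computed from the derivative of \<open>X\<close>. The trace of that derivative over the tangent plane is
  \<open>\<Sum>\<^sub>i \<partial>\<^sub>i\<^sup>2 f - \<Sum>\<^sub>i\<^sub>j x\<^sub>i x\<^sub>j \<partial>\<^sub>i \<partial>\<^sub>j f - 2 x \<bullet> \<nabla>f\<close>, which is also the value of the sum of squares of the
  rotation fields.
\<close>

lemma laplace_beltrami_polyf:
  assumes f: "polyf f" and x: "norm x = 1"
  shows "laplace_beltrami f x = (\<Sum>i\<in>UNIV. rot i (rot i f) x)"
proof -
  define p where "p k y = pd k f y - (y $ 1 * pd 1 f y + y $ 2 * pd 2 f y + y $ 3 * pd 3 f y) * y $ k" for k y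
  define X where "X y = (\<chi> k. p k y)" for y
  have p: "polyf (p k)" for k unfolding p_def[abs_def] by (intro polyf_intros polyf_pd f)
  define B where "B h = (\<chi> k. \<Sum>i\<in>UNIV. h $ i * pd i (p k) x)" for h :: "real^3"
  have X: "(X has_derivative B) (at x)"
  proof -
    have "((\<lambda>y. \<Sum>k\<in>UNIV. p k y *\<^sub>R axis k 1) has_derivative
       (\<lambda>h. \<Sum>k\<in>UNIV. frechet_derivative (p k) (at x) h *\<^sub>R axis k (1::real))) (at x)"
      by (intro has_derivative_sum has_derivative_scaleR_left polyf_has_derivative p)
    moreover have "(\<lambda>y. \<Sum>k\<in>UNIV. p k y *\<^sub>R axis k 1) = X"
      by (simp add: fun_eq_iff X_def vec_eq_iff forall_3 sum_3 axis_def)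
    moreover have "(\<lambda>h. \<Sum>k\<in>UNIV. frechet_derivative (p k) (at x) h *\<^sub>R axis k 1) = B"
      by (simp add: fun_eq_iff B_def vec_eq_iff forall_3 sum_3 axis_def frechet_derivative_eq_pd[OF p])
    ultimately show ?thesis by simp
  qed
  have "radial_ext (sphere_grad f) y = radial_ext X y" if "y \<noteq> 0" for y
  proof -
    have "norm (y /\<^sub>R norm y) = 1" using that by simp
    then show ?thesis unfolding radial_ext_def
      by (subst sphere_grad_eq[OF f]) (simp_all add: X_def p_def vec_eq_iff tangent_proj_def inner_vec_def sum_3)
  qed
  moreover have "(radial_ext X has_derivative (\<lambda>v. B (tangent_proj x v))) (at x)"
  proof -
    have "(X has_derivative B) (at (x /\<^sub>R norm x))" using X x by simp
    from has_derivative_compose[OF has_derivative_normalize[OF x] this]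
    show ?thesis by (simp add: radial_ext_def tangent_proj_def)
  qed
  ultimately have "(radial_ext (sphere_grad f) has_derivative (\<lambda>v. B (tangent_proj x v))) (at x)"
    using x by (elim has_derivative_transform_within_open[where s = "- {0}"]) auto
  from frechet_derivative_at[OF this, symmetric]
  have sd: "sphere_diff (sphere_grad f) x v = B (tangent_proj x v)" for v
    by (simp add: sphere_diff_def)
  have tt: "tangent_proj x (tangent_proj x v) = tangent_proj x v" for v
    using x by (intro tangent_proj_id inner_tangent_proj)
  have lB: "linear B" using X has_derivative_linear by blast
  have x1: "(x $ 1)\<^sup>2 + (x $ 2)\<^sup>2 + (x $ 3)\<^sup>2 = 1"
    using x by (simp add: norm_vec_def L2_set_def sum_3)
  have pdp: "pd i (p k) x = pd i (pd k f) x - (pd i f x + (\<Sum>j\<in>UNIV. x $ j * pd i (pd j f) x)) * x $ k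
      - (if i = k then \<Sum>j\<in>UNIV. x $ j * pd j f x else 0)" for i k
    using exhaust_3[of i]
    by (auto simp add: p_def[abs_def] f polyf_pd polyf_intros pd_diff pd_add pd_mult pd_nth sum_3)
  have "laplace_beltrami f x = (\<Sum>b\<in>Basis. tangent_proj x (B (tangent_proj x b)) \<bullet> b)"
    by (simp add: laplace_beltrami_def sphere_div_def sphere_cov_def sd tt)
  also have "\<dots> = (\<Sum>b\<in>Basis. B b \<bullet> b) - B x \<bullet> x"
    by (rule trace_tangent_proj[OF lB x])
  also have "(\<Sum>b\<in>Basis. B b \<bullet> b) = (\<Sum>i\<in>UNIV. pd i (p i) x)"
    by (simp add: sum_Basis_vec3 B_def inner_vec_def sum_3 axis_def)
  also have "\<dots> = (\<Sum>i\<in>UNIV. pd i (pd i f) x) - (\<Sum>i\<in>UNIV. \<Sum>j\<in>UNIV. x $ i * x $ j * pd i (pd j f) x)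
      - 4 * (\<Sum>i\<in>UNIV. x $ i * pd i f x)"
    unfolding pdp by (simp add: sum_3, simp add: algebra_simps)
  also have "B x \<bullet> x = - 2 * (\<Sum>i\<in>UNIV. x $ i * pd i f x)"
  proof -
    have "B x \<bullet> x = (\<Sum>i\<in>UNIV. \<Sum>j\<in>UNIV. x $ i * x $ j * pd i (pd j f) x)
      * (1 - ((x $ 1)\<^sup>2 + (x $ 2)\<^sup>2 + (x $ 3)\<^sup>2))
      - 2 * ((x $ 1)\<^sup>2 + (x $ 2)\<^sup>2 + (x $ 3)\<^sup>2) * (\<Sum>i\<in>UNIV. x $ i * pd i f x)"
      unfolding B_def pdp inner_vec_def
      by (simp add: sum_3 power2_eq_square, simp add: algebra_simps)
    then show ?thesis by (simp add: x1)
  qed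
  finally show ?thesis by (simp add: sum_rot_rot[OF f x])
qed

lemma gen_op_polyf:
  assumes "polyf f" "x \<in> S2"
  shows "gen_op \<mu> f x = rot_gen \<mu> f x"
proof -
  have x: "norm x = 1" using assms by simp
  have *: "drift_field \<mu> x = \<mu> *\<^sub>R cross3 (axis 3 1) x"
    by (simp add: drift_field_def cross3_def axis_def vec_eq_iff forall_3)
  have "x \<bullet> drift_field \<mu> x = 0"
    by (simp add: * dot_cross_self)
  then have "sphere_diff f x (drift_field \<mu> x) = frechet_derivative f (at x) (drift_field \<mu> x)"
    using sphere_diff_eqI[OF polyf_has_derivative[OF assms(1)] x] by (simp add: tangent_proj_id)
  also have "\<dots> = \<mu> * rot 3 f x"
    unfolding * rot_def using has_derivative_linear[OF polyf_has_derivative[OF assms(1)]]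
    by (simp add: linear_cmul)
  finally show ?thesis
    using laplace_beltrami_polyf[OF assms(1) x] by (simp add: gen_op_def rot_gen_def)
qed

text \<open>
  An algebra of functions that contains the radial extensions of all polynomials and is closed
  under differentiation away from the origin; membership therefore gives derivatives of every
  order.
\<close>

inductive radial_rational :: "(real^3 \<Rightarrow> real) \<Rightarrow> bool" where
  "radial_rational (\<lambda>x. c)"
| "radial_rational (\<lambda>x. x \<bullet> v)"
| "radial_rational (\<lambda>x. inverse (norm x))"
| "radial_rational f \<Longrightarrow> radial_rational g \<Longrightarrow> radial_rational (\<lambda>x. f x + g x)"
| "radial_rational f \<Longrightarrow> radial_rational g \<Longrightarrow> radial_rational (\<lambda>x. f x * g x)"

lemma radial_rational_derivative:
  assumes "radial_rational f"
  shows "\<exists>f'. (\<forall>v. radial_rational (\<lambda>x. f' x v)) \<and> (\<forall>x. x \<noteq> 0 \<longrightarrow> (f has_derivative f' x) (at x))"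
  using assms
proof induction
  case (1 c)
  then show ?case
    by (intro exI[of _ "\<lambda>_ _. 0"]) (auto intro: radial_rational.intros)
next
  case (2 v)
  then show ?case
    by (intro exI[of _ "\<lambda>_ w. w \<bullet> v"]) (auto intro!: radial_rational.intros derivative_eq_intros)
next
  case 3
  have "radial_rational (\<lambda>x. (-1) * ((x \<bullet> v) * (inverse (norm x) * (inverse (norm x) * inverse (norm x)))))" for v
    by (intro radial_rational.intros)
  moreover have "((\<lambda>x. inverse (norm x)) has_derivative
      (\<lambda>v. (-1) * ((x \<bullet> v) * (inverse (norm x) * (inverse (norm x) * inverse (norm x)))))) (at x)"
    if "x \<noteq> 0" for x :: "real^3"
    using that by (auto intro!: derivative_eq_intros has_derivative_norm simp: sgn_div_norm inner_commute[of _ x] divide_inverse power2_eq_square mult.assoc)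
  ultimately show ?case
    by (intro exI[of _ "\<lambda>x v. (-1) * ((x \<bullet> v) * (inverse (norm x) * (inverse (norm x) * inverse (norm x))))"]) simp
next
  case (4 f g)
  then obtain f' g' where *: "\<forall>v. radial_rational (\<lambda>x. f' x v)" "\<forall>x. x \<noteq> 0 \<longrightarrow> (f has_derivative f' x) (at x)"
    "\<forall>v. radial_rational (\<lambda>x. g' x v)" "\<forall>x. x \<noteq> 0 \<longrightarrow> (g has_derivative g' x) (at x)" by blast
  show ?case
    by (intro exI[of _ "\<lambda>x v. f' x v + g' x v"] conjI allI impI radial_rational.intros has_derivative_add) (use * in auto)
next
  case (5 f g)
  then obtain f' g' where *: "\<forall>v. radial_rational (\<lambda>x. f' x v)" "\<forall>x. x \<noteq> 0 \<longrightarrow> (f has_derivative f' x) (at x)"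
    "\<forall>v. radial_rational (\<lambda>x. g' x v)" "\<forall>x. x \<noteq> 0 \<longrightarrow> (g has_derivative g' x) (at x)" by blast
  show ?case
    by (intro exI[of _ "\<lambda>x v. f x * g' x v + f' x v * g x"] conjI allI impI radial_rational.intros(4,5) has_derivative_mult) (use * 5 in auto)
qed

lemma Ck_on_cong:
  assumes "open U" "\<And>x. x \<in> U \<Longrightarrow> f x = g x" "Ck_on k f U"
  shows "Ck_on k g U"
  using assms(2,3)
proof (induction k arbitrary: f g)
  case 0
  then show ?case by (simp cong: continuous_on_cong)
next
  case (Suc k)
  have *: "(g has_derivative frechet_derivative f (at x)) (at x)" if "x \<in> U" for x
  proof -
    have "(f has_derivative frechet_derivative f (at x)) (at x)"
      using Suc.prems that frechet_derivative_works by auto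
    then show ?thesis
      by (rule has_derivative_transform_within_open[OF _ assms(1) that]) (use Suc.prems in auto)
  qed
  show ?case
    unfolding Ck_on.simps
  proof (intro conjI ballI allI)
    fix x assume "x \<in> U"
    then show "g differentiable (at x)" using * by (auto simp: differentiable_def)
  next
    fix v
    show "Ck_on k (\<lambda>x. frechet_derivative g (at x) v) U"
    proof (rule Suc.IH)
      show "Ck_on k (\<lambda>x. frechet_derivative f (at x) v) U" using Suc.prems by simp
      show "frechet_derivative f (at x) v = frechet_derivative g (at x) v" if "x \<in> U" for x
        using frechet_derivative_at[OF *[OF that]] by simp
    qed
  qed
qed

lemma Ck_on_radial_rational: "radial_rational f \<Longrightarrow> Ck_on k f (- {0})"
proof (induction k arbitrary: f)
  case 0
  from radial_rational_derivative[OF 0] obtain f' where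
    f': "\<And>x. x \<noteq> 0 \<Longrightarrow> (f has_derivative f' x) (at x)" by blast
  have "continuous (at x) f" if "x \<noteq> 0" for x
    using has_derivative_continuous[OF f'[OF that]] .
  then show ?case by (simp add: continuous_at_imp_continuous_on)
next
  case (Suc k)
  from radial_rational_derivative[OF Suc.prems] obtain f' where
    r: "\<And>v. radial_rational (\<lambda>x. f' x v)" and f': "\<And>x. x \<noteq> 0 \<Longrightarrow> (f has_derivative f' x) (at x)" by blast
  have "Ck_on k (\<lambda>x. frechet_derivative f (at x) v) (- {0})" for v
    by (rule Ck_on_cong[OF _ _ Suc.IH[OF r[of v]]]) (auto simp: frechet_derivative_at[OF f'])
  then show ?case using f' by (auto simp: differentiable_def)
qed

lemma radial_rational_radial_ext: "polyf f \<Longrightarrow> radial_rational (radial_ext f)"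
proof (induction f rule: real_polynomial_function.induct)
  case (linear f)
  then interpret bounded_linear f .
  have 1: "f x = x \<bullet> adjoint f 1" for x
    using adjoint_works[of f x 1] linear bounded_linear.linear by force
  have "radial_ext f = (\<lambda>x. inverse (norm x) * (x \<bullet> adjoint f 1))"
    by (simp add: radial_ext_def scaleR fun_eq_iff, simp add: 1)
  then show ?case by (simp add: radial_rational.intros)
qed (auto simp: radial_ext_def intro: radial_rational.intros)

lemma smooth_on_S2_polyf: "polyf f \<Longrightarrow> smooth_on_S2 f"
  by (simp add: smooth_on_S2_def Ck_on_radial_rational radial_rational_radial_ext)

lemma in_generator_polyf:
  assumes "generated_by K \<mu>" "polyf f"
  shows "in_generator K f (rot_gen \<mu> f)"
proof -
  have "uniform_limit S2 (\<lambda>n. gen_op \<mu> f) (rot_gen \<mu> f) sequentially"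
    by (rule uniform_limitI) (simp add: gen_op_polyf assms)
  moreover have "uniform_limit S2 (\<lambda>n::nat. f) f sequentially"
    by (rule uniform_limitI) simp
  ultimately show ?thesis
    using assms smooth_on_S2_polyf[OF assms(2)] unfolding generated_by_def
    by (auto simp: polyf_continuous_on polyf_rot_gen intro!: exI[of _ "\<lambda>_. f"])
qed

section \<open>The semigroup and its time derivative\<close>

locale feller_diffusion =
  fixes K :: "real \<Rightarrow> real^3 \<Rightarrow> (real^3) measure" and \<mu> :: real
  assumes feller: "feller_transition K" and gen: "generated_by K \<mu>"
begin

definition T :: "real \<Rightarrow> (real^3 \<Rightarrow> real) \<Rightarrow> real^3 \<Rightarrow> real"
  where "T s f x = (\<integral>y. f y \<partial>K s x)"

lemma K_measurable: "s \<ge> 0 \<Longrightarrow> K s \<in> S2_borel \<rightarrow>\<^sub>M prob_algebra S2_borel"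
  using feller unfolding feller_transition_def by blast

lemma K_prob:
  assumes "s \<ge> 0" "x \<in> S2"
  shows "prob_space (K s x)" "sets (K s x) = sets S2_borel" "space (K s x) = S2"
proof -
  have "K s x \<in> space (prob_algebra S2_borel)"
    using measurable_space[OF K_measurable[OF assms(1)]] assms(2) by (simp add: space_restrict_space)
  then show "prob_space (K s x)" and *: "sets (K s x) = sets S2_borel" by (auto simp: space_prob_algebra)
  from sets_eq_imp_space_eq[OF *] show "space (K s x) = S2" by (simp add: space_restrict_space)
qed

lemma K_0: "x \<in> S2 \<Longrightarrow> K 0 x = return S2_borel x"
  and K_add: "s \<ge> 0 \<Longrightarrow> t \<ge> 0 \<Longrightarrow> x \<in> S2 \<Longrightarrow> K (s + t) x = K s x \<bind> K t"
  using feller unfolding feller_transition_def by blast+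

lemma T_continuous: "continuous_on S2 f \<Longrightarrow> t \<ge> 0 \<Longrightarrow> continuous_on S2 (T t f)"
  using feller unfolding feller_transition_def T_def[abs_def] by blast

lemma T_uniform_limit: "continuous_on S2 f \<Longrightarrow> uniform_limit S2 (\<lambda>t. T t f) f (at_right 0)"
  using feller unfolding feller_transition_def T_def[abs_def] by blast

end

lemma continuous_on_S2_bounded:
  fixes f :: "real^3 \<Rightarrow> real"
  assumes "continuous_on S2 f"
  obtains B where "\<And>x. x \<in> S2 \<Longrightarrow> \<bar>f x\<bar> \<le> B"
proof -
  have "bounded (f ` S2)" using assms compact_continuous_image compact_sphere compact_imp_bounded by blast
  then obtain B where "\<forall>y\<in>f ` S2. norm y \<le> B" by (auto simp: bounded_iff)
  then show ?thesis by (intro that[of B]) auto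
qed

lemma integrable_continuous_on_S2:
  fixes f :: "real^3 \<Rightarrow> real"
  assumes "continuous_on S2 f" "finite_measure M" "sets M = sets S2_borel"
  shows "integrable M f"
proof -
  interpret finite_measure M by fact
  obtain B where B: "\<And>x. x \<in> S2 \<Longrightarrow> \<bar>f x\<bar> \<le> B" using continuous_on_S2_bounded[OF assms(1)] by blast
  have "f \<in> borel_measurable M"
    using borel_measurable_continuous_on_restrict[OF assms(1)] measurable_cong_sets[OF assms(3) refl] by blast
  moreover have "space M = S2"
    using sets_eq_imp_space_eq[OF assms(3)] by (simp add: space_restrict_space)
  ultimately show ?thesis using B by (intro integrable_const_bound[of _ B]) auto
qed

context feller_diffusion
begin

lemma T_integrable:
  fixes f :: "real^3 \<Rightarrow> real"
  assumes "continuous_on S2 f" "s \<ge> 0" "x \<in> S2"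
  shows "integrable (K s x) f"
  by (rule integrable_continuous_on_S2[OF assms(1) prob_space.axioms(1)[OF K_prob(1)[OF assms(2,3)]]
      K_prob(2)[OF assms(2,3)]])

lemma T_0: "continuous_on S2 f \<Longrightarrow> x \<in> S2 \<Longrightarrow> T 0 f x = f x"
  unfolding T_def K_0
  by (subst integral_return) (auto simp: space_restrict_space borel_measurable_continuous_on_restrict)

lemma T_const: "s \<ge> 0 \<Longrightarrow> x \<in> S2 \<Longrightarrow> T s (\<lambda>y. c) x = c"
  using prob_space.prob_space[OF K_prob(1)] by (simp add: T_def)

lemma T_add_diff:
  assumes "continuous_on S2 f" "continuous_on S2 g" "s \<ge> 0" "x \<in> S2"
  shows "T s (\<lambda>y. f y + g y) x = T s f x + T s g x"
    and "T s (\<lambda>y. f y - g y) x = T s f x - T s g x"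
  using assms by (simp_all add: T_def T_integrable)

lemma T_cmult: "T s (\<lambda>y. c * f y) x = c * T s f x"
  by (simp add: T_def)

lemma T_mono:
  assumes "continuous_on S2 f" "continuous_on S2 g" "s \<ge> 0" "x \<in> S2" "\<And>y. y \<in> S2 \<Longrightarrow> f y \<le> g y"
  shows "T s f x \<le> T s g x"
  unfolding T_def using assms by (intro integral_mono T_integrable) (auto simp: K_prob)

lemma T_dist_le:
  assumes c: "continuous_on S2 f" "continuous_on S2 g" and s: "s \<ge> 0" "x \<in> S2"
    and e: "\<And>y. y \<in> S2 \<Longrightarrow> \<bar>f y - g y\<bar> \<le> e"
  shows "\<bar>T s f x - T s g x\<bar> \<le> e"
proof -
  have 1: "T s (\<lambda>y. f y - g y) x \<le> T s (\<lambda>y. e) x"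
    using assms by (intro T_mono continuous_intros) (auto simp: abs_le_iff)
  have 2: "T s (\<lambda>y. - e) x \<le> T s (\<lambda>y. f y - g y) x"
  proof (intro T_mono continuous_intros)
    fix y assume "y \<in> S2"
    then show "- e \<le> f y - g y" using e[of y] by linarith
  qed (use c s in auto)
  show ?thesis using 1 2 s c by (simp add: T_const T_add_diff)
qed

lemma T_semigroup:
  assumes f: "continuous_on S2 f" and s: "s \<ge> 0" "t \<ge> 0" "x \<in> S2"
  shows "T (s + t) f x = T s (T t f) x"
proof -
  obtain B where B: "\<And>x. x \<in> S2 \<Longrightarrow> \<bar>f x\<bar> \<le> B" using continuous_on_S2_bounded[OF f] by blast
  interpret prob_space "K s x" using K_prob s by blast
  have N: "K t \<in> K s x \<rightarrow>\<^sub>M subprob_algebra S2_borel"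
    using measurable_prob_algebraD[OF K_measurable[OF s(2)]] measurable_cong_sets[OF K_prob(2)[OF s(1,3)] refl]
    by blast
  show ?thesis
    unfolding T_def K_add[OF s]
    using B s
    by (intro integral_bind[where K = S2_borel and B = B and B' = 1, OF _ _ N])
      (auto simp: space_restrict_space K_prob borel_measurable_continuous_on_restrict[OF f]
        prob_space.emeasure_space_1 finite_measure_axioms intro!: AE_I2 prob_space.emeasure_le_1)
qed

lemma T_eventually_close:
  assumes "continuous_on S2 f" "e > 0"
  obtains d where "d > 0" "\<And>h y. 0 < h \<Longrightarrow> h < d \<Longrightarrow> y \<in> S2 \<Longrightarrow> \<bar>T h f y - f y\<bar> < e"
proof -
  have "\<forall>\<^sub>F h in at_right 0. \<forall>y\<in>S2. dist (T h f y) (f y) < e"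
    using T_uniform_limit[OF assms(1)] assms(2) by (simp add: uniform_limit_iff)
  then obtain d where "d > 0" "\<forall>h>0. h < d \<longrightarrow> (\<forall>y\<in>S2. dist (T h f y) (f y) < e)"
    by (auto simp: eventually_at_right_field)
  then show ?thesis by (intro that[of d]) (auto simp: dist_real_def)
qed

lemma T_time_continuous:
  assumes f: "continuous_on S2 f" and x: "x \<in> S2"
  shows "continuous_on {0..} (\<lambda>s. T s f x)"
proof (rule continuous_onI)
  fix s e :: real assume s: "s \<in> {0..}" and e: "e > 0"
  obtain d where d: "d > 0" "\<And>h y. 0 < h \<Longrightarrow> h < d \<Longrightarrow> y \<in> S2 \<Longrightarrow> \<bar>T h f y - f y\<bar> < e"
    using T_eventually_close[OF f e] by blast
  have *: "\<bar>T b f x - T a f x\<bar> \<le> e" if "0 \<le> a" "a < b" "b - a < d" for a b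
  proof -
    have "T b f x = T a (T (b - a) f) x"
      using T_semigroup[OF f that(1) _ x, of "b - a"] that by simp
    moreover have "\<bar>T a (T (b - a) f) x - T a f x\<bar> \<le> e"
      using that x d(2)[of "b - a"] by (intro T_dist_le T_continuous f) (auto intro: less_imp_le)
    ultimately show ?thesis by simp
  qed
  show "\<exists>d>0. \<forall>s'\<in>{0..}. dist s' s < d \<longrightarrow> dist (T s' f x) (T s f x) \<le> e"
  proof (intro exI[of _ d] conjI ballI impI d(1))
    fix s' assume s': "s' \<in> {0..}" "dist s' s < d"
    show "dist (T s' f x) (T s f x) \<le> e"
      using *[of s s'] *[of s' s] s s' e
      by (cases s s' rule: linorder_cases) (auto simp: dist_real_def abs_minus_commute)
  qed
qed

text \<open>
  The generator is defined by a limit from the right at time \<open>0\<close>. The difference quotient of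
  \<open>s \<mapsto> T s f\<close> to the right of \<open>s\<close> is \<open>T s\<close> of the one at \<open>0\<close>; to the left of \<open>s\<close>, with step \<open>k\<close>, it is
  \<open>T (s - k)\<close> of the one at \<open>0\<close>, and this is compared with \<open>T s G f = T (s - k) (T k G f)\<close>.
  Both comparisons work because the limits at time \<open>0\<close> are uniform on the sphere and
  each \<open>T r\<close> is a contraction for the uniform norm.
\<close>

lemma T_has_derivative:
  assumes f: "polyf f" and x: "x \<in> S2" and s: "s > 0"
  shows "((\<lambda>s. T s f x) has_real_derivative T s (rot_gen \<mu> f) x) (at s)"
proof -
  let ?g = "rot_gen \<mu> f" and ?q = "\<lambda>h y. (T h f y - f y) / h"
  have cf: "continuous_on S2 f" and cg: "continuous_on S2 ?g"
    using f polyf_rot_gen polyf_continuous_on by auto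
  have cq: "continuous_on S2 (?q h)" if "h > 0" for h
    using that by (intro continuous_intros T_continuous cf) auto
  have Tq: "T r (?q h) x = (T (r + h) f x - T r f x) / h" if "r \<ge> 0" "h > 0" for r h
  proof -
    have "T r (?q h) x = T r (\<lambda>y. (1 / h) * (T h f y - f y)) x" by simp
    also have "\<dots> = (1 / h) * (T r (T h f) x - T r f x)"
      unfolding T_cmult using that x by (subst T_add_diff) (auto intro: T_continuous cf)
    finally show ?thesis using that x by (simp add: T_semigroup[OF cf])
  qed
  have close: "\<exists>d>0. \<forall>h. h \<noteq> 0 \<and> \<bar>h\<bar> < d \<longrightarrow> \<bar>(T (s + h) f x - T s f x) / h - T s ?g x\<bar> \<le> 2 * e"
    if e: "e > 0" for e
  proof -
    have "uniform_limit S2 ?q ?g (at_right 0)"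
      using in_generator_polyf[OF gen f] unfolding in_generator_def T_def by blast
    then have "\<forall>\<^sub>F h in at_right 0. \<forall>y\<in>S2. dist (?q h y) (?g y) < e"
      using e by (simp add: uniform_limit_iff)
    then obtain d1 where d1: "d1 > 0" "\<And>h y. 0 < h \<Longrightarrow> h < d1 \<Longrightarrow> y \<in> S2 \<Longrightarrow> \<bar>?q h y - ?g y\<bar> < e"
      by (auto simp: eventually_at_right_field dist_real_def)
    obtain d2 where d2: "d2 > 0" "\<And>h y. 0 < h \<Longrightarrow> h < d2 \<Longrightarrow> y \<in> S2 \<Longrightarrow> \<bar>T h ?g y - ?g y\<bar> < e"
      using T_eventually_close[OF cg e] by blast
    define d where "d = min (min d1 d2) s"
    have "\<bar>(T (s + h) f x - T s f x) / h - T s ?g x\<bar> \<le> 2 * e" if h: "h \<noteq> 0" "\<bar>h\<bar> < d" for h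
    proof (cases "h > 0")
      case True
      have "\<bar>T s (?q h) x - T s ?g x\<bar> \<le> e"
        using True h s x d1(2)[of h] by (intro T_dist_le cq cg) (auto simp: d_def intro: less_imp_le)
      then show ?thesis using Tq[of s h] True s e by simp
    next
      case False
      define k where "k = - h"
      have k: "k > 0" "k < d1" "k < d2" "k < s" using False h by (auto simp: k_def d_def)
      have "\<bar>T (s - k) (?q k) x - T (s - k) (T k ?g) x\<bar> \<le> 2 * e"
      proof (intro T_dist_le cq T_continuous cg)
        fix y assume y: "y \<in> S2"
        show "\<bar>?q k y - T k ?g y\<bar> \<le> 2 * e" using d1(2)[OF k(1,2) y] d2(2)[OF k(1,3) y] by linarith
      qed (use k x in auto)
      moreover have "T (s - k) (T k ?g) x = T s ?g x"
        using T_semigroup[OF cg, of "s - k" k x] k x by simp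
      moreover have "T (s - k) (?q k) x = (T (s + h) f x - T s f x) / h"
        using Tq[of "s - k" k] k by (simp add: k_def field_simps)
      ultimately show ?thesis by simp
    qed
    moreover have "d > 0" using d1 d2 s by (simp add: d_def)
    ultimately show ?thesis by blast
  qed
  have "(\<lambda>h. (T (s + h) f x - T s f x) / h) \<midarrow>0\<rightarrow> T s ?g x"
  proof (rule LIM_I)
    fix r :: real assume "r > 0"
    then obtain d where d: "d > 0" "\<forall>h. h \<noteq> 0 \<and> \<bar>h\<bar> < d \<longrightarrow> \<bar>(T (s + h) f x - T s f x) / h - T s ?g x\<bar> \<le> 2 * (r / 4)"
      using close[of "r / 4"] by auto
    show "\<exists>d>0. \<forall>h. h \<noteq> 0 \<and> norm (h - 0) < d \<longrightarrow> norm ((T (s + h) f x - T s f x) / h - T s ?g x) < r"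
      using d \<open>r > 0\<close> by (intro exI[of _ d]) force
  qed
  then show ?thesis by (simp add: DERIV_def)
qed

end

section \<open>Finite dimensional spaces of polynomials stable under rotations\<close>

definition lincomb :: "(real^3 \<Rightarrow> real) set \<Rightarrow> (real^3 \<Rightarrow> real) \<Rightarrow> bool"
  where "lincomb E f \<longleftrightarrow> (\<exists>c. f = (\<lambda>x. \<Sum>b\<in>E. c b * b x))"

lemma lincomb_mem: "finite E \<Longrightarrow> e \<in> E \<Longrightarrow> lincomb E e"
  unfolding lincomb_def
  by (intro exI[of _ "\<lambda>b. if b = e then 1 else 0"])
    (simp add: if_distrib[of "\<lambda>c. c * _"] cong: if_cong)

lemma lincomb_add:
  assumes "lincomb E f" "lincomb E g" shows "lincomb E (\<lambda>x. f x + g x)"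
proof -
  obtain c d where "f = (\<lambda>x. \<Sum>b\<in>E. c b * b x)" "g = (\<lambda>x. \<Sum>b\<in>E. d b * b x)"
    using assms unfolding lincomb_def by blast
  then show ?thesis unfolding lincomb_def
    by (intro exI[of _ "\<lambda>b. c b + d b"]) (simp add: sum.distrib distrib_right)
qed

lemma lincomb_cmult:
  assumes "lincomb E f" shows "lincomb E (\<lambda>x. k * f x)"
proof -
  obtain c where "f = (\<lambda>x. \<Sum>b\<in>E. c b * b x)" using assms unfolding lincomb_def by blast
  then show ?thesis unfolding lincomb_def
    by (intro exI[of _ "\<lambda>b. k * c b"]) (simp add: sum_distrib_left mult.assoc)
qed

lemma lincomb_zero: "lincomb E (\<lambda>x. 0)"
  unfolding lincomb_def by (intro exI[of _ "\<lambda>_. 0"]) simp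

lemma lincomb_sum:
  "finite J \<Longrightarrow> (\<And>j. j \<in> J \<Longrightarrow> lincomb E (f j)) \<Longrightarrow> lincomb E (\<lambda>x. \<Sum>j\<in>J. f j x)"
  by (induction J rule: finite_induct) (auto intro: lincomb_zero lincomb_add)

lemma lincomb_trans:
  assumes "finite E" "lincomb E f" "\<And>e. e \<in> E \<Longrightarrow> lincomb F e"
  shows "lincomb F f"
  using assms unfolding lincomb_def[of E] by (auto intro!: lincomb_sum lincomb_cmult)

definition rot_stable :: "(real^3 \<Rightarrow> real) set \<Rightarrow> bool"
  where "rot_stable E \<longleftrightarrow> finite E \<and> (\<forall>e\<in>E. polyf e) \<and> (\<forall>e\<in>E. \<forall>i. lincomb E (rot i e))"

lemma rot_stable_lincomb:
  assumes "rot_stable E" "lincomb E f"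
  shows "polyf f" "lincomb E (rot i f)"
proof -
  obtain c where f: "f = (\<lambda>x. \<Sum>b\<in>E. c b * b x)" using assms unfolding lincomb_def by blast
  have E: "finite E" "\<And>e. e \<in> E \<Longrightarrow> polyf e" "\<And>e. e \<in> E \<Longrightarrow> lincomb E (rot i e)"
    using assms unfolding rot_stable_def by auto
  show "polyf f" unfolding f by (intro polyf_intros E)
  have "rot i f = (\<lambda>x. \<Sum>b\<in>E. c b * rot i b x)"
    unfolding f using E by (simp add: rot_sum rot_cmult polyf_intros)
  then show "lincomb E (rot i f)" using E by (simp add: lincomb_sum lincomb_cmult)
qed

lemma lincomb_rot_gen:
  assumes "rot_stable E" "lincomb E f"
  shows "lincomb E (rot_gen \<mu> f)"
  unfolding rot_gen_def[abs_def]
  by (intro lincomb_add lincomb_sum lincomb_cmult rot_stable_lincomb(2)[OF assms(1)] assms finite)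

lemma lincomb_mult:
  assumes "lincomb E f" "lincomb F g" and fin: "finite E" "finite F"
  shows "lincomb ((\<lambda>(e, h) x. e x * h x) ` (E \<times> F)) (\<lambda>x. f x * g x)"
proof -
  let ?EF = "(\<lambda>(e, h) x. e x * h x) ` (E \<times> F)"
  obtain c d where f: "f = (\<lambda>x. \<Sum>b\<in>E. c b * b x)" and g: "g = (\<lambda>x. \<Sum>b\<in>F. d b * b x)"
    using assms unfolding lincomb_def by blast
  have "lincomb ?EF (\<lambda>x. \<Sum>e\<in>E. \<Sum>h\<in>F. (c e * d h) * (e x * h x))"
    by (intro lincomb_sum lincomb_cmult lincomb_mem fin finite_imageI finite_cartesian_product) force+
  also have "(\<lambda>x. \<Sum>e\<in>E. \<Sum>h\<in>F. (c e * d h) * (e x * h x)) = (\<lambda>x. f x * g x)"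
    by (simp add: f g sum_product mult_ac)
  finally show ?thesis .
qed

text \<open>
  The linear functions and the constants span stable spaces. Since the rotation fields are
  derivations, sums and products of stable spaces are stable.
\<close>

lemma polyf_in_rot_stable:
  assumes "polyf f"
  shows "\<exists>E. rot_stable E \<and> lincomb E f"
  using assms
proof (induction f rule: real_polynomial_function.induct)
  case (linear f)
  let ?E = "range (\<lambda>k (x::real^3). x $ k)"
  have lin: "lincomb ?E g" if "bounded_linear g" for g
  proof -
    interpret bounded_linear g by fact
    have "g = (\<lambda>x. \<Sum>i\<in>UNIV. g (axis i 1) * x $ i)"
    proof
      fix x
      have "g x = g (\<Sum>i\<in>UNIV. x $ i *\<^sub>R axis i 1)"
        using basis_expansion[of x] by (simp add: scalar_mult_eq_scaleR)
      also have "\<dots> = (\<Sum>i\<in>UNIV. g (axis i 1) * x $ i)"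
        by (simp add: sum scaleR mult.commute)
      finally show "g x = (\<Sum>i\<in>UNIV. g (axis i 1) * x $ i)" .
    qed
    moreover have "lincomb ?E (\<lambda>x. \<Sum>i\<in>UNIV. g (axis i 1) * x $ i)"
      by (intro lincomb_sum lincomb_cmult lincomb_mem) auto
    ultimately show ?thesis by simp
  qed
  have "lincomb ?E (rot i (\<lambda>x. x $ k))" for i k
    unfolding rot_linear[OF bounded_linear_vec_nth]
    by (intro lin bounded_linear_compose[OF bounded_linear_vec_nth] bounded_linear_cross_right)
  then have "rot_stable ?E" by (auto simp: rot_stable_def polyf_nth)
  then show ?case using lin[OF linear] by blast
next
  case (const c)
  let ?E = "{\<lambda>x::real^3. 1::real}"
  have "rot_stable ?E"
    by (auto simp: rot_stable_def rot_const lincomb_zero intro: polyf_intros)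
  moreover have "lincomb ?E (\<lambda>x. c)" by (auto simp: lincomb_def)
  ultimately show ?case by blast
next
  case (add f g)
  then obtain E F where *: "rot_stable E" "lincomb E f" "rot_stable F" "lincomb F g" by blast
  have fin: "finite E" "finite F" using * by (auto simp: rot_stable_def)
  have E: "lincomb (E \<union> F) h" if "lincomb E h" for h
    using lincomb_trans[OF fin(1) that] fin by (simp add: lincomb_mem)
  have F: "lincomb (E \<union> F) h" if "lincomb F h" for h
    using lincomb_trans[OF fin(2) that] fin by (simp add: lincomb_mem)
  have "rot_stable (E \<union> F)" using * E F unfolding rot_stable_def by auto
  then show ?case using lincomb_add E F * by blast
next
  case (mult f g)
  then obtain E F where *: "rot_stable E" "lincomb E f" "rot_stable F" "lincomb F g" by blast
  let ?EF = "(\<lambda>(e, h) x. e x * h x) ` (E \<times> F)"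
  have fin: "finite E" "finite F" and p: "\<And>e. e \<in> E \<Longrightarrow> polyf e" "\<And>e. e \<in> F \<Longrightarrow> polyf e"
    and r: "\<And>e i. e \<in> E \<Longrightarrow> lincomb E (rot i e)" "\<And>e i. e \<in> F \<Longrightarrow> lincomb F (rot i e)"
    using * by (auto simp: rot_stable_def)
  have "lincomb ?EF (rot i (\<lambda>x. e x * h x))" if "e \<in> E" "h \<in> F" for e h i
    unfolding rot_mult[OF p(1)[OF that(1)] p(2)[OF that(2)]]
    by (intro lincomb_add lincomb_mult fin r that lincomb_mem)
  then have "rot_stable ?EF"
    using fin p by (auto simp: rot_stable_def intro: polyf_intros)
  then show ?case using lincomb_mult[OF *(2,4) fin] by blast
qed

section \<open>Flows of polynomials and the Duhamel formula\<close>

text \<open>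
  A family of polynomials in a fixed finite dimensional space, with differentiable coefficients,
  together with its derivative in time. Recording the pair keeps the algebra of time derivatives
  free of any topology on polynomials.
\<close>

inductive time_poly :: "(real \<Rightarrow> real^3 \<Rightarrow> real) \<Rightarrow> (real \<Rightarrow> real^3 \<Rightarrow> real) \<Rightarrow> bool" where
  base: "polyf p \<Longrightarrow> (\<And>\<tau>. (a has_real_derivative a' \<tau>) (at \<tau>)) \<Longrightarrow>
    time_poly (\<lambda>\<tau> x. a \<tau> * p x) (\<lambda>\<tau> x. a' \<tau> * p x)"
| add: "time_poly F F' \<Longrightarrow> time_poly H H' \<Longrightarrow>
    time_poly (\<lambda>\<tau> x. F \<tau> x + H \<tau> x) (\<lambda>\<tau> x. F' \<tau> x + H' \<tau> x)"

lemma time_poly_polyf: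
  assumes "time_poly F F'" shows "polyf (F \<tau>)" "polyf (F' \<tau>)"
  using assms by (induction) (auto intro: polyf_intros)

lemma time_poly_sum:
  assumes "finite J" "\<And>j. j \<in> J \<Longrightarrow> time_poly (F j) (F' j)"
  shows "time_poly (\<lambda>\<tau> x. \<Sum>j\<in>J. F j \<tau> x) (\<lambda>\<tau> x. \<Sum>j\<in>J. F' j \<tau> x)"
  using assms
proof (induction J rule: finite_induct)
  case empty
  show ?case using time_poly.base[of "\<lambda>x. 0" "\<lambda>_. 0" "\<lambda>_. 0"] by (simp add: polyf_intros)
next
  case (insert j J)
  then show ?case using time_poly.add[of "F j" "F' j"] by simp
qed

lemma time_poly_mult_base:
  assumes "time_poly H H'" "polyf p" "\<And>\<tau>. (a has_real_derivative a' \<tau>) (at \<tau>)"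
  shows "time_poly (\<lambda>\<tau> x. (a \<tau> * p x) * H \<tau> x) (\<lambda>\<tau> x. (a \<tau> * p x) * H' \<tau> x + (a' \<tau> * p x) * H \<tau> x)"
  using assms(1)
proof induction
  case (base q b b')
  have "time_poly (\<lambda>\<tau> x. (a \<tau> * b \<tau>) * (p x * q x)) (\<lambda>\<tau> x. (a \<tau> * b' \<tau> + a' \<tau> * b \<tau>) * (p x * q x))"
    using assms(2) base by (intro time_poly.base polyf_intros)
      (auto intro!: derivative_eq_intros assms(3) simp: algebra_simps)
  then show ?case by (simp add: algebra_simps)
next
  case (add F F' G G')
  from time_poly.add[OF add.IH] show ?case by (simp add: algebra_simps)
qed

lemma time_poly_mult:
  assumes "time_poly F F'" "time_poly H H'"
  shows "time_poly (\<lambda>\<tau> x. F \<tau> x * H \<tau> x) (\<lambda>\<tau> x. F \<tau> x * H' \<tau> x + F' \<tau> x * H \<tau> x)"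
  using assms(1)
proof induction
  case (base p a a')
  then show ?case using time_poly_mult_base[OF assms(2)] by blast
next
  case (add F F' G G')
  from time_poly.add[OF add.IH] show ?case by (simp add: algebra_simps)
qed

lemma time_poly_rot:
  assumes "time_poly F F'"
  shows "time_poly (\<lambda>\<tau>. rot i (F \<tau>)) (\<lambda>\<tau>. rot i (F' \<tau>))"
  using assms
proof induction
  case (base p a a')
  then show ?case using time_poly.base[OF polyf_rot[OF base(1), of i] base(2)] by (simp add: rot_cmult)
next
  case (add F F' G G')
  show ?case using time_poly.add[OF add.IH] time_poly_polyf[OF add(1)] time_poly_polyf[OF add(2)]
    by (simp add: rot_add)
qed

text \<open>
  The exponential series of the matrix \<open>M\<close>, coordinate by coordinate: the Taylor coefficients \<open>d k\<close>
  grow at most like \<open>C ^ k\<close>, so that all series converge everywhere and can be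
  differentiated termwise.
\<close>

lemma linear_ode_solution:
  fixes M :: "'a \<Rightarrow> 'a \<Rightarrow> real"
  assumes "finite E"
  shows "\<exists>c. (\<forall>b\<in>E. c 0 b = c0 b) \<and>
    (\<forall>b\<in>E. \<forall>\<tau>. ((\<lambda>\<tau>. c \<tau> b) has_real_derivative (\<Sum>a\<in>E. c \<tau> a * M a b)) (at \<tau>))"
proof -
  define d where "d = rec_nat c0 (\<lambda>_ v b. \<Sum>a\<in>E. v a * M a b)"
  have d: "d 0 = c0" "\<And>k. d (Suc k) = (\<lambda>b. \<Sum>a\<in>E. d k a * M a b)" by (simp_all add: d_def)
  \<comment> \<open>One step of the recursion for \<open>d\<close> increases its \<open>l\<^sup>1\<close> norm \<open>N\<close> at most by the factor \<open>C\<close>.\<close>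
  define C where "C = (\<Sum>a\<in>E. \<Sum>b\<in>E. \<bar>M a b\<bar>)"
  define N where "N k = (\<Sum>b\<in>E. \<bar>d k b\<bar>)" for k
  have C: "(\<Sum>b\<in>E. \<bar>M a b\<bar>) \<le> C" if "a \<in> E" for a
    unfolding C_def using that assms by (intro member_le_sum) (auto simp: sum_nonneg)
  have N_Suc: "N (Suc k) \<le> N k * C" for k
  proof -
    have "N (Suc k) \<le> (\<Sum>b\<in>E. \<Sum>a\<in>E. \<bar>d k a\<bar> * \<bar>M a b\<bar>)"
      unfolding N_def d by (intro sum_mono order.trans[OF sum_abs]) (simp add: abs_mult)
    also have "\<dots> = (\<Sum>a\<in>E. \<bar>d k a\<bar> * (\<Sum>b\<in>E. \<bar>M a b\<bar>))"
      by (subst sum.swap) (simp add: sum_distrib_left)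
    also have "\<dots> \<le> (\<Sum>a\<in>E. \<bar>d k a\<bar> * C)"
      by (intro sum_mono mult_left_mono C) auto
    finally show ?thesis by (simp add: N_def sum_distrib_right)
  qed
  have C0: "C \<ge> 0" by (simp add: C_def sum_nonneg)
  have N: "N k \<le> N 0 * C ^ k" for k
  proof (induction k)
    case (Suc k)
    have "N (Suc k) \<le> N k * C" by (rule N_Suc)
    also have "\<dots> \<le> (N 0 * C ^ k) * C" using Suc C0 by (intro mult_right_mono)
    finally show ?case by (simp add: mult_ac)
  qed simp
  have dN: "\<bar>d k b\<bar> \<le> N 0 * C ^ k" if "b \<in> E" for k b
    using member_le_sum[of b E "\<lambda>b. \<bar>d k b\<bar>"] that assms N[of k] by (simp add: N_def)
  define e where "e b k = d k b / fact k" for b k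
  have summ: "summable (\<lambda>k. e b k * y ^ k)" if "b \<in> E" for b and y :: real
  proof (rule summable_comparison_test)
    show "\<exists>n0. \<forall>n\<ge>n0. norm (e b n * y ^ n) \<le> N 0 * (inverse (fact n) * (C * \<bar>y\<bar>) ^ n)"
    proof (intro exI[of _ 0] allI impI)
      fix n
      have "norm (e b n * y ^ n) = \<bar>d n b\<bar> * (inverse (fact n) * \<bar>y\<bar> ^ n)"
        by (simp add: e_def abs_mult power_abs divide_inverse)
      also have "\<dots> \<le> (N 0 * C ^ n) * (inverse (fact n) * \<bar>y\<bar> ^ n)"
        using dN[OF that] by (intro mult_right_mono) auto
      finally show "norm (e b n * y ^ n) \<le> N 0 * (inverse (fact n) * (C * \<bar>y\<bar>) ^ n)"
        by (simp add: power_mult_distrib mult_ac)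
    qed
    show "summable (\<lambda>n. N 0 * (inverse (fact n) * (C * \<bar>y\<bar>) ^ n))"
      by (intro summable_mult summable_exp)
  qed
  define c where "c \<tau> b = (\<Sum>k. e b k * \<tau> ^ k)" for \<tau> b
  have "((\<lambda>\<tau>. c \<tau> b) has_real_derivative (\<Sum>a\<in>E. c \<tau> a * M a b)) (at \<tau>)" if b: "b \<in> E" for b \<tau>
  proof -
    have "((\<lambda>\<tau>. c \<tau> b) has_real_derivative (\<Sum>k. diffs (e b) k * \<tau> ^ k)) (at \<tau>)"
      unfolding c_def by (rule termdiffs_strong_converges_everywhere[OF summ[OF b]])
    also have "(\<Sum>k. diffs (e b) k * \<tau> ^ k) = (\<Sum>k. \<Sum>a\<in>E. e a k * \<tau> ^ k * M a b)"
      by (intro suminf_cong) (simp add: diffs_def e_def d sum_distrib_left sum_distrib_right divide_simps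
        del: of_nat_Suc, simp add: field_simps)
    also have "\<dots> = (\<Sum>a\<in>E. \<Sum>k. e a k * \<tau> ^ k * M a b)"
      by (rule suminf_sum) (intro summable_mult2 summ)
    also have "\<dots> = (\<Sum>a\<in>E. c \<tau> a * M a b)"
      by (intro sum.cong refl) (simp add: c_def suminf_mult2[OF summ])
    finally show ?thesis .
  qed
  moreover have "c 0 b = c0 b" if "b \<in> E" for b
  proof -
    have "(\<lambda>k. e b k * 0 ^ k) sums (e b 0)"
      using powser_sums_zero[of "e b"] by simp
    then show ?thesis by (simp add: c_def sums_iff e_def d)
  qed
  ultimately show ?thesis by blast
qed

text \<open>
  On a stable space the generator is a matrix, and the coefficients of the solution follow the
  transposed linear system.
\<close>

lemma rot_gen_flow:
  assumes "polyf f"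
  obtains u where "time_poly u (\<lambda>\<tau>. rot_gen \<mu> (u \<tau>))" "u 0 = f"
proof -
  obtain E where E: "rot_stable E" "lincomb E f" using polyf_in_rot_stable[OF assms] by blast
  have fin: "finite E" and p: "\<And>e. e \<in> E \<Longrightarrow> polyf e" using E by (auto simp: rot_stable_def)
  obtain c0 where c0: "f = (\<lambda>x. \<Sum>b\<in>E. c0 b * b x)" using E unfolding lincomb_def by blast
  have "\<forall>e\<in>E. \<exists>m. rot_gen \<mu> e = (\<lambda>x. \<Sum>b\<in>E. m b * b x)"
    using lincomb_rot_gen[OF E(1) lincomb_mem[OF fin]] unfolding lincomb_def by blast
  then obtain M where M: "\<And>e. e \<in> E \<Longrightarrow> rot_gen \<mu> e = (\<lambda>x. \<Sum>b\<in>E. M e b * b x)" by metis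
  obtain c where c: "\<And>b. b \<in> E \<Longrightarrow> c 0 b = c0 b"
    "\<And>b \<tau>. b \<in> E \<Longrightarrow> ((\<lambda>\<tau>. c \<tau> b) has_real_derivative (\<Sum>a\<in>E. c \<tau> a * M a b)) (at \<tau>)"
    using linear_ode_solution[OF fin, of c0 M] by blast
  define u where "u \<tau> x = (\<Sum>b\<in>E. c \<tau> b * b x)" for \<tau> x
  have gen: "rot_gen \<mu> (u \<tau>) x = (\<Sum>b\<in>E. (\<Sum>a\<in>E. c \<tau> a * M a b) * b x)" for \<tau> x
  proof -
    have "rot_gen \<mu> (\<lambda>x. \<Sum>b\<in>F. c \<tau> b * b x) = (\<lambda>x. \<Sum>b\<in>F. c \<tau> b * rot_gen \<mu> b x)" if "F \<subseteq> E" for F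
      using finite_subset[OF that fin] that
    proof (induction F rule: finite_induct)
      case empty
      then show ?case by (simp add: rot_gen_const)
    next
      case (insert b F)
      have "polyf (\<lambda>x. \<Sum>b\<in>F. c \<tau> b * b x)" using insert p by (intro polyf_intros) auto
      then show ?case using insert p by (simp add: rot_gen_add rot_gen_cmult polyf_intros)
    qed
    then have "rot_gen \<mu> (u \<tau>) x = (\<Sum>a\<in>E. \<Sum>b\<in>E. c \<tau> a * (M a b * b x))"
      unfolding u_def by (simp add: M sum_distrib_left)
    then show ?thesis by (subst (asm) sum.swap) (simp add: sum_distrib_right mult.assoc)
  qed
  have "time_poly u (\<lambda>\<tau> x. \<Sum>b\<in>E. (\<Sum>a\<in>E. c \<tau> a * M a b) * b x)"
    unfolding u_def by (intro time_poly_sum time_poly.base fin p c(2))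
  moreover have "(\<lambda>\<tau> x. \<Sum>b\<in>E. (\<Sum>a\<in>E. c \<tau> a * M a b) * b x) = (\<lambda>\<tau>. rot_gen \<mu> (u \<tau>))"
    by (simp add: fun_eq_iff gen)
  moreover have "u 0 = f" by (simp add: u_def fun_eq_iff c c0)
  ultimately show ?thesis using that by simp
qed

context feller_diffusion
begin

text \<open>
  The product rule for \<open>T s\<close> applied to the moving polynomial \<open>F (t - s)\<close>: the semigroup
  contributes the generator, the moving argument contributes \<open>- F'\<close>.
\<close>

lemma duhamel:
  assumes "time_poly F F'" "x \<in> S2"
  shows "continuous_on {0..} (\<lambda>s. T s (F (t - s)) x)"
    and "s > 0 \<Longrightarrow> ((\<lambda>s. T s (F (t - s)) x) has_real_derivative
      T s (\<lambda>y. rot_gen \<mu> (F (t - s)) y - F' (t - s) y) x) (at s)"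
proof -
  have "continuous_on {0..} (\<lambda>s. T s (F (t - s)) x) \<and> (\<forall>s>0. ((\<lambda>s. T s (F (t - s)) x) has_real_derivative
      T s (\<lambda>y. rot_gen \<mu> (F (t - s)) y - F' (t - s) y) x) (at s))"
    using assms(1)
  proof induction
    case (base p a a')
    have "continuous_on UNIV a"
      using base(2) by (meson DERIV_isCont continuous_at_imp_continuous_on)
    then have c: "continuous_on {0..} (\<lambda>s. T s (\<lambda>y. a (t - s) * p y) x)"
      unfolding T_cmult using base assms(2)
      by (intro continuous_on_mult T_time_continuous polyf_continuous_on
        continuous_on_compose2[of UNIV a _ "\<lambda>s. t - s"] continuous_intros) auto
    moreover have "((\<lambda>s. T s (\<lambda>y. a (t - s) * p y) x) has_real_derivative
      T s (\<lambda>y. rot_gen \<mu> (\<lambda>y. a (t - s) * p y) y - a' (t - s) * p y) x) (at s)" if s: "s > 0" for s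
    proof -
      have "((\<lambda>s. a (t - s)) has_real_derivative a' (t - s) * (0 - 1)) (at s)"
        by (rule DERIV_chain2[OF base(2)]) (auto intro!: derivative_eq_intros)
      from DERIV_mult[OF this T_has_derivative[OF base(1) assms(2) s]]
      have "((\<lambda>s. T s (\<lambda>y. a (t - s) * p y) x) has_real_derivative
        a (t - s) * T s (rot_gen \<mu> p) x - a' (t - s) * T s p x) (at s)"
        unfolding T_cmult by (simp add: algebra_simps)
      also have "a (t - s) * T s (rot_gen \<mu> p) x - a' (t - s) * T s p x =
          T s (\<lambda>y. rot_gen \<mu> (\<lambda>y. a (t - s) * p y) y - a' (t - s) * p y) x"
        unfolding rot_gen_cmult[OF base(1)] T_cmult[symmetric]
        using s assms(2) base(1) by (intro T_add_diff(2)[symmetric] polyf_continuous_on polyf_intros polyf_rot_gen) auto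
      finally show ?thesis .
    qed
    ultimately show ?case by blast
  next
    case (add F F' H H')
    note p = time_poly_polyf[OF add(1)] time_poly_polyf[OF add(2)]
    have T: "T s (\<lambda>y. F (t - s) y + H (t - s) y) x = T s (F (t - s)) x + T s (H (t - s)) x" if "s \<ge> 0" for s
      using that assms(2) p by (intro T_add_diff polyf_continuous_on) auto
    have "continuous_on {0..} (\<lambda>s. T s (F (t - s)) x + T s (H (t - s)) x)"
      using add.IH by (intro continuous_on_add) auto
    then have "continuous_on {0..} (\<lambda>s. T s (\<lambda>y. F (t - s) y + H (t - s) y) x)"
      by (subst continuous_on_cong[OF refl T]) auto
    moreover have "((\<lambda>s. T s (\<lambda>y. F (t - s) y + H (t - s) y) x) has_real_derivative
      T s (\<lambda>y. rot_gen \<mu> (\<lambda>y. F (t - s) y + H (t - s) y) y - (F' (t - s) y + H' (t - s) y)) x) (at s)"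
      if s: "s > 0" for s
    proof -
      have "T s (\<lambda>y. rot_gen \<mu> (\<lambda>y. F (t - s) y + H (t - s) y) y - (F' (t - s) y + H' (t - s) y)) x
        = T s (\<lambda>y. (rot_gen \<mu> (F (t - s)) y - F' (t - s) y) + (rot_gen \<mu> (H (t - s)) y - H' (t - s) y)) x"
        by (simp add: rot_gen_add p algebra_simps)
      also have "\<dots> = T s (\<lambda>y. rot_gen \<mu> (F (t - s)) y - F' (t - s) y) x + T s (\<lambda>y. rot_gen \<mu> (H (t - s)) y - H' (t - s) y) x"
        using s assms(2) p by (intro T_add_diff(1) polyf_continuous_on polyf_intros polyf_rot_gen) auto
      finally have eq: "T s (\<lambda>y. rot_gen \<mu> (\<lambda>y. F (t - s) y + H (t - s) y) y - (F' (t - s) y + H' (t - s) y)) x = \<dots>" .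
      have "((\<lambda>s. T s (F (t - s)) x + T s (H (t - s)) x) has_real_derivative
        T s (\<lambda>y. rot_gen \<mu> (F (t - s)) y - F' (t - s) y) x + T s (\<lambda>y. rot_gen \<mu> (H (t - s)) y - H' (t - s) y) x) (at s)"
        using add.IH s by (intro DERIV_add) auto
      then show ?thesis unfolding eq
        using s T by (elim has_field_derivative_transform_within_open[where S = "{0<..}"]) auto
    qed
    ultimately show ?case by blast
  qed
  then show "continuous_on {0..} (\<lambda>s. T s (F (t - s)) x)"
    and "s > 0 \<Longrightarrow> ((\<lambda>s. T s (F (t - s)) x) has_real_derivative
      T s (\<lambda>y. rot_gen \<mu> (F (t - s)) y - F' (t - s) y) x) (at s)" by auto
qed

text \<open>
  The maximum principle in semigroup form: a subsolution stays below the evolution of its initial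
  value.
\<close>

lemma duhamel_mono:
  assumes F: "time_poly F F'" and x: "x \<in> S2" and t: "t \<ge> 0"
    and sub: "\<And>\<tau> y. \<tau> \<ge> 0 \<Longrightarrow> y \<in> S2 \<Longrightarrow> F' \<tau> y \<le> rot_gen \<mu> (F \<tau>) y"
  shows "F t x \<le> T t (F 0) x"
proof (cases "t = 0")
  case True
  then show ?thesis using x by (simp add: T_0 polyf_continuous_on time_poly_polyf[OF F])
next
  case False
  let ?h = "\<lambda>s. T s (F (t - s)) x"
  have "continuous_on {0..t} ?h"
    using duhamel(1)[OF F x] by (rule continuous_on_subset) auto
  moreover have diff: "?h differentiable (at z)" if "0 < z" "z < t" for z
    using duhamel(2)[OF F x that(1)] real_differentiable_def by blast
  ultimately obtain l z where z: "0 < z" "z < t" "(?h has_real_derivative l) (at z)" "?h t - ?h 0 = (t - 0) * l"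
    using MVT[of 0 t ?h] diff False t by auto
  have p: "polyf (F \<tau>)" "polyf (F' \<tau>)" for \<tau> using time_poly_polyf[OF F] by auto
  have "l = T z (\<lambda>y. rot_gen \<mu> (F (t - z)) y - F' (t - z) y) x"
    using DERIV_unique[OF z(3) duhamel(2)[OF F x z(1)]] .
  also have "\<dots> \<ge> T z (\<lambda>y. 0) x"
    using z x sub p by (intro T_mono polyf_continuous_on polyf_intros polyf_rot_gen) auto
  finally have "l \<ge> 0" using z x by (simp add: T_const)
  then have "(t - 0) * l \<ge> 0" using t by simp
  then have "?h 0 \<le> ?h t" using z(4) by linarith
  moreover have "?h 0 = F t x"
    using T_0[OF polyf_continuous_on[OF p(1)[of t]] x] by (simp only: diff_zero)
  ultimately show ?thesis by simp
qed

text \<open>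
  A solution is at once a subsolution and, up to the sign, a supersolution.
\<close>

lemma T_eq_flow:
  assumes u: "time_poly u (\<lambda>\<tau>. rot_gen \<mu> (u \<tau>))" and x: "x \<in> S2" and t: "t \<ge> 0"
  shows "T t (u 0) x = u t x"
proof (rule antisym)
  show "u t x \<le> T t (u 0) x" by (rule duhamel_mono[OF u x t]) simp
  have c: "time_poly (\<lambda>\<tau> y. -1) (\<lambda>\<tau> y. 0)"
    using time_poly.base[of "\<lambda>_. 1" "\<lambda>_. -1" "\<lambda>_. 0"] by (simp add: polyf_intros)
  have "polyf (u \<tau>)" for \<tau> using time_poly_polyf[OF u] by auto
  then have "time_poly (\<lambda>\<tau> x. - 1 * u \<tau> x) (\<lambda>\<tau>. rot_gen \<mu> (\<lambda>x. - 1 * u \<tau> x))"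
    using time_poly_mult[OF c u] by (simp only: rot_gen_cmult) simp
  from duhamel_mono[OF this x t] show "T t (u 0) x \<le> u t x" by (simp only: T_cmult) simp
qed

text \<open>
  The reverse Poincare inequality. The function \<open>2 \<tau> \<Gamma>(u\<^sub>\<tau>) + u\<^sub>\<tau>\<^sup>2\<close> is a subsolution: in
  the time derivative minus the generator, the term \<open>2 \<Gamma>(u)\<close> from the factor \<open>2 \<tau>\<close> cancels the one
  from \<open>G (u\<^sup>2) = 2 u G u + 2 \<Gamma>(u)\<close>, and the rest has a sign by \<open>bochner_identity\<close>. At time \<open>0\<close> it is \<open>u\<^sub>0\<^sup>2 \<le> 1\<close>.
\<close>

lemma gradient_bound:
  assumes u: "time_poly u (\<lambda>\<tau>. rot_gen \<mu> (u \<tau>))" and x: "x \<in> S2" and t: "t \<ge> 0"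
    and b: "\<And>y. y \<in> S2 \<Longrightarrow> \<bar>u 0 y\<bar> \<le> 1"
  shows "2 * t * sq_gradient (u t) x \<le> 1"
proof -
  have p: "polyf (u \<tau>)" for \<tau> by (rule time_poly_polyf(1)[OF u])
  note p' = p polyf_rot polyf_rot_gen polyf_intros
  \<comment> \<open>The factors \<open>1\<close> are the constant polynomial by which \<open>time_poly\<close> represents functions of time alone.\<close>
  define F where "F \<tau> y = (2 * \<tau>) * 1 * sq_gradient (u \<tau>) y + u \<tau> y * u \<tau> y" for \<tau> y
  define F' where "F' \<tau> y = ((2 * \<tau>) * 1) * (\<Sum>i\<in>UNIV. rot i (u \<tau>) y * rot i (rot_gen \<mu> (u \<tau>)) y
      + rot i (rot_gen \<mu> (u \<tau>)) y * rot i (u \<tau>) y) + (2 * 1) * sq_gradient (u \<tau>) y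
      + (u \<tau> y * rot_gen \<mu> (u \<tau>) y + rot_gen \<mu> (u \<tau>) y * u \<tau> y)" for \<tau> y
  have tp: "time_poly (\<lambda>\<tau> y. (2 * \<tau>) * 1) (\<lambda>\<tau> y. 2 * 1)"
    by (rule time_poly.base) (auto intro: polyf_intros intro!: derivative_eq_intros)
  have "time_poly F F'"
    unfolding F_def F'_def sq_gradient_def
    by (intro time_poly.add time_poly_mult[OF tp] time_poly_sum time_poly_mult time_poly_rot u finite)
  moreover have "F' \<tau> y \<le> rot_gen \<mu> (F \<tau>) y" if "\<tau> \<ge> 0" "y \<in> S2" for \<tau> y
  proof -
    have g: "polyf (sq_gradient (u \<tau>))" unfolding sq_gradient_def[abs_def] by (intro p' finite)
    have "rot_gen \<mu> (F \<tau>) y = 2 * \<tau> * rot_gen \<mu> (sq_gradient (u \<tau>)) y + (2 * (u \<tau> y * rot_gen \<mu> (u \<tau>) y) + 2 * sq_gradient (u \<tau>) y)"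
      unfolding F_def[abs_def] using g p by (simp add: rot_gen_add rot_gen_cmult rot_gen_mult p' sq_gradient_def[of _ y])
    moreover have "F' \<tau> y = 2 * \<tau> * (2 * (\<Sum>i\<in>UNIV. rot i (u \<tau>) y * rot i (rot_gen \<mu> (u \<tau>)) y))
       + 2 * sq_gradient (u \<tau>) y + 2 * (u \<tau> y * rot_gen \<mu> (u \<tau>) y)"
      unfolding F'_def by (simp add: sum_3 algebra_simps)
    moreover have "rot_gen \<mu> (sq_gradient (u \<tau>)) y = 2 * (\<Sum>i\<in>UNIV. rot i (u \<tau>) y * rot i (rot_gen \<mu> (u \<tau>)) y)
      + 2 * (\<Sum>i\<in>UNIV. \<Sum>j\<in>UNIV. (rot j (rot i (u \<tau>)) y)\<^sup>2)"
      using bochner_identity[OF p, of \<mu> \<tau> y] by linarith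
    ultimately have "rot_gen \<mu> (F \<tau>) y - F' \<tau> y
        = 2 * \<tau> * (2 * (\<Sum>i\<in>UNIV. \<Sum>j\<in>UNIV. (rot j (rot i (u \<tau>)) y)\<^sup>2))"
      by (simp add: algebra_simps)
    moreover have "\<dots> \<ge> 0" using that by (intro mult_nonneg_nonneg sum_nonneg) auto
    ultimately show ?thesis by linarith
  qed
  ultimately have "F t x \<le> T t (F 0) x" using x t by (intro duhamel_mono)
  also have "\<dots> \<le> T t (\<lambda>y. 1) x"
  proof (intro T_mono x t continuous_intros)
    show "continuous_on S2 (F 0)" unfolding F_def[abs_def] sq_gradient_def by (intro polyf_continuous_on p' finite)
    show "F 0 y \<le> 1" if "y \<in> S2" for y
      using abs_le_square_iff[of "u 0 y" 1] b[OF that] by (simp add: F_def power2_eq_square)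
  qed
  finally have "2 * t * sq_gradient (u t) x + u t x * u t x \<le> 1" using x t by (simp add: T_const F_def)
  moreover have "0 \<le> u t x * u t x" by simp
  ultimately show ?thesis by linarith
qed

end

section \<open>Integration over the sphere\<close>

lemma space_S2_borel: "space S2_borel = S2"
  by (simp add: space_restrict_space)

lemma continuous_sph: "continuous_on UNIV sph"
  unfolding sph_expand case_prod_beta by (intro continuous_intros)

lemma space_sets_sphere_measure: "space sphere_measure = S2" "sets sphere_measure = sets S2_borel"
  by (simp_all add: sphere_measure_def space_restrict_space)

lemma integral_sphere_measure:
  fixes f :: "real^3 \<Rightarrow> real"
  assumes f: "continuous_on UNIV f"
  shows "(\<integral>x. f x \<partial>sphere_measure) =
    integral (cbox (0, 0) (pi, 2 * pi)) (\<lambda>p. sin (fst p) * f (sph p))"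
proof -
  let ?B = "{0..pi} \<times> {0..2 * pi} :: (real \<times> real) set"
  let ?R = "restrict_space lborel ?B :: (real \<times> real) measure"
  have B: "?B = cbox (0, 0) (pi, 2 * pi)" by (simp add: cbox_Pair_eq)
  have B': "?B \<in> sets borel" unfolding B by simp
  have D: "(\<lambda>(\<theta>, \<phi>). ennreal (sin \<theta>)) = (\<lambda>p::real \<times> real. ennreal (sin (fst p)))"
    by (auto simp: fun_eq_iff)
  have fm: "f \<in> borel_measurable S2_borel"
    using borel_measurable_continuous_on_restrict continuous_on_subset[OF f] by blast
  have meas: "g \<in> borel_measurable ?R" if "continuous_on UNIV g" for g :: "real \<times> real \<Rightarrow> real"
    using borel_measurable_continuous_onI[OF that] by (intro measurable_restrict_space1) simp
  have [measurable]: "(\<lambda>p. sin (fst p)) \<in> borel_measurable ?R"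
    by (intro meas continuous_intros)
  have cfs: "continuous_on UNIV (\<lambda>p. f (sph p))"
    by (intro continuous_on_compose2[OF f continuous_sph]) auto
  note fsm = meas[OF cfs]
  have sphm: "sph \<in> ?R \<rightarrow>\<^sub>M S2_borel"
    using measurable_restrict_space1[OF measurable_sph] by (simp cong: measurable_cong_sets sets_restrict_space_cong)
  have "(\<integral>x. f x \<partial>sphere_measure) = (\<integral>p. f (sph p) \<partial>density ?R (\<lambda>p. ennreal (sin (fst p))))"
    unfolding sphere_measure_def D using sphm by (intro integral_distr fm) (simp cong: measurable_cong_sets)
  also have "\<dots> = (\<integral>p. sin (fst p) *\<^sub>R f (sph p) \<partial>?R)"
    by (intro integral_density fsm AE_I2) (auto simp: space_restrict_space intro: sin_ge_zero)
  also have "\<dots> = (\<integral>p. indicator ?B p *\<^sub>R (sin (fst p) *\<^sub>R f (sph p)) \<partial>lborel)"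
    using B' by (intro integral_restrict_space) simp
  also have "\<dots> = (LINT p:?B|lborel. sin (fst p) * f (sph p))"
    by (simp add: set_lebesgue_integral_def)
  also have "\<dots> = integral ?B (\<lambda>p. sin (fst p) * f (sph p))"
  proof (rule set_borel_integral_eq_integral(2))
    have "continuous_on ?B (\<lambda>p. sin (fst p) * f (sph p))"
      by (intro continuous_intros continuous_on_subset[OF cfs]) auto
    then show "set_integrable lborel ?B (\<lambda>p. sin (fst p) * f (sph p))"
      unfolding set_integrable_def B by (intro borel_integrable_compact) auto
  qed
  finally show ?thesis by (simp add: B)
qed

lemma integral_divergence_rectangle:
  fixes a b :: "real \<Rightarrow> real \<Rightarrow> real"
  assumes a: "\<And>x y. ((\<lambda>x. a x y) has_real_derivative a' (x, y)) (at x)" "\<And>y. a p y = a 0 y"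
    and b: "\<And>x y. ((\<lambda>y. b x y) has_real_derivative b' (x, y)) (at y)" "\<And>x. b x q = b x 0"
    and c: "continuous_on UNIV a'" "continuous_on UNIV b'"
    and pq: "p \<ge> 0" "q \<ge> 0"
  shows "integral (cbox (0, 0) (p, q)) (\<lambda>z. a' z + b' z) = 0"
proof -
  have int: "a' integrable_on cbox (0, 0) (p, q)" "b' integrable_on cbox (0, 0) (p, q)"
    using c continuous_on_subset by (blast intro: integrable_continuous)+
  have "(b' \<circ> Pair x has_integral 0) (cbox 0 q)" for x
    using fundamental_theorem_of_calculus[OF pq(2), of "\<lambda>y. b x y" "b' \<circ> Pair x"] b
    by (simp add: has_real_derivative_iff_has_vector_derivative[symmetric] has_field_derivative_at_within)
  then have ib: "integral (cbox 0 q) (\<lambda>y. b' (x, y)) = 0" for x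
    by (auto simp: o_def dest: integral_unique)
  have "((\<lambda>x. a' (x, y)) has_integral 0) (cbox 0 p)" for y
    using fundamental_theorem_of_calculus[OF pq(1), of "\<lambda>x. a x y" "\<lambda>x. a' (x, y)"] a
    by (simp add: has_real_derivative_iff_has_vector_derivative[symmetric] has_field_derivative_at_within)
  then have ia: "integral (cbox 0 p) (\<lambda>x. a' (x, y)) = 0" for y
    by (auto dest: integral_unique)
  have "integral (cbox (0, 0) (p, q)) a' = integral (cbox 0 p) (\<lambda>x. integral (cbox 0 q) (\<lambda>y. a' (x, y)))"
    using c(1) by (intro integral_prod_continuous) (rule continuous_on_subset, auto)
  also have "\<dots> = integral (cbox 0 q) (\<lambda>y. integral (cbox 0 p) (\<lambda>x. a' (x, y)))"
    using c(1) by (intro integral_swap_continuous) (auto intro: continuous_on_subset)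
  also have "\<dots> = 0" by (simp add: ia del: box_real)
  finally have "integral (cbox (0, 0) (p, q)) a' = 0" .
  moreover have "integral (cbox (0, 0) (p, q)) b' = integral (cbox 0 p) (\<lambda>x. integral (cbox 0 q) (\<lambda>y. b' (x, y)))"
    using c(2) by (intro integral_prod_continuous) (rule continuous_on_subset, auto)
  ultimately show ?thesis using int by (simp add: Henstock_Kurzweil_Integration.integral_add ib del: box_real)
qed

lemma sph_derivatives:
  assumes f: "polyf f"
  shows "((\<lambda>\<theta>. f (sph (\<theta>, \<phi>))) has_real_derivative
      cos \<phi> * rot 2 f (sph (\<theta>, \<phi>)) - sin \<phi> * rot 1 f (sph (\<theta>, \<phi>))) (at \<theta>)"
    and "((\<lambda>\<phi>. f (sph (\<theta>, \<phi>))) has_real_derivative rot 3 f (sph (\<theta>, \<phi>))) (at \<phi>)"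
proof -
  let ?s = "sph (\<theta>, \<phi>)"
  let ?D = "frechet_derivative f (at ?s)"
  note D = polyf_has_derivative[OF f, of ?s]
  have lin: "linear ?D" using has_derivative_linear[OF D] .
  have D\<theta>: "((\<lambda>\<theta>. sph (\<theta>, \<phi>)) has_derivative (\<lambda>h. h *\<^sub>R
    (cos \<phi> *\<^sub>R cross3 (axis 2 1) ?s - sin \<phi> *\<^sub>R cross3 (axis 1 1) ?s))) (at \<theta>)"
  proof -
    have "((\<lambda>\<theta>. sph (\<theta>, \<phi>)) has_derivative (\<lambda>h. h *\<^sub>R
      ((cos \<theta> * cos \<phi>) *\<^sub>R axis 1 1 + (cos \<theta> * sin \<phi>) *\<^sub>R axis 2 1 - sin \<theta> *\<^sub>R axis 3 1))) (at \<theta>)"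
      unfolding sph_expand prod.case by (auto intro!: derivative_eq_intros simp: fun_eq_iff algebra_simps)
    also have "(cos \<theta> * cos \<phi>) *\<^sub>R axis 1 1 + (cos \<theta> * sin \<phi>) *\<^sub>R axis 2 1 - sin \<theta> *\<^sub>R axis 3 1
      = cos \<phi> *\<^sub>R cross3 (axis 2 1) ?s - sin \<phi> *\<^sub>R cross3 (axis 1 1) ?s"
      using sin_cos_squared_add3[of \<phi>]
      by (simp add: vec_eq_iff forall_3 cross3_def sph_components axis_def, algebra)
    finally show ?thesis .
  qed
  from has_derivative_compose[OF D\<theta> D]
  show "((\<lambda>\<theta>. f (sph (\<theta>, \<phi>))) has_real_derivative
      cos \<phi> * rot 2 f (sph (\<theta>, \<phi>)) - sin \<phi> * rot 1 f (sph (\<theta>, \<phi>))) (at \<theta>)"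
    by (simp add: has_field_derivative_def rot_def linear_cmul[OF lin] linear_diff[OF lin] mult_commute_abs)
  have D\<phi>: "((\<lambda>\<phi>. sph (\<theta>, \<phi>)) has_derivative (\<lambda>h. h *\<^sub>R cross3 (axis 3 1) ?s)) (at \<phi>)"
  proof -
    have "((\<lambda>\<phi>. sph (\<theta>, \<phi>)) has_derivative (\<lambda>h. h *\<^sub>R
      ((sin \<theta> * (- sin \<phi>)) *\<^sub>R axis 1 1 + (sin \<theta> * cos \<phi>) *\<^sub>R axis 2 1))) (at \<phi>)"
      unfolding sph_expand prod.case by (auto intro!: derivative_eq_intros simp: fun_eq_iff algebra_simps)
    also have "(sin \<theta> * (- sin \<phi>)) *\<^sub>R axis 1 1 + (sin \<theta> * cos \<phi>) *\<^sub>R axis 2 1 = cross3 (axis 3 1) ?s"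
      by (simp add: vec_eq_iff forall_3 cross3_def sph_components axis_def)
    finally show ?thesis .
  qed
  from has_derivative_compose[OF D\<phi> D]
  show "((\<lambda>\<phi>. f (sph (\<theta>, \<phi>))) has_real_derivative rot 3 f (sph (\<theta>, \<phi>))) (at \<phi>)"
    by (simp add: has_field_derivative_def rot_def linear_cmul[OF lin] mult_commute_abs)
qed

text \<open>
  In spherical coordinates each rotation field, multiplied by the density \<open>sin \<theta>\<close>, is a divergence:
  \<open>sin \<theta> L\<^sub>1 f = \<partial>\<^sub>\<theta> (- sin \<phi> sin \<theta> f) + \<partial>\<^sub>\<phi> (- cos \<theta> cos \<phi> f)\<close>,
  \<open>sin \<theta> L\<^sub>2 f = \<partial>\<^sub>\<theta> (cos \<phi> sin \<theta> f) + \<partial>\<^sub>\<phi> (- cos \<theta> sin \<phi> f)\<close> and \<open>sin \<theta> L\<^sub>3 f = \<partial>\<^sub>\<phi> (sin \<theta> f)\<close>.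
  The boundary terms vanish at the poles, where \<open>sin \<theta> = 0\<close>, and cancel by periodicity in \<open>\<phi>\<close>.
\<close>

lemma integral_rot_zero:
  assumes f: "polyf f"
  shows "(\<integral>x. rot i f x \<partial>sphere_measure) = 0"
proof -
  have c: "continuous_on UNIV (\<lambda>z. g (sph z))" if "polyf g" for g
    by (intro continuous_on_compose2[OF polyf_continuous_on[OF that] continuous_sph]) auto
  note c' = c[OF f] c[OF polyf_rot[OF f, of 1]] c[OF polyf_rot[OF f, of 2]] c[OF polyf_rot[OF f, of 3]]
  \<comment> \<open>\<open>\<Sum>\<^sub>i x\<^sub>i L\<^sub>i = 0\<close>, since \<open>\<Sum>\<^sub>i x\<^sub>i (e\<^sub>i \<times> x) = x \<times> x\<close>.\<close>
  have R: "sin \<theta> * cos \<phi> * rot 1 f (sph (\<theta>, \<phi>)) + sin \<theta> * sin \<phi> * rot 2 f (sph (\<theta>, \<phi>))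
      + cos \<theta> * rot 3 f (sph (\<theta>, \<phi>)) = 0" for \<theta> \<phi>
    by (simp add: rot_eq_pd[OF f] sph_components, simp add: algebra_simps)
  have per: "sph (\<theta>, 2 * pi) = sph (\<theta>, 0)" for \<theta> by (simp add: sph_def)
  note d = sph_derivatives[OF f]
  have H: "(\<integral>x. rot i f x \<partial>sphere_measure) = 0"
    if a: "\<And>x y. ((\<lambda>x. a x y) has_real_derivative a' (x, y)) (at x)" "\<And>y. a pi y = a 0 y"
      and b: "\<And>x y. ((\<lambda>y. b x y) has_real_derivative b' (x, y)) (at y)" "\<And>x. b x (2 * pi) = b x 0"
      and ab: "continuous_on UNIV a'" "continuous_on UNIV b'"
        "\<And>\<theta> \<phi>. sin \<theta> * rot i f (sph (\<theta>, \<phi>)) = a' (\<theta>, \<phi>) + b' (\<theta>, \<phi>)" for a b a' b' i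
  proof -
    have "(\<integral>x. rot i f x \<partial>sphere_measure) = integral (cbox (0, 0) (pi, 2 * pi)) (\<lambda>z. a' z + b' z)"
      unfolding integral_sphere_measure[OF polyf_continuous_on[OF polyf_rot[OF f]]]
      by (rule arg_cong[where f = "integral _"]) (auto simp: fun_eq_iff ab(3))
    also have "\<dots> = 0" by (rule integral_divergence_rectangle[OF a b ab(1,2)]) auto
    finally show ?thesis .
  qed
  consider "i = 1" | "i = 2" | "i = 3" using exhaust_3 by blast
  then show ?thesis
  proof cases
    case 1
    show ?thesis unfolding 1
    proof (rule H)
      show "((\<lambda>\<theta>. - sin \<phi> * sin \<theta> * f (sph (\<theta>, \<phi>))) has_real_derivative
        (\<lambda>z. - sin (snd z) * cos (fst z) * f (sph z)
          - sin (snd z) * sin (fst z) * (cos (snd z) * rot 2 f (sph z) - sin (snd z) * rot 1 f (sph z))) (\<theta>, \<phi>)) (at \<theta>)"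
        for \<theta> \<phi> by (auto intro!: derivative_eq_intros d simp: algebra_simps)
      show "((\<lambda>\<phi>. - cos \<theta> * cos \<phi> * f (sph (\<theta>, \<phi>))) has_real_derivative
        (\<lambda>z. sin (snd z) * cos (fst z) * f (sph z) - cos (fst z) * cos (snd z) * rot 3 f (sph z)) (\<theta>, \<phi>)) (at \<phi>)"
        for \<theta> \<phi> by (auto intro!: derivative_eq_intros d simp: algebra_simps)
      show "sin \<theta> * rot 1 f (sph (\<theta>, \<phi>)) =
        (\<lambda>z. - sin (snd z) * cos (fst z) * f (sph z)
          - sin (snd z) * sin (fst z) * (cos (snd z) * rot 2 f (sph z) - sin (snd z) * rot 1 f (sph z))) (\<theta>, \<phi>)
        + (\<lambda>z. sin (snd z) * cos (fst z) * f (sph z) - cos (fst z) * cos (snd z) * rot 3 f (sph z)) (\<theta>, \<phi>)" for \<theta> \<phi>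
        using R[of \<theta> \<phi>] sin_cos_squared_add3[of \<phi>] by (simp, algebra)
    qed (auto simp: per intro!: continuous_intros c')
  next
    case 2
    show ?thesis unfolding 2
    proof (rule H)
      show "((\<lambda>\<theta>. cos \<phi> * sin \<theta> * f (sph (\<theta>, \<phi>))) has_real_derivative
        (\<lambda>z. cos (snd z) * cos (fst z) * f (sph z)
          + cos (snd z) * sin (fst z) * (cos (snd z) * rot 2 f (sph z) - sin (snd z) * rot 1 f (sph z))) (\<theta>, \<phi>)) (at \<theta>)"
        for \<theta> \<phi> by (auto intro!: derivative_eq_intros d simp: algebra_simps)
      show "((\<lambda>\<phi>. - cos \<theta> * sin \<phi> * f (sph (\<theta>, \<phi>))) has_real_derivative
        (\<lambda>z. - cos (snd z) * cos (fst z) * f (sph z) - cos (fst z) * sin (snd z) * rot 3 f (sph z)) (\<theta>, \<phi>)) (at \<phi>)"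
        for \<theta> \<phi> by (auto intro!: derivative_eq_intros d simp: algebra_simps)
      show "sin \<theta> * rot 2 f (sph (\<theta>, \<phi>)) =
        (\<lambda>z. cos (snd z) * cos (fst z) * f (sph z)
          + cos (snd z) * sin (fst z) * (cos (snd z) * rot 2 f (sph z) - sin (snd z) * rot 1 f (sph z))) (\<theta>, \<phi>)
        + (\<lambda>z. - cos (snd z) * cos (fst z) * f (sph z) - cos (fst z) * sin (snd z) * rot 3 f (sph z)) (\<theta>, \<phi>)" for \<theta> \<phi>
        using R[of \<theta> \<phi>] sin_cos_squared_add3[of \<phi>] by (simp, algebra)
    qed (auto simp: per intro!: continuous_intros c')
  next
    case 3
    show ?thesis unfolding 3
    proof (rule H)
      show "((\<lambda>\<theta>. 0) has_real_derivative (\<lambda>z::real\<times>real. 0) (\<theta>, \<phi>)) (at \<theta>)"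
        for \<theta> \<phi> :: real by simp
      show "((\<lambda>\<phi>. sin \<theta> * f (sph (\<theta>, \<phi>))) has_real_derivative
        (\<lambda>z. sin (fst z) * rot 3 f (sph z)) (\<theta>, \<phi>)) (at \<phi>)"
        for \<theta> \<phi> by (auto intro!: derivative_eq_intros d simp: algebra_simps)
    qed (auto simp: per intro!: continuous_intros c')
  qed
qed

lemma sph_surj:
  assumes "x \<in> S2"
  obtains \<theta> \<phi> where "\<theta> \<in> {0..pi}" "\<phi> \<in> {0..2 * pi}" "x = sph (\<theta>, \<phi>)"
proof -
  have x: "(x $ 1)\<^sup>2 + (x $ 2)\<^sup>2 + (x $ 3)\<^sup>2 = 1"
    using assms by (simp add: norm_vec_def L2_set_def sum_3)
  then have "(x $ 3)\<^sup>2 \<le> 1" by (smt (verit) zero_le_power2)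
  then have x3: "\<bar>x $ 3\<bar> \<le> 1" by (simp add: abs_square_le_1)
  define \<theta> where "\<theta> = arccos (x $ 3)"
  have \<theta>: "\<theta> \<in> {0..pi}" "cos \<theta> = x $ 3"
    using x3 by (auto simp: \<theta>_def arccos_lbound arccos_ubound abs_le_iff)
  have s: "(x $ 1)\<^sup>2 + (x $ 2)\<^sup>2 = (sin \<theta>)\<^sup>2"
    using x sin_squared_eq[of \<theta>] \<theta> by simp
  obtain \<phi> where \<phi>: "\<phi> \<in> {0..2 * pi}" "x $ 1 = sin \<theta> * cos \<phi>" "x $ 2 = sin \<theta> * sin \<phi>"
  proof (cases "sin \<theta> = 0")
    case True
    then have "x $ 1 = 0" "x $ 2 = 0" using s by (auto simp: sum_power2_eq_zero_iff)
    \<comment> \<open>At a pole any longitude will do.\<close>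
    then show ?thesis using True by (intro that[of 0]) auto
  next
    case False
    then have "(x $ 1 / sin \<theta>)\<^sup>2 + (x $ 2 / sin \<theta>)\<^sup>2 = 1"
      using s by (simp add: power_divide add_divide_distrib[symmetric])
    then obtain \<phi> where "0 \<le> \<phi>" "\<phi> < 2 * pi" "x $ 1 / sin \<theta> = cos \<phi>" "x $ 2 / sin \<theta> = sin \<phi>"
      using sincos_total_2pi by blast
    then show ?thesis using False by (intro that[of \<phi>]) (auto simp: field_simps)
  qed
  show ?thesis using \<theta> \<phi> by (intro that[of \<theta> \<phi>]) (auto simp: vec_eq_iff forall_3 sph_components)
qed

text \<open>
  Join the two points by an arc of a meridian and an arc of a parallel. Along these the derivative
  is a combination of the \<open>L\<^sub>i f\<close> with coefficients bounded by \<open>1\<close>.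
\<close>

lemma oscillation_bound:
  assumes f: "polyf f" and g: "\<And>x. x \<in> S2 \<Longrightarrow> sq_gradient f x \<le> \<delta>\<^sup>2" and \<delta>: "\<delta> \<ge> 0"
    and xy: "x \<in> S2" "y \<in> S2"
  shows "\<bar>f x - f y\<bar> \<le> 4 * pi * \<delta>"
proof -
  have r: "\<bar>rot i f z\<bar> \<le> \<delta>" if "z \<in> S2" for i z
  proof (rule power2_le_imp_le[OF _ \<delta>])
    have "(rot i f z)\<^sup>2 \<le> sq_gradient f z"
      unfolding sq_gradient_def power2_eq_square using member_le_sum[of i UNIV "\<lambda>i. rot i f z * rot i f z"] by simp
    then show "\<bar>rot i f z\<bar>\<^sup>2 \<le> \<delta>\<^sup>2" using g[OF that] by simp
  qed
  note r' = r[OF sph_in_S2]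
  obtain \<theta> \<phi> where x: "\<theta> \<in> {0..pi}" "\<phi> \<in> {0..2 * pi}" "x = sph (\<theta>, \<phi>)" using sph_surj[OF xy(1)] by blast
  obtain \<theta>' \<phi>' where y: "\<theta>' \<in> {0..pi}" "\<phi>' \<in> {0..2 * pi}" "y = sph (\<theta>', \<phi>')" using sph_surj[OF xy(2)] by blast
  have "norm (f (sph (\<theta>, \<phi>)) - f (sph (\<theta>', \<phi>))) \<le> (\<delta> + \<delta>) * norm (\<theta> - \<theta>')"
  proof (rule field_differentiable_bound[OF convex_UNIV])
    fix z
    show "((\<lambda>\<theta>. f (sph (\<theta>, \<phi>))) has_real_derivative
      cos \<phi> * rot 2 f (sph (z, \<phi>)) - sin \<phi> * rot 1 f (sph (z, \<phi>))) (at z)" by (rule sph_derivatives[OF f])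
    have "\<bar>cos \<phi> * rot 2 f (sph (z, \<phi>))\<bar> \<le> 1 * \<delta>" "\<bar>sin \<phi> * rot 1 f (sph (z, \<phi>))\<bar> \<le> 1 * \<delta>"
      unfolding abs_mult by (intro mult_mono r'; simp)+
    then show "norm (cos \<phi> * rot 2 f (sph (z, \<phi>)) - sin \<phi> * rot 1 f (sph (z, \<phi>))) \<le> \<delta> + \<delta>"
      by (simp add: abs_le_iff)
  qed auto
  also have "\<dots> \<le> (\<delta> + \<delta>) * pi" using x y \<delta> by (intro mult_left_mono) auto
  finally have 1: "\<bar>f (sph (\<theta>, \<phi>)) - f (sph (\<theta>', \<phi>))\<bar> \<le> 2 * pi * \<delta>" by (simp add: algebra_simps)
  have "norm (f (sph (\<theta>', \<phi>)) - f (sph (\<theta>', \<phi>'))) \<le> \<delta> * norm (\<phi> - \<phi>')"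
  proof (rule field_differentiable_bound[OF convex_UNIV])
    fix z
    show "((\<lambda>\<phi>. f (sph (\<theta>', \<phi>))) has_real_derivative rot 3 f (sph (\<theta>', z))) (at z)"
      by (rule sph_derivatives[OF f])
    show "norm (rot 3 f (sph (\<theta>', z))) \<le> \<delta>" using r' by simp
  qed auto
  also have "\<dots> \<le> \<delta> * (2 * pi)" using x y \<delta> by (intro mult_left_mono) auto
  finally have 2: "\<bar>f (sph (\<theta>', \<phi>)) - f (sph (\<theta>', \<phi>'))\<bar> \<le> 2 * pi * \<delta>" by (simp add: algebra_simps)
  show ?thesis unfolding x(3) y(3) using 1 2 by linarith
qed

section \<open>The uniform law and the flow\<close>

lemma uniform_S2_sets: "sets uniform_S2 = sets S2_borel" "space uniform_S2 = S2"
  by (simp_all add: uniform_S2_def space_sets_sphere_measure space_scale_measure)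

lemma measure_uniform_S2: "measure uniform_S2 A = measure sphere_measure A / (4 * pi)"
  by (simp add: uniform_S2_def)

lemma prob_space_uniform_S2: "prob_space uniform_S2"
proof
  have "emeasure uniform_S2 (space uniform_S2) = ennreal (1 / (4 * pi)) * ennreal (4 * pi)"
    unfolding uniform_S2_sets(2) by (simp add: uniform_S2_def emeasure_sphere_measure)
  also have "\<dots> = 1" by (subst ennreal_mult[symmetric]) auto
  finally show "emeasure uniform_S2 (space uniform_S2) = 1" .
qed

lemma integrable_uniform_S2:
  assumes "polyf f" shows "integrable uniform_S2 f"
  using integrable_continuous_on_S2[OF polyf_continuous_on[OF assms] _ uniform_S2_sets(1)]
    prob_space.axioms(1)[OF prob_space_uniform_S2] by blast

lemma integral_rot_gen_zero:
  assumes f: "polyf f"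
  shows "(\<integral>x. rot_gen \<mu> f x \<partial>uniform_S2) = 0"
proof -
  have "uniform_S2 = density sphere_measure (\<lambda>_. ennreal (1 / (4 * pi)))"
    by (rule measure_eqI) (auto simp: uniform_S2_def emeasure_density_const mult.commute)
  moreover have "rot i g \<in> borel_measurable sphere_measure" if "polyf g" for i g
    using borel_measurable_continuous_on_restrict[OF polyf_continuous_on[OF polyf_rot[OF that]]]
    by (simp cong: measurable_cong_sets add: space_sets_sphere_measure)
  ultimately have "(\<integral>x. rot i g x \<partial>uniform_S2) = 0" if "polyf g" for i g
    using that by (subst \<open>uniform_S2 = _\<close>, subst integral_density) (simp_all add: integral_rot_zero)
  then show ?thesis
    unfolding rot_gen_def using f by (simp add: integrable_uniform_S2 polyf_rot)
qed

lemma time_poly_integral: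
  assumes "time_poly F F'"
  shows "((\<lambda>\<tau>. \<integral>x. F \<tau> x \<partial>uniform_S2) has_real_derivative (\<integral>x. F' \<tau> x \<partial>uniform_S2)) (at \<tau>)"
  using assms
proof induction
  case (base p a a')
  then show ?case by (auto intro!: derivative_eq_intros)
next
  case (add F F' H H')
  note p = time_poly_polyf[OF add(1)] time_poly_polyf[OF add(2)]
  show ?case using DERIV_add[OF add.IH] by (simp add: p integrable_uniform_S2)
qed

lemma flow_integral:
  assumes u: "time_poly u (\<lambda>\<tau>. rot_gen \<mu> (u \<tau>))"
  shows "(\<integral>x. u t x \<partial>uniform_S2) = (\<integral>x. u 0 x \<partial>uniform_S2)"
proof -
  have "\<forall>\<tau>. ((\<lambda>\<tau>. \<integral>x. u \<tau> x \<partial>uniform_S2) has_real_derivative 0) (at \<tau>)"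
    using time_poly_integral[OF u] time_poly_polyf[OF u] by (simp add: integral_rot_gen_zero)
  from DERIV_isconst_all[OF this, of t 0] show ?thesis .
qed

context feller_diffusion
begin

lemma T_integral_uniform:
  assumes "polyf f" "t \<ge> 0"
  shows "(\<integral>x. T t f x \<partial>uniform_S2) = (\<integral>x. f x \<partial>uniform_S2)"
proof -
  obtain u where u: "time_poly u (\<lambda>\<tau>. rot_gen \<mu> (u \<tau>))" "u 0 = f" using rot_gen_flow[OF assms(1)] by blast
  have "(\<integral>x. T t f x \<partial>uniform_S2) = (\<integral>x. u t x \<partial>uniform_S2)"
    using T_eq_flow[OF u(1) _ assms(2)] u(2)
    by (intro Bochner_Integration.integral_cong) (auto simp: uniform_S2_sets)
  then show ?thesis using flow_integral[OF u(1)] u(2) by simp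
qed

text \<open>
  The flow has the same uniform mean at all times, so its distance from the mean of \<open>f\<close> is at most
  its oscillation, which \<open>gradient_bound\<close> controls.
\<close>

lemma T_close_to_uniform:
  assumes f: "polyf f" and b: "\<And>y. y \<in> S2 \<Longrightarrow> \<bar>f y\<bar> \<le> 1" and t: "t > 0" and x: "x \<in> S2"
  shows "\<bar>T t f x - (\<integral>y. f y \<partial>uniform_S2)\<bar> \<le> 4 * pi / sqrt (2 * t)"
proof -
  interpret U: prob_space uniform_S2 by (rule prob_space_uniform_S2)
  obtain u where u: "time_poly u (\<lambda>\<tau>. rot_gen \<mu> (u \<tau>))" "u 0 = f" using rot_gen_flow[OF f] by blast
  have p: "polyf (u t)" by (rule time_poly_polyf[OF u(1)])
  let ?\<delta> = "1 / sqrt (2 * t)"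
  have osc: "\<bar>u t x - u t y\<bar> \<le> 4 * pi * ?\<delta>" if "y \<in> S2" for y
  proof (rule oscillation_bound[OF p _ _ x that])
    fix z assume "z \<in> S2"
    then have "2 * t * sq_gradient (u t) z \<le> 1" using gradient_bound[OF u(1), of z t] b u(2) t by simp
    then show "sq_gradient (u t) z \<le> ?\<delta>\<^sup>2" using t by (simp add: power_divide field_simps)
  qed (use t in simp)
  have "T t f x - (\<integral>y. f y \<partial>uniform_S2) = u t x - (\<integral>y. u t y \<partial>uniform_S2)"
    using T_eq_flow[OF u(1) x, of t] flow_integral[OF u(1), of t] t u(2) by simp
  also have "\<dots> = (\<integral>y. u t x - u t y \<partial>uniform_S2)"
    using integrable_uniform_S2[OF p] U.prob_space by simp
  also have "\<bar>\<dots>\<bar> \<le> (\<integral>y. \<bar>u t x - u t y\<bar> \<partial>uniform_S2)"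
    by (rule integral_abs_bound)
  also have "\<dots> \<le> (\<integral>y. 4 * pi * ?\<delta> \<partial>uniform_S2)"
    using integrable_uniform_S2[OF p] osc
    by (intro integral_mono) (auto simp: uniform_S2_sets)
  finally show ?thesis using U.prob_space by simp
qed

end

section \<open>Convergence in total variation\<close>

text \<open>
  An estimate on polynomials passes to continuous functions by the Stone-Weierstrass theorem (the
  approximating polynomial has to be rescaled to keep its bound), to compact sets by decreasing
  continuous approximations of the indicator, and to Borel sets by inner regularity. In the last
  step regularity of \<open>M\<close> alone is enough because the estimate is one-sided.
\<close>

lemma measure_diff_le_of_polynomials:
  fixes M N :: "(real^3) measure"
  assumes M: "prob_space M" "sets M = sets S2_borel" and N: "prob_space N" "sets N = sets S2_borel"
    and e: "e \<ge> 0" "\<And>f. polyf f \<Longrightarrow> (\<And>x. x \<in> S2 \<Longrightarrow> \<bar>f x\<bar> \<le> 1) \<Longrightarrow> (\<integral>x. f x \<partial>M) - (\<integral>x. f x \<partial>N) \<le> e"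
    and A: "A \<in> sets S2_borel"
  shows "measure M A - measure N A \<le> e"
proof -
  interpret M: prob_space M by fact
  interpret N: prob_space N by fact
  have sp: "space M = S2" "space N = S2"
    using sets_eq_imp_space_eq[OF M(2)] sets_eq_imp_space_eq[OF N(2)] by (simp_all add: space_S2_borel)
  have int: "integrable M g" "integrable N g" if "continuous_on S2 g" for g :: "real^3 \<Rightarrow> real"
    using that M N by (auto intro!: integrable_continuous_on_S2 prob_space.axioms(1))
  have cont: "(\<integral>x. g x \<partial>M) - (\<integral>x. g x \<partial>N) \<le> e"
    if g: "continuous_on S2 g" "\<And>x. x \<in> S2 \<Longrightarrow> \<bar>g x\<bar> \<le> 1" for g :: "real^3 \<Rightarrow> real"
  proof (rule field_le_epsilon)
    fix d :: real assume d: "d > 0"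
    \<comment> \<open>Rescaling costs \<open>\<eta> e\<close> and the two approximations cost \<open>\<eta>\<close> each.\<close>
    define \<eta> where "\<eta> = d / (e + 2)"
    have \<eta>: "\<eta> > 0" "\<eta> * (e + 2) = d" using d e by (auto simp: \<eta>_def)
    obtain p where p: "polyf p" "\<And>x. x \<in> S2 \<Longrightarrow> \<bar>g x - p x\<bar> < \<eta>"
      using Stone_Weierstrass_real_polynomial_function[OF compact_sphere g(1) \<eta>(1)] by blast
    have "(\<integral>x. 1 / (1 + \<eta>) * p x \<partial>M) - (\<integral>x. 1 / (1 + \<eta>) * p x \<partial>N) \<le> e"
    proof (rule e(2))
      fix x :: "real^3" assume x: "x \<in> S2"
      have "\<bar>p x\<bar> \<le> 1 + \<eta>" using p(2)[OF x] g(2)[OF x] by linarith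
      then show "\<bar>1 / (1 + \<eta>) * p x\<bar> \<le> 1" using \<eta> by (simp add: abs_mult)
    qed (intro polyf_intros p)
    then have "1 / (1 + \<eta>) * ((\<integral>x. p x \<partial>M) - (\<integral>x. p x \<partial>N)) \<le> e"
      by (simp add: diff_divide_distrib)
    then have 1: "(\<integral>x. p x \<partial>M) - (\<integral>x. p x \<partial>N) \<le> e * (1 + \<eta>)"
      using \<eta> by (simp add: field_simps)
    have pc: "continuous_on S2 p" using p(1) by (rule polyf_continuous_on)
    have "(\<integral>x. g x \<partial>M) \<le> (\<integral>x. p x + \<eta> \<partial>M)"
      using p(2) by (intro integral_mono int continuous_intros g pc) (fastforce simp: sp abs_less_iff intro: less_imp_le)
    then have 2: "(\<integral>x. g x \<partial>M) \<le> (\<integral>x. p x \<partial>M) + \<eta>"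
      using int(1)[OF pc] M.prob_space by simp
    have "(\<integral>x. p x - \<eta> \<partial>N) \<le> (\<integral>x. g x \<partial>N)"
      using p(2) by (intro integral_mono int continuous_intros g pc) (fastforce simp: sp abs_less_iff intro: less_imp_le)
    then have 3: "(\<integral>x. p x \<partial>N) - \<eta> \<le> (\<integral>x. g x \<partial>N)"
      using int(2)[OF pc] N.prob_space by simp
    have "e * (1 + \<eta>) + 2 * \<eta> = e + d" using \<eta>(2) by (simp add: algebra_simps)
    then show "(\<integral>x. g x \<partial>M) - (\<integral>x. g x \<partial>N) \<le> e + d" using 1 2 3 by linarith
  qed
  have comp: "measure M F - measure N F \<le> e" if F: "compact F" "F \<subseteq> S2" for F
  proof (cases "F = {}")
    case True
    then show ?thesis using e by simp
  next
    case False
    \<comment> \<open>Continuous functions that decrease to the indicator of \<open>F\<close>.\<close>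
    define g where "g n x = max 0 (1 - real n * infdist x F)" for n x
    have gc: "continuous_on S2 (g n)" for n
      unfolding g_def by (intro continuous_intros)
    have g1: "\<bar>g n x\<bar> \<le> 1" for n x
      by (auto simp: g_def infdist_nonneg abs_le_iff max_def)
    have lim: "(\<lambda>n. g n x) \<longlonglongrightarrow> indicator F x" for x
    proof (cases "x \<in> F")
      case True
      then show ?thesis by (simp add: g_def)
    next
      case x: False
      have d: "infdist x F > 0"
        using infdist_pos_not_in_closed[OF compact_imp_closed[OF F(1)] False x] .
      obtain n0 :: nat where n0: "1 / infdist x F < n0" using reals_Archimedean2 by blast
      have "\<forall>\<^sub>F n in sequentially. g n x = indicator F x"
      proof (rule eventually_sequentiallyI)
        fix n assume "n \<ge> n0"
        then have "1 / infdist x F \<le> n" using n0 by linarith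
        then have "1 \<le> n * infdist x F" using d by (simp add: field_simps)
        then show "g n x = indicator F x" using x by (simp add: g_def)
      qed
      then show ?thesis by (rule tendsto_eventually)
    qed
    have Fs: "F \<in> sets M" "F \<in> sets N"
      using F borel_closed[OF compact_imp_closed[OF F(1)]] by (auto simp: M N sets_restrict_space_iff)
    have "(\<lambda>n. \<integral>x. g n x \<partial>M) \<longlonglongrightarrow> (\<integral>x. indicator F x \<partial>M)"
      by (rule integral_dominated_convergence[where w = "\<lambda>_. 1"])
        (use Fs g1 lim int[OF gc] in auto)
    moreover have "(\<lambda>n. \<integral>x. g n x \<partial>N) \<longlonglongrightarrow> (\<integral>x. indicator F x \<partial>N)"
      by (rule integral_dominated_convergence[where w = "\<lambda>_. 1"])
        (use Fs g1 lim int[OF gc] in auto)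
    ultimately have "(\<lambda>n. (\<integral>x. g n x \<partial>M) - (\<integral>x. g n x \<partial>N)) \<longlonglongrightarrow> measure M F - measure N F"
      using Fs by (intro tendsto_diff) simp_all
    then show ?thesis
      by (rule LIMSEQ_le_const2) (intro exI[of _ 0] allI impI cont gc g1)
  qed
  have A': "A \<in> sets borel" "A \<subseteq> S2" using A by (auto simp: sets_restrict_space_iff)
  let ?M = "distr M borel (\<lambda>x. x)"
  have id: "(\<lambda>x. x) \<in> M \<rightarrow>\<^sub>M borel"
    using measurable_restrict_space1[of "\<lambda>x. x" borel borel S2] by (simp add: measurable_cong_sets[OF M(2) refl])
  have eM: "emeasure ?M B = emeasure M B" if "B \<in> sets borel" "B \<subseteq> S2" for B
    using that by (subst emeasure_distr[OF id]) (auto simp: sp Int_absorb2)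
  have fin: "emeasure ?M (space ?M) \<noteq> \<infinity>"
    using prob_space.emeasure_space_1[OF M.prob_space_distr[OF id]] by simp
  have reg: "emeasure M A = (SUP F\<in>{F. F \<subseteq> A \<and> compact F}. emeasure ?M F)"
    using inner_regular[of ?M A] fin A' by (simp add: eM)
  show ?thesis
  proof (rule field_le_epsilon)
    fix d :: real assume d: "d > 0"
    have "\<exists>F. F \<subseteq> A \<and> compact F \<and> measure M A \<le> measure M F + d"
    proof (rule ccontr)
      assume "\<not> ?thesis"
      then have *: "measure M F \<le> measure M A - d" if "F \<subseteq> A" "compact F" for F
        using that by force
      have "emeasure M A \<le> ennreal (measure M A - d)"
        unfolding reg
      proof (rule SUP_least)
        fix F assume "F \<in> {F. F \<subseteq> A \<and> compact F}"
        then have F: "F \<subseteq> A" "compact F" by auto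
        then have "emeasure ?M F = ennreal (measure M F)"
          using A' by (subst eM) (auto simp: M.emeasure_eq_measure compact_imp_closed)
        then show "emeasure ?M F \<le> ennreal (measure M A - d)"
          using *[OF F] by (simp add: ennreal_leI)
      qed
      moreover have "0 \<le> measure M A - d" using *[of "{}"] by simp
      ultimately show False using d by (simp add: M.emeasure_eq_measure)
    qed
    then obtain F where F: "F \<subseteq> A" "compact F" "measure M A \<le> measure M F + d" by blast
    have "measure N F \<le> measure N A" using F A N by (intro N.finite_measure_mono) auto
    moreover have "measure M F - measure N F \<le> e" using comp F A' by blast
    ultimately show "measure M A - measure N A \<le> e + d" using F(3) by linarith
  qed
qed

lemma abs_measure_diff_le_of_polynomials:
  fixes M N :: "(real^3) measure"
  assumes M: "prob_space M" "sets M = sets S2_borel" and N: "prob_space N" "sets N = sets S2_borel"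
    and e: "\<And>f. polyf f \<Longrightarrow> (\<And>x. x \<in> S2 \<Longrightarrow> \<bar>f x\<bar> \<le> 1) \<Longrightarrow> \<bar>(\<integral>x. f x \<partial>M) - (\<integral>x. f x \<partial>N)\<bar> \<le> e"
    and A: "A \<in> sets S2_borel"
  shows "\<bar>measure M A - measure N A\<bar> \<le> e"
proof -
  have "e \<ge> 0" using e[of "\<lambda>_. 0"] by (simp add: polyf_intros)
  moreover have "(\<integral>x. f x \<partial>M) - (\<integral>x. f x \<partial>N) \<le> e" "(\<integral>x. f x \<partial>N) - (\<integral>x. f x \<partial>M) \<le> e"
    if "polyf f" "\<And>x. x \<in> S2 \<Longrightarrow> \<bar>f x\<bar> \<le> 1" for f
    using e[OF that] by (simp_all add: abs_le_iff)
  ultimately show ?thesis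
    using measure_diff_le_of_polynomials[OF M N _ _ A, of e] measure_diff_le_of_polynomials[OF N M _ _ A, of e]
    by (simp add: abs_le_iff)
qed

context feller_diffusion
begin

lemma K_close_to_uniform:
  assumes "t > 0" "x \<in> S2" "A \<in> sets S2_borel"
  shows "\<bar>measure (K t x) A - measure uniform_S2 A\<bar> \<le> 4 * pi / sqrt (2 * t)"
  using T_close_to_uniform[OF _ _ assms(1,2)] assms
  by (intro abs_measure_diff_le_of_polynomials K_prob prob_space_uniform_S2 uniform_S2_sets)
    (auto simp: T_def)

lemma K_measure_measurable:
  assumes "t \<ge> 0" "A \<in> sets S2_borel"
  shows "(\<lambda>x. measure (K t x) A) \<in> borel_measurable S2_borel"
  using measurable_compose[OF K_measurable[OF assms(1)] measurable_measure_prob_algebra[OF assms(2)]] .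

lemma bind_K:
  assumes I: "prob_space I" "sets I = sets S2_borel" and t: "t \<ge> 0"
  shows "prob_space (I \<bind> K t)" "sets (I \<bind> K t) = sets S2_borel"
    and "f \<in> borel_measurable S2_borel \<Longrightarrow> (\<And>x. x \<in> S2 \<Longrightarrow> \<bar>f x\<bar> \<le> 1) \<Longrightarrow>
      (\<integral>x. f x \<partial>(I \<bind> K t)) = (\<integral>x. T t f x \<partial>I)"
proof -
  have Kt: "K t \<in> I \<rightarrow>\<^sub>M prob_algebra S2_borel"
    using K_measurable[OF t] by (simp add: measurable_cong_sets[OF I(2) refl])
  have sp: "space I = S2" using sets_eq_imp_space_eq[OF I(2)] by (simp add: space_S2_borel)
  have "I \<in> space (prob_algebra I)" using I by (simp add: space_prob_algebra)
  note b = prob_space_bind'[OF this Kt] sets_bind'[OF this Kt]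
  show "prob_space (I \<bind> K t)" "sets (I \<bind> K t) = sets S2_borel" using b by auto
  assume f: "f \<in> borel_measurable S2_borel" "\<And>x. x \<in> S2 \<Longrightarrow> \<bar>f x\<bar> \<le> 1"
  show "(\<integral>x. f x \<partial>(I \<bind> K t)) = (\<integral>x. T t f x \<partial>I)"
    unfolding T_def
    using f t prob_space.axioms(1)[OF I(1)]
    by (intro integral_bind[where K = S2_borel and B = 1 and B' = 1])
      (auto simp: space_S2_borel sp K_prob measurable_prob_algebraD[OF Kt] intro!: AE_I2 prob_space.emeasure_le_1)
qed

text \<open>
  Both sides are measures of \<open>A\<close>, under the law at time \<open>t\<close> of the process started uniformly and under the
  uniform law. They agree on polynomials, that is, they are within distance \<open>0\<close>.
\<close>

lemma uniform_invariant:
  assumes t: "t \<ge> 0" and A: "A \<in> sets S2_borel"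
  shows "(\<integral>x. measure (K t x) A \<partial>uniform_S2) = measure uniform_S2 A"
proof -
  note b = bind_K[OF prob_space_uniform_S2 uniform_S2_sets(1) t]
  have "\<bar>measure (uniform_S2 \<bind> K t) A - measure uniform_S2 A\<bar> \<le> 0"
  proof (rule abs_measure_diff_le_of_polynomials[OF b(1,2) prob_space_uniform_S2 uniform_S2_sets(1) _ A])
    fix f assume f: "polyf f" "\<And>x. x \<in> S2 \<Longrightarrow> \<bar>f x\<bar> \<le> 1"
    have "f \<in> borel_measurable S2_borel"
      using borel_measurable_continuous_on_restrict polyf_continuous_on[OF f(1)] by blast
    then show "\<bar>(\<integral>x. f x \<partial>(uniform_S2 \<bind> K t)) - (\<integral>x. f x \<partial>uniform_S2)\<bar> \<le> 0"
      using b(3)[OF _ f(2)] T_integral_uniform[OF f(1) t] by simp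
  qed
  moreover have "measure (uniform_S2 \<bind> K t) A = (\<integral>x. T t (indicator A) x \<partial>uniform_S2)"
  proof -
    have "A \<in> sets (uniform_S2 \<bind> K t)" using A b(2) by simp
    moreover have "(\<integral>x. indicator A x \<partial>(uniform_S2 \<bind> K t)) = (\<integral>x. T t (indicator A) x \<partial>uniform_S2)"
      using A by (intro b(3)) (auto simp: indicator_def)
    ultimately show ?thesis by simp
  qed
  moreover have "(\<integral>x. T t (indicator A) x \<partial>uniform_S2) = (\<integral>x. measure (K t x) A \<partial>uniform_S2)"
    using t sets.sets_into_space[OF A]
    by (intro Bochner_Integration.integral_cong)
      (auto simp: T_def uniform_S2_sets K_prob space_S2_borel Int_absorb2)
  ultimately show ?thesis by simp
qed

end

section \<open>Inverse subordinators\<close>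

lemma space_process_sigma [simp]: "space (process_sigma M E X T) = space M"
  by (simp add: process_sigma_def space_measure_of_conv)

lemma sets_process_sigma:
  "sets (process_sigma M E X T) = sigma_sets (space M) (\<Union>t\<in>T. {X t -` B \<inter> space M | B. B \<in> sets E})"
  unfolding process_sigma_def by (rule sets_measure_of) auto

lemma process_sigma_measurable:
  assumes "t \<in> T" "X t \<in> M \<rightarrow>\<^sub>M E"
  shows "X t \<in> process_sigma M E X T \<rightarrow>\<^sub>M E"
proof (rule measurableI)
  show "X t x \<in> space E" if "x \<in> space (process_sigma M E X T)" for x
    using that measurable_space[OF assms(2)] by simp
  show "X t -` B \<inter> space (process_sigma M E X T) \<in> sets (process_sigma M E X T)" if "B \<in> sets E" for B
    unfolding sets_process_sigma using that assms(1) by (intro sigma_sets.Basic) auto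
qed

lemma subalgebra_process_sigma:
  assumes "\<And>t. t \<in> T \<Longrightarrow> X t \<in> M \<rightarrow>\<^sub>M E"
  shows "subalgebra M (process_sigma M E X T)"
  unfolding subalgebra_def sets_process_sigma
  using assms by (auto intro!: sets.sigma_sets_subset dest: measurable_sets)

lemma inverse_process_nonneg: "inverse_process S t \<omega> \<ge> 0"
  unfolding inverse_process_def by (auto intro!: cInf_greatest)

lemma inverse_process_ge:
  assumes "mono_on {0..} (\<lambda>t. S t \<omega>)" "n \<ge> 0" "S n \<omega> \<le> s" "\<exists>r>0. S r \<omega> > s"
  shows "inverse_process S s \<omega> \<ge> n"
proof -
  have "n \<le> r" if "r > 0" "S r \<omega> > s" for r
  proof (rule ccontr)
    assume "\<not> n \<le> r"
    then have "S r \<omega> \<le> S n \<omega>" using that assms(2) by (intro mono_onD[OF assms(1)]) auto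
    then show False using that assms(3) by simp
  qed
  then show ?thesis using assms(4) unfolding inverse_process_def by (auto intro!: cInf_greatest)
qed

text \<open>
  By monotonicity the passage over the level can be tested at rational times. The second
  alternative accounts for the paths that never pass it, where the inverse is \<open>0\<close> by convention.
\<close>

lemma inverse_process_less_iff:
  assumes mono: "mono_on {0..} (\<lambda>t. S t \<omega>)"
  shows "inverse_process S s \<omega> < a \<longleftrightarrow>
    (\<exists>q\<in>\<rat>. 0 < q \<and> q < a \<and> S q \<omega> > s) \<or> (0 < a \<and> (\<forall>q\<in>\<rat>. 0 < q \<longrightarrow> S q \<omega> \<le> s))"
proof -
  let ?A = "{r. r > 0 \<and> S r \<omega> > s}"
  have rat: "\<exists>q\<in>\<rat>. 0 < q \<and> q < b \<and> S q \<omega> > s" if r: "r \<in> ?A" "r < b" for r b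
  proof -
    obtain q where q: "q \<in> \<rat>" "r < q" "q < b" using Rats_dense_in_real[OF r(2)] by blast
    have "S r \<omega> \<le> S q \<omega>" using r q by (intro mono_onD[OF mono]) auto
    then show ?thesis using r q by (intro bexI[of _ q]) auto
  qed
  show ?thesis
  proof (cases "?A = {}")
    case True
    then have "inverse_process S s \<omega> = 0" by (auto simp: inverse_process_def)
    moreover have "\<forall>q\<in>\<rat>. 0 < q \<longrightarrow> S q \<omega> \<le> s"
      using True by (metis (mono_tags, lifting) empty_iff mem_Collect_eq not_less)
    ultimately show ?thesis by fastforce
  next
    case False
    then have i: "inverse_process S s \<omega> = Inf ?A" by (auto simp: inverse_process_def)
    have bdd: "bdd_below ?A" by (auto intro: bdd_belowI[of _ 0])
    have "Inf ?A < a \<longleftrightarrow> (\<exists>r\<in>?A. r < a)" using cInf_less_iff[OF False bdd] by blast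
    also have "\<dots> \<longleftrightarrow> (\<exists>q\<in>\<rat>. 0 < q \<and> q < a \<and> S q \<omega> > s)" using rat by fastforce
    finally have 1: "Inf ?A < a \<longleftrightarrow> (\<exists>q\<in>\<rat>. 0 < q \<and> q < a \<and> S q \<omega> > s)" .
    obtain r where "r \<in> ?A" using False by blast
    from rat[OF this, of "r + 1"] have "\<not> (\<forall>q\<in>\<rat>. 0 < q \<longrightarrow> S q \<omega> \<le> s)" by force
    then show ?thesis unfolding i 1 by blast
  qed
qed

lemma inverse_process_measurable:
  assumes mono: "\<And>\<omega>. \<omega> \<in> space M \<Longrightarrow> mono_on {0..} (\<lambda>t. S t \<omega>)"
    and S: "\<And>t. t \<ge> 0 \<Longrightarrow> S t \<in> borel_measurable M"
  shows "inverse_process S s \<in> borel_measurable (process_sigma M borel S {0..})"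
  unfolding borel_measurable_iff_less
proof
  fix a
  let ?F = "process_sigma M borel S {0..}"
  have Sm: "S q \<in> borel_measurable ?F" if "0 < q" for q
    using that S by (intro process_sigma_measurable) auto
  have "{\<omega> \<in> space ?F. inverse_process S s \<omega> < a} =
    (\<Union>q\<in>{q\<in>\<rat>. 0 < q \<and> q < a}. {\<omega> \<in> space ?F. S q \<omega> > s}) \<union>
    (if 0 < a then {\<omega> \<in> space ?F. \<forall>q\<in>{q\<in>\<rat>. 0 < q}. S q \<omega> \<le> s} else {})"
    using inverse_process_less_iff[where S = S, OF mono] by auto
  also have "\<dots> \<in> sets ?F"
  proof -
    have c: "countable {q \<in> \<rat>. R q}" for R :: "real \<Rightarrow> bool" by (rule countable_subset[OF _ countable_rat]) auto
    have "(\<Union>q\<in>{q\<in>\<rat>. 0 < q \<and> q < a}. {\<omega> \<in> space ?F. S q \<omega> > s}) \<in> sets ?F"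
      using Sm by (intro sets.countable_UN'' c borel_measurable_less) auto
    moreover have "{\<omega> \<in> space ?F. \<forall>q\<in>{q\<in>\<rat>. 0 < q}. S q \<omega> \<le> s} \<in> sets ?F"
    proof -
      have U: "(\<Union>q\<in>{q\<in>\<rat>. 0 < q}. {\<omega> \<in> space ?F. S q \<omega> > s}) \<in> sets ?F"
        using Sm by (intro sets.countable_UN'' c borel_measurable_less) auto
      have eq: "{\<omega> \<in> space ?F. \<forall>q\<in>{q\<in>\<rat>. 0 < q}. S q \<omega> \<le> s}
          = space ?F - (\<Union>q\<in>{q\<in>\<rat>. 0 < q}. {\<omega> \<in> space ?F. S q \<omega> > s})"
        by (auto simp: not_less)
      show ?thesis unfolding eq by (rule sets.compl_sets[OF U])
    qed
    ultimately show ?thesis by (simp add: sets.Un)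
  qed
  finally show "{\<omega> \<in> space ?F. inverse_process S s \<omega> < a} \<in> sets ?F" .
qed

text \<open>
  The integrand is positive on \<open>(0, \<infinity>)\<close> and dominated by \<open>min 1 t\<close>, so its integral vanishes only
  for the zero measure.
\<close>

lemma laplace_exponent_pos:
  assumes "levy_measure_inf \<nu>"
  shows "laplace_exponent \<nu> 1 > 0"
proof -
  have s: "sets \<nu> = sets (restrict_space borel {0<..})" and fin: "(\<integral>\<^sup>+t. ennreal (min 1 t) \<partial>\<nu>) < \<infinity>"
    and inf: "emeasure \<nu> {0<..} = \<infinity>" using assms unfolding levy_measure_inf_def by auto
  have sp: "space \<nu> = {0<..}" using sets_eq_imp_space_eq[OF s] by (simp add: space_restrict_space)
  have m: "f \<in> borel_measurable \<nu>" if "f \<in> borel_measurable borel" for f :: "real \<Rightarrow> real"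
    using measurable_restrict_space1[OF that] by (simp add: measurable_cong_sets[OF s refl])
  have 1: "integrable \<nu> (\<lambda>t. min 1 t)"
    using fin by (intro integrableI_nonneg m) (auto simp: sp)
  have 2: "integrable \<nu> (\<lambda>t. 1 - exp (- 1 * t))"
  proof (rule Bochner_Integration.integrable_bound[OF 1])
    show "AE t in \<nu>. norm (1 - exp (- 1 * t)) \<le> norm (min 1 t)"
    proof (rule AE_I2)
      fix t assume "t \<in> space \<nu>"
      then have "t > 0" by (simp add: sp)
      moreover have "1 - exp (- t) \<le> t" using exp_ge_add_one_self[of "- t"] by linarith
      ultimately show "norm (1 - exp (- 1 * t)) \<le> norm (min 1 t)" by (auto simp: min_def)
    qed
  qed (intro m, measurable)
  have nn: "AE t in \<nu>. 0 \<le> 1 - exp (- 1 * t)" by (rule AE_I2) (simp add: sp)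
  have "laplace_exponent \<nu> 1 \<noteq> 0"
  proof
    assume "laplace_exponent \<nu> 1 = 0"
    then have "AE t in \<nu>. 1 - exp (- 1 * t) = 0"
      using integral_nonneg_eq_0_iff_AE[OF 2 nn] by (simp add: laplace_exponent_def)
    then have "AE t in \<nu>. False" by (rule AE_mp) (rule AE_I2, simp add: sp)
    then have "emeasure \<nu> (space \<nu>) = 0" by (simp add: AE_iff_null null_sets_def)
    then show False using inf by (simp add: sp)
  qed
  moreover have "laplace_exponent \<nu> 1 \<ge> 0"
    unfolding laplace_exponent_def by (rule integral_nonneg_AE[OF nn])
  ultimately show ?thesis by simp
qed

text \<open>
  By Markov's inequality for \<open>exp (- S k)\<close>, the probability that the path stays below \<open>m\<close> up to
  time \<open>k\<close> is at most \<open>exp (m - k \<Phi>(1))\<close>, which tends to \<open>0\<close>.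
\<close>

lemma subordinator_unbounded:
  assumes "prob_space M" "levy_measure_inf \<nu>" "subordinator M \<nu> S"
  shows "AE \<omega> in M. \<forall>s. \<exists>r>0. S r \<omega> > s"
proof -
  interpret prob_space M by fact
  let ?\<Phi> = "laplace_exponent \<nu> 1"
  have \<Phi>: "?\<Phi> > 0" using assms(2) by (rule laplace_exponent_pos)
  have Sm [measurable]: "S t \<in> borel_measurable M" if "t \<ge> 0" for t
    using assms(3) that by (auto simp: subordinator_def levy_process_def)
  have S0: "S 0 \<omega> = 0" if "\<omega> \<in> space M" for \<omega>
    using assms(3) that by (auto simp: subordinator_def levy_process_def)
  have mono: "mono_on {0..} (\<lambda>t. S t \<omega>)" if "\<omega> \<in> space M" for \<omega>
    using assms(3) that by (auto simp: subordinator_def)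
  have E: "expectation (\<lambda>\<omega>. exp (- 1 * S t \<omega>)) = exp (- t * ?\<Phi>)" if "t \<ge> 0" for t
  proof -
    from assms(3) have "\<forall>t\<ge>0. \<forall>z\<ge>0. expectation (\<lambda>\<omega>. exp (- z * S t \<omega>)) = exp (- t * laplace_exponent \<nu> z)"
      unfolding subordinator_def by blast
    from this[rule_format, OF that zero_le_one] show ?thesis .
  qed
  have nn: "S t \<omega> \<ge> 0" if "t \<ge> 0" "\<omega> \<in> space M" for t \<omega>
    using mono_onD[OF mono[OF that(2)], of 0 t] S0 that by simp
  have "AE \<omega> in M. \<exists>k::nat. S (Suc k) \<omega> > m" for m :: real
  proof -
    define N where "N = {\<omega> \<in> space M. \<not> (\<exists>k::nat. S (Suc k) \<omega> > m)}"
    have N: "N \<in> sets M" unfolding N_def by measurable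
    have le: "prob N \<le> exp m * exp (- ?\<Phi>) ^ Suc k" for k
    proof -
      have i: "integrable M (\<lambda>\<omega>. exp (- 1 * S (Suc k) \<omega>))"
        using nn by (intro integrable_const_bound[of _ 1]) auto
      have "prob N * exp (- m) = expectation (\<lambda>\<omega>. indicator N \<omega> * exp (- m))"
        using N by simp
      also have "\<dots> \<le> expectation (\<lambda>\<omega>. exp (- 1 * S (Suc k) \<omega>))"
      proof (intro integral_mono i)
        show "integrable M (\<lambda>\<omega>. indicator N \<omega> * exp (- m))"
          using N by (intro integrable_mult_left integrable_real_indicator) (auto simp: emeasure_eq_measure)
        show "indicator N \<omega> * exp (- m) \<le> exp (- 1 * S (Suc k) \<omega>)" if "\<omega> \<in> space M" for \<omega>
          by (auto simp: indicator_def N_def not_less simp del: of_nat_Suc)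
      qed
      also have "\<dots> = exp (- ?\<Phi>) ^ Suc k"
        unfolding E[OF of_nat_0_le_iff] exp_of_nat_mult[symmetric] by (simp add: algebra_simps)
      finally show ?thesis by (simp add: exp_minus[of m] field_simps del: power_Suc)
    qed
    have lim: "(\<lambda>k. exp m * exp (- ?\<Phi>) ^ Suc k) \<longlonglongrightarrow> exp m * 0"
      using \<Phi> by (intro tendsto_mult tendsto_const LIMSEQ_Suc LIMSEQ_power_zero) auto
    have "prob N \<le> exp m * 0"
      by (rule LIMSEQ_le_const[OF lim]) (use le in blast)
    then have "prob N = 0" by (simp add: measure_le_0_iff)
    then have "N \<in> null_sets M" using N by (auto simp: emeasure_eq_measure)
    then show ?thesis by (rule AE_I') (simp add: N_def)
  qed
  then have "AE \<omega> in M. \<forall>m::nat. \<exists>k::nat. S (Suc k) \<omega> > m" by (simp add: AE_all_countable)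
  then show ?thesis
  proof (rule AE_mp, intro AE_I2 impI allI)
    fix \<omega> and s :: real assume *: "\<forall>m::nat. \<exists>k::nat. S (Suc k) \<omega> > m"
    obtain m :: nat where "s < m" using reals_Archimedean2 by blast
    moreover obtain k :: nat where "S (Suc k) \<omega> > m" using * by blast
    ultimately show "\<exists>r>0. S r \<omega> > s" by (intro exI[of _ "real (Suc k)"]) (auto simp del: of_nat_Suc)
  qed
qed

lemma inverse_process_at_top:
  assumes "mono_on {0..} (\<lambda>t. S t \<omega>)" "\<forall>s. \<exists>r>0. S r \<omega> > s"
  shows "filterlim (\<lambda>s. inverse_process S s \<omega>) at_top at_top"
  unfolding filterlim_at_top
proof
  fix Z :: real
  show "\<forall>\<^sub>F s in at_top. Z \<le> inverse_process S s \<omega>"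
    unfolding eventually_at_top_linorder
  proof (intro exI allI impI)
    fix s assume "s \<ge> S (max 0 Z) \<omega>"
    then have "max 0 Z \<le> inverse_process S s \<omega>" using assms by (intro inverse_process_ge) auto
    then show "Z \<le> inverse_process S s \<omega>" by simp
  qed
qed

section \<open>Independent random times\<close>

text \<open>
  Paths are approximated by their values on the grids of mesh \<open>1 / (n + 1)\<close>, which involve only
  countably many times.
\<close>

lemma jointly_measurable_continuous_paths:
  fixes W :: "real \<Rightarrow> 'w \<Rightarrow> 'e::metric_space"
  assumes W: "\<And>t. t \<ge> 0 \<Longrightarrow> W t \<in> borel_measurable F"
    and c: "\<And>\<omega>. \<omega> \<in> space F \<Longrightarrow> continuous_on {0..} (\<lambda>t. W t \<omega>)"
  shows "(\<lambda>(u, \<omega>). W (max 0 u) \<omega>) \<in> borel_measurable (borel \<Otimes>\<^sub>M F)"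
proof (rule borel_measurable_LIMSEQ_metric)
  let ?r = "\<lambda>n (u::real). max 0 (real_of_int \<lfloor>u * real (Suc n)\<rfloor> / real (Suc n))"
  show "(\<lambda>(u, \<omega>). W (?r n u) \<omega>) \<in> borel_measurable (borel \<Otimes>\<^sub>M F)" for n
  proof -
    have "(\<lambda>p. (\<lambda>i p. W (max 0 (real_of_int i / real (Suc n))) (snd p)) \<lfloor>fst p * real (Suc n)\<rfloor> p)
       \<in> borel_measurable (borel \<Otimes>\<^sub>M F)"
      by (rule measurable_compose_countable[OF measurable_compose[OF measurable_snd W]]) measurable
    then show ?thesis by (simp add: case_prod_beta')
  qed
  fix p :: "real \<times> 'w" assume "p \<in> space (borel \<Otimes>\<^sub>M F)"
  then obtain u \<omega> where p: "p = (u, \<omega>)" "\<omega> \<in> space F" by (auto simp: space_pair_measure)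
  have "(\<lambda>n. real_of_int \<lfloor>u * real (Suc n)\<rfloor> / real (Suc n)) \<longlonglongrightarrow> u"
  proof (rule tendsto_sandwich)
    show "\<forall>\<^sub>F n in sequentially. u - inverse (real (Suc n)) \<le> real_of_int \<lfloor>u * real (Suc n)\<rfloor> / real (Suc n)"
    proof (intro always_eventually allI)
      fix n
      have "u * real (Suc n) - 1 \<le> real_of_int \<lfloor>u * real (Suc n)\<rfloor>" by linarith
      then have "(u * real (Suc n) - 1) / real (Suc n) \<le> real_of_int \<lfloor>u * real (Suc n)\<rfloor> / real (Suc n)"
        by (intro divide_right_mono) auto
      then show "u - inverse (real (Suc n)) \<le> real_of_int \<lfloor>u * real (Suc n)\<rfloor> / real (Suc n)"
        by (simp add: diff_divide_distrib inverse_eq_divide)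
    qed
    show "\<forall>\<^sub>F n in sequentially. real_of_int \<lfloor>u * real (Suc n)\<rfloor> / real (Suc n) \<le> u"
    proof (intro always_eventually allI)
      fix n
      have "real_of_int \<lfloor>u * real (Suc n)\<rfloor> / real (Suc n) \<le> (u * real (Suc n)) / real (Suc n)"
        by (intro divide_right_mono) auto
      then show "real_of_int \<lfloor>u * real (Suc n)\<rfloor> / real (Suc n) \<le> u" by simp
    qed
    show "(\<lambda>n. u - inverse (real (Suc n))) \<longlonglongrightarrow> u"
      using tendsto_diff[OF tendsto_const LIMSEQ_inverse_real_of_nat, of u] by simp
  qed simp
  then have "(\<lambda>n. ?r n u) \<longlonglongrightarrow> max 0 u" by (intro tendsto_max tendsto_const)
  then have "(\<lambda>n. W (?r n u) \<omega>) \<longlonglongrightarrow> W (max 0 u) \<omega>"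
    by (rule continuous_on_tendsto_compose[OF c[OF p(2)]]) auto
  then show "(\<lambda>n. case p of (u, \<omega>) \<Rightarrow> W (?r n u) \<omega>) \<longlonglongrightarrow> (case p of (u, \<omega>) \<Rightarrow> W (max 0 u) \<omega>)"
    by (simp add: p)
qed

text \<open>
  Independence makes the joint law of \<open>(L \<omega>, \<omega>)\<close> on \<open>borel \<Otimes>\<^sub>M F\<close> a product, so that the random time
  can be frozen by Fubini's theorem.
\<close>

lemma prob_independent_time:
  fixes W :: "real \<Rightarrow> 'w \<Rightarrow> 'e::metric_space"
  assumes "prob_space M" and F: "subalgebra M F" and H: "subalgebra M H"
    and ind: "prob_space.indep_set M (sets F) (sets H)"
    and W: "\<And>t. t \<ge> 0 \<Longrightarrow> W t \<in> borel_measurable F"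
    and c: "\<And>\<omega>. \<omega> \<in> space M \<Longrightarrow> continuous_on {0..} (\<lambda>t. W t \<omega>)"
    and L: "L \<in> borel_measurable H" "\<And>\<omega>. L \<omega> \<ge> 0" and A: "A \<in> sets borel"
  defines "p \<equiv> \<lambda>u. measure M {\<omega> \<in> space M. W (max 0 u) \<omega> \<in> A}"
  shows "(\<lambda>\<omega>. p (L \<omega>)) \<in> borel_measurable M"
    and "measure M {\<omega> \<in> space M. W (L \<omega>) \<omega> \<in> A} = (\<integral>\<omega>. p (L \<omega>) \<partial>M)"
proof -
  interpret prob_space M by fact
  have sp: "space F = space M" "space H = space M" using F H by (auto simp: subalgebra_def)
  have LM: "L \<in> borel_measurable M" using measurable_from_subalg[OF H L(1)] .
  have idF: "(\<lambda>\<omega>. \<omega>) \<in> M \<rightarrow>\<^sub>M F" using F by (auto simp: measurable_def subalgebra_def)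
  let ?QL = "distr M borel L" and ?QF = "distr M F (\<lambda>\<omega>. \<omega>)"
  interpret QL: prob_space ?QL by (rule prob_space_distr[OF LM])
  interpret QF: prob_space ?QF by (rule prob_space_distr[OF idF])
  interpret P: pair_prob_space ?QL ?QF ..
  have LF: "(\<lambda>\<omega>. (L \<omega>, \<omega>)) \<in> M \<rightarrow>\<^sub>M borel \<Otimes>\<^sub>M F" by (rule measurable_Pair[OF LM idF])
  have joint: "?QL \<Otimes>\<^sub>M ?QF = distr M (borel \<Otimes>\<^sub>M F) (\<lambda>\<omega>. (L \<omega>, \<omega>))"
  proof (rule pair_measure_eqI[OF QL.sigma_finite_measure_axioms QF.sigma_finite_measure_axioms])
    show "sets (?QL \<Otimes>\<^sub>M ?QF) = sets (distr M (borel \<Otimes>\<^sub>M F) (\<lambda>\<omega>. (L \<omega>, \<omega>)))"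
      by (simp cong: sets_pair_measure_cong)
    fix C B assume "C \<in> sets ?QL" "B \<in> sets ?QF"
    then have C: "C \<in> sets borel" and B: "B \<in> sets F" by simp_all
    have LC: "L -` C \<inter> space M \<in> sets H" using measurable_sets[OF L(1) C] sp by simp
    have BM: "B \<subseteq> space M" using sets.sets_into_space[OF B] sp by simp
    have "emeasure (distr M (borel \<Otimes>\<^sub>M F) (\<lambda>\<omega>. (L \<omega>, \<omega>))) (C \<times> B)
        = emeasure M (B \<inter> (L -` C \<inter> space M))"
      using B C BM by (subst emeasure_distr[OF LF]) (auto intro!: arg_cong2[where f = emeasure])
    also have "\<dots> = emeasure M (L -` C \<inter> space M) * emeasure M B"
      using indep_setD[OF ind B LC] by (simp add: emeasure_eq_measure ennreal_mult mult.commute)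
    also have "\<dots> = emeasure ?QL C * emeasure ?QF B"
      using B C BM by (simp add: emeasure_distr[OF LM] emeasure_distr[OF idF] Int_absorb2)
    finally show "emeasure ?QL C * emeasure ?QF B
      = emeasure (distr M (borel \<Otimes>\<^sub>M F) (\<lambda>\<omega>. (L \<omega>, \<omega>))) (C \<times> B)" ..
  qed
  let ?G = "\<lambda>(u, \<omega>). W (max 0 u) \<omega>"
  have G: "?G \<in> borel_measurable (borel \<Otimes>\<^sub>M F)"
    using W c sp by (intro jointly_measurable_continuous_paths) auto
  let ?f = "\<lambda>(u, \<omega>). indicator A (W (max 0 u) \<omega>) :: real"
  have f: "?f \<in> borel_measurable (borel \<Otimes>\<^sub>M F)"
    using measurable_compose[OF G borel_measurable_indicator[OF A]] by (simp add: case_prod_beta')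
  have eq: "sets (?QL \<Otimes>\<^sub>M ?QF) = sets (borel \<Otimes>\<^sub>M F)" by (intro sets_pair_measure_cong) auto
  have int: "integrable (?QL \<Otimes>\<^sub>M ?QF) ?f"
    using f by (intro P.P.integrable_const_bound[of _ 1])
      (auto simp: measurable_cong_sets[OF eq refl] indicator_def)
  have WA: "{\<omega> \<in> space M. W (max 0 u) \<omega> \<in> A} \<in> sets M" for u
    using measurable_sets[OF measurable_from_subalg[OF F W] A, of "max 0 u"]
    by (simp add: vimage_def Int_def conj_commute)
  have inner: "(\<integral>\<omega>. ?f (u, \<omega>) \<partial>?QF) = p u" for u
  proof -
    have "(\<lambda>\<omega>. indicator A (W (max 0 u) \<omega>) :: real) \<in> borel_measurable F"
      using measurable_compose[OF W[of "max 0 u"] borel_measurable_indicator[OF A]] by simp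
    then have "(\<integral>\<omega>. ?f (u, \<omega>) \<partial>?QF) = (\<integral>\<omega>. indicator A (W (max 0 u) \<omega>) \<partial>M)"
      by (simp add: integral_distr[OF idF])
    also have "\<dots> = (\<integral>\<omega>. indicator {\<omega> \<in> space M. W (max 0 u) \<omega> \<in> A} \<omega> \<partial>M)"
      by (intro Bochner_Integration.integral_cong) (auto simp: indicator_def)
    finally show ?thesis using WA by (simp add: p_def)
  qed
  have pm: "p \<in> borel_measurable borel"
  proof -
    have "?f \<in> borel_measurable (borel \<Otimes>\<^sub>M ?QF)"
      using f by (simp add: measurable_cong_sets[OF sets_pair_measure_cong[OF refl sets_distr] refl])
    from QF.borel_measurable_lebesgue_integral[OF this]
    have "(\<lambda>u. \<integral>\<omega>. ?f (u, \<omega>) \<partial>?QF) \<in> borel_measurable borel" by simp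
    then show ?thesis unfolding inner .
  qed
  show pL: "(\<lambda>\<omega>. p (L \<omega>)) \<in> borel_measurable M"
    by (rule measurable_compose[OF LM pm])
  have LA: "{\<omega> \<in> space M. W (L \<omega>) \<omega> \<in> A} \<in> sets M"
  proof -
    have "(\<lambda>\<omega>. ?G (L \<omega>, \<omega>)) \<in> borel_measurable M"
      by (rule measurable_compose[OF measurable_Pair[OF LM idF] G])
    then have "(\<lambda>\<omega>. W (L \<omega>) \<omega>) \<in> borel_measurable M" using L(2) by (simp add: max_absorb2)
    from measurable_sets[OF this A] show ?thesis by (simp add: vimage_def Int_def conj_commute)
  qed
  have "measure M {\<omega> \<in> space M. W (L \<omega>) \<omega> \<in> A} = (\<integral>\<omega>. indicator {\<omega> \<in> space M. W (L \<omega>) \<omega> \<in> A} \<omega> \<partial>M)"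
    using LA by simp
  also have "\<dots> = (\<integral>\<omega>. ?f (L \<omega>, \<omega>) \<partial>M)"
    using L(2) by (intro Bochner_Integration.integral_cong) (auto simp: indicator_def max_absorb2)
  also have "\<dots> = (\<integral>z. ?f z \<partial>(?QL \<Otimes>\<^sub>M ?QF))"
    unfolding joint by (rule integral_distr[OF measurable_Pair[OF LM idF] f, symmetric])
  also have "\<dots> = (\<integral>u. p u \<partial>?QL)"
    unfolding P.integral_fst'[OF int, symmetric] inner ..
  also have "\<dots> = (\<integral>\<omega>. p (L \<omega>) \<partial>M)"
    by (rule integral_distr[OF LM pm])
  finally show "measure M {\<omega> \<in> space M. W (L \<omega>) \<omega> \<in> A} = (\<integral>\<omega>. p (L \<omega>) \<partial>M)" .
qed

context feller_diffusion
begin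

text \<open>
  The Markov property at time \<open>0\<close>, integrated over the initial law.
\<close>

lemma diffusion_law:
  assumes "prob_space M" and D: "diffusion_process M K I W" and t: "t \<ge> 0" and A: "A \<in> sets S2_borel"
  shows "measure M {\<omega> \<in> space M. W t \<omega> \<in> A} = (\<integral>x. measure (K t x) A \<partial>I)"
proof -
  interpret prob_space M by fact
  have W: "W s \<in> M \<rightarrow>\<^sub>M S2_borel" if "s \<ge> 0" for s
    using D that by (auto simp: diffusion_process_def)
  have I: "distr M S2_borel (W 0) = I"
    using D by (auto simp: diffusion_process_def)
  \<comment> \<open>The sigma-algebra of the starting point.\<close>
  let ?F = "process_sigma M S2_borel W {0..0}"
  have "subalgebra M ?F" using W by (intro subalgebra_process_sigma) auto
  then interpret finite_measure_subalgebra M ?F by unfold_locales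
  let ?g = "\<lambda>\<omega>. indicator A (W t \<omega>) :: real"
  have g: "?g \<in> borel_measurable M"
    using measurable_compose[OF W[OF t] borel_measurable_indicator[OF A]] .
  have WA: "{\<omega> \<in> space M. W t \<omega> \<in> A} \<in> sets M"
    using measurable_sets[OF W[OF t] A] by (simp add: vimage_def Int_def conj_commute)
  have ae: "AE \<omega> in M. real_cond_exp M ?F ?g \<omega> = measure (K t (W 0 \<omega>)) A"
  proof -
    have "\<forall>s\<ge>0. \<forall>t\<ge>0. \<forall>B\<in>sets S2_borel. AE \<omega> in M.
        real_cond_exp M (process_sigma M S2_borel W {0..s}) (\<lambda>\<omega>'. indicator B (W (s + t) \<omega>')) \<omega>
          = measure (K t (W s \<omega>)) B"
      using D unfolding diffusion_process_def by blast
    from this[rule_format, OF order_refl t A] show ?thesis by (simp only: add_0_left)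
  qed
  have Km: "(\<lambda>x. measure (K t x) A) \<in> borel_measurable S2_borel" by (rule K_measure_measurable[OF t A])
  have "measure M {\<omega> \<in> space M. W t \<omega> \<in> A} = (\<integral>\<omega>. indicator {\<omega> \<in> space M. W t \<omega> \<in> A} \<omega> \<partial>M)"
    using WA by simp
  also have "\<dots> = (\<integral>\<omega>. 1 * ?g \<omega> \<partial>M)"
    by (intro Bochner_Integration.integral_cong) (auto simp: indicator_def)
  also have "\<dots> = (\<integral>\<omega>. 1 * real_cond_exp M ?F ?g \<omega> \<partial>M)"
    using g by (intro real_cond_exp_intg(2)[symmetric] integrable_const_bound[of _ 1]) (auto simp: indicator_def)
  also have "\<dots> = (\<integral>\<omega>. measure (K t (W 0 \<omega>)) A \<partial>M)"
    using ae measurable_compose[OF W[OF order_refl] Km]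
    by (intro integral_cong_AE) (auto intro: borel_measurable_cond_exp2)
  also have "\<dots> = (\<integral>x. measure (K t x) A \<partial>I)"
    unfolding I[symmetric] by (rule integral_distr[OF W[OF order_refl] Km, symmetric])
  finally show ?thesis .
qed

lemma time_changed_prob:
  assumes M: "prob_space M" and D: "diffusion_process M K I W" and S: "subordinator M \<nu> S"
    and ind: "indep_processes M W S" and A: "A \<in> sets S2_borel"
  defines "p \<equiv> \<lambda>u. \<integral>x. measure (K u x) A \<partial>I"
  shows "(\<lambda>\<omega>. p (inverse_process S s \<omega>)) \<in> borel_measurable M"
    and "measure M {\<omega> \<in> space M. time_changed W S s \<omega> \<in> A} = (\<integral>\<omega>. p (inverse_process S s \<omega>) \<partial>M)"
proof -
  have W: "W t \<in> M \<rightarrow>\<^sub>M S2_borel" if "t \<ge> 0" for t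
    using D that by (auto simp: diffusion_process_def)
  have c: "continuous_on {0..} (\<lambda>t. W t \<omega>)" if "\<omega> \<in> space M" for \<omega>
    using D that by (auto simp: diffusion_process_def)
  have Sm: "S t \<in> borel_measurable M" if "t \<ge> 0" for t
    using S that by (auto simp: subordinator_def levy_process_def)
  have mono: "mono_on {0..} (\<lambda>t. S t \<omega>)" if "\<omega> \<in> space M" for \<omega>
    using S that by (auto simp: subordinator_def)
  let ?F = "process_sigma M S2_borel W {0..}" and ?H = "process_sigma M borel S {0..}"
  have F: "subalgebra M ?F" using W by (intro subalgebra_process_sigma) auto
  have H: "subalgebra M ?H" using Sm by (intro subalgebra_process_sigma) auto
  have WF: "W t \<in> borel_measurable ?F" if "t \<ge> 0" for t
    using process_sigma_measurable[of t "{0..}" W M S2_borel] W that by (simp add: measurable_restrict_space2_iff)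
  have A': "A \<in> sets borel" using A by (auto simp: sets_restrict_space_iff)
  have p: "p (inverse_process S s \<omega>) = measure M {\<omega>' \<in> space M. W (max 0 (inverse_process S s \<omega>)) \<omega>' \<in> A}" for \<omega>
    using diffusion_law[OF M D inverse_process_nonneg[of S s \<omega>] A] inverse_process_nonneg[of S s \<omega>]
    by (simp add: p_def max_absorb2)
  have ind': "prob_space.indep_set M (sets ?F) (sets ?H)" using ind by (simp add: indep_processes_def)
  have L: "inverse_process S s \<in> borel_measurable ?H"
    using mono Sm by (rule inverse_process_measurable)
  note * = prob_independent_time[OF M F H ind' WF c L inverse_process_nonneg A']
  show "(\<lambda>\<omega>. p (inverse_process S s \<omega>)) \<in> borel_measurable M" unfolding p by (rule *(1))
  show "measure M {\<omega> \<in> space M. time_changed W S s \<omega> \<in> A} = (\<integral>\<omega>. p (inverse_process S s \<omega>) \<partial>M)"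
    unfolding p time_changed_def by (rule *(2))
qed

lemma law_tendsto_uniform:
  assumes I: "prob_space I" "sets I = sets S2_borel" and A: "A \<in> sets S2_borel"
  shows "((\<lambda>u. \<integral>x. measure (K u x) A \<partial>I) \<longlongrightarrow> measure uniform_S2 A) at_top"
proof (rule LIM_zero_cancel, rule Lim_null_comparison)
  interpret I: prob_space I by fact
  let ?U = "measure uniform_S2 A"
  have sp: "space I = S2" using sets_eq_imp_space_eq[OF I(2)] by (simp add: space_S2_borel)
  show "\<forall>\<^sub>F u in at_top. norm ((\<integral>x. measure (K u x) A \<partial>I) - ?U) \<le> 4 * pi / sqrt (2 * u)"
    using eventually_gt_at_top[of 0]
  proof eventually_elim
    case (elim u)
    have int: "integrable I (\<lambda>x. measure (K u x) A)"
      using K_measure_measurable[of u, OF _ A] elim K_prob(1)[of u]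
      by (intro I.integrable_const_bound[of _ 1])
        (auto simp: measurable_cong_sets[OF I(2) refl] sp prob_space.prob_le_1)
    have "(\<integral>x. measure (K u x) A \<partial>I) - ?U = (\<integral>x. measure (K u x) A - ?U \<partial>I)"
      using int I.prob_space by simp
    also have "\<bar>\<dots>\<bar> \<le> (\<integral>x. \<bar>measure (K u x) A - ?U\<bar> \<partial>I)"
      by (rule integral_abs_bound)
    also have "\<dots> \<le> (\<integral>x. 4 * pi / sqrt (2 * u) \<partial>I)"
      using int K_close_to_uniform[OF elim _ A] by (intro integral_mono) (auto simp: sp)
    finally show ?case using I.prob_space by simp
  qed
  show "((\<lambda>u. 4 * pi / sqrt (2 * u)) \<longlongrightarrow> 0) at_top"
    by (intro real_tendsto_divide_at_top tendsto_const filterlim_compose[OF sqrt_at_top]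
        filterlim_tendsto_pos_mult_at_top[OF tendsto_const] filterlim_ident) auto
qed

end

theorem proposition3p13:
  fixes \<mu> t :: real
    and \<nu> :: "real measure"
    and K :: "real \<Rightarrow> real^3 \<Rightarrow> (real^3) measure"
    and P :: "(real^3) measure \<Rightarrow> 'w measure"
    and W :: "real \<Rightarrow> 'w \<Rightarrow> real^3"
    and S :: "real \<Rightarrow> 'w \<Rightarrow> real"
    and I :: "(real^3) measure"
    and A :: "(real^3) set"
  assumes "levy_measure_inf \<nu>"
    and "feller_transition K" and "generated_by K \<mu>"
    and "\<And>J. prob_space J \<Longrightarrow> sets J = sets S2_borel \<Longrightarrow>
      prob_space (P J) \<and> diffusion_process (P J) K J W \<and> subordinator (P J) \<nu> S \<and>
      indep_processes (P J) W S"
    and "prob_space I" and "sets I = sets S2_borel"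
    and "A \<in> sets borel" and "A \<subseteq> S2"
    and "t > 0"
  shows "((\<lambda>s. measure (P I) {\<omega> \<in> space (P I). time_changed W S s \<omega> \<in> A})
      \<longlongrightarrow> measure sphere_measure A / (4 * pi)) at_top \<and>
    measure sphere_measure A / (4 * pi) =
      measure (P uniform_S2) {\<omega> \<in> space (P uniform_S2). time_changed W S t \<omega> \<in> A}"
proof
  interpret feller_diffusion K \<mu> using assms(2,3) by unfold_locales
  have A: "A \<in> sets S2_borel" using assms(7,8) by (auto simp: sets_restrict_space_iff)
  note PI = assms(4)[OF assms(5,6)]
  interpret M: prob_space "P I" using PI by blast
  let ?p = "\<lambda>u. \<integral>x. measure (K u x) A \<partial>I"
  note tc = time_changed_prob[of "P I" I W \<nu> S A]
  have ae: "AE \<omega> in P I. \<forall>s. \<exists>r>0. S r \<omega> > s"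
    using PI assms(1) by (intro subordinator_unbounded) auto
  have mono: "mono_on {0..} (\<lambda>t. S t \<omega>)" if "\<omega> \<in> space (P I)" for \<omega>
    using PI that by (auto simp: subordinator_def)
  have p1: "\<bar>?p u\<bar> \<le> 1" if "u \<ge> 0" for u
  proof -
    have "?p u = measure (P I) {\<omega> \<in> space (P I). W u \<omega> \<in> A}"
      using diffusion_law[of "P I" I W u A] PI A that by simp
    then show ?thesis by (simp add: measure_nonneg)
  qed
  have "((\<lambda>s. \<integral>\<omega>. ?p (inverse_process S s \<omega>) \<partial>P I) \<longlongrightarrow> (\<integral>\<omega>. measure uniform_S2 A \<partial>P I)) at_top"
  proof (rule integral_dominated_convergence_at_top[where w = "\<lambda>_. 1"])
    show "(\<lambda>\<omega>. ?p (inverse_process S s \<omega>)) \<in> borel_measurable (P I)" for s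
      using tc PI A by blast
    show "AE \<omega> in P I. ((\<lambda>s. ?p (inverse_process S s \<omega>)) \<longlongrightarrow> measure uniform_S2 A) at_top"
      using ae
    proof (rule AE_mp, intro AE_I2 impI)
      fix \<omega> assume \<omega>: "\<omega> \<in> space (P I)" "\<forall>s. \<exists>r>0. S r \<omega> > s"
      show "((\<lambda>s. ?p (inverse_process S s \<omega>)) \<longlongrightarrow> measure uniform_S2 A) at_top"
        by (rule filterlim_compose[OF law_tendsto_uniform[OF assms(5,6) A]
              inverse_process_at_top[where S = S and \<omega> = \<omega>, OF mono[OF \<omega>(1)] \<omega>(2)]])
    qed
    show "\<forall>\<^sub>F s in at_top. AE \<omega> in P I. norm (?p (inverse_process S s \<omega>)) \<le> 1"
      by (intro always_eventually allI AE_I2) (simp only: real_norm_def p1 inverse_process_nonneg)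
  qed auto
  then show "((\<lambda>s. measure (P I) {\<omega> \<in> space (P I). time_changed W S s \<omega> \<in> A})
      \<longlongrightarrow> measure sphere_measure A / (4 * pi)) at_top"
    using tc(2) PI A M.prob_space by (simp add: measure_uniform_S2)
  note PU = assms(4)[OF prob_space_uniform_S2 uniform_S2_sets(1)]
  interpret U: prob_space "P uniform_S2" using PU by blast
  have "measure (P uniform_S2) {\<omega> \<in> space (P uniform_S2). time_changed W S t \<omega> \<in> A}
      = (\<integral>\<omega>. measure uniform_S2 A \<partial>P uniform_S2)"
    using time_changed_prob(2)[of "P uniform_S2" uniform_S2 W \<nu> S A t] PU A
    by (simp add: uniform_invariant[OF inverse_process_nonneg A])
  then show "measure sphere_measure A / (4 * pi) =
      measure (P uniform_S2) {\<omega> \<in> space (P uniform_S2). time_changed W S t \<omega> \<in> A}"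
    using U.prob_space by (simp add: measure_uniform_S2)
qed

end
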